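(* Let $\mathcal{P}$ be a finite classical polar space of rank $n$ and let $t$ be an integer with $1<t<n$. Suppose that $\mathcal{P}$ contains a $t$-Steiner system. Then one of the following holds: (1) $t=2$ and $\mathcal{P}={}^2A_{2n}$ or $\mathcal{P}={}^2D_{n+1}$, with $n$ odd; (2) $t=n-1$ and either $\mathcal{P}={}^2A_{2n}$ or ${}^2D_{n+1}$ with $q\ge 3$, or $\mathcal{P}=D_n$.
   Context: Let $q$ be a prime power. The six finite classical polar spaces of rank $n$ are defined as follows; each consists of the totally isotropic subspaces of a vector space $V$ equipped with a nondegenerate form. A subspace $U$ is totally isotropic if the form vanishes on $U\times U$ (for a sesquilinear/alternating form), respectively if the quadratic form vanishes on every vector of $U$. The maximal totally isotropic subspaces are called generators; in all six cases below they have dimension $n$. - ${}^2A_{2n-1}$: $V=\mathbb{F}_{q^2}^{2n}$ with a nondegenerate Hermitian form. - ${}^2A_{2n}$: $V=\mathbb{F}_{q^2}^{2n+1}$ with a nondegenerate Hermitian form. - $C_n$: $V=\mathbb{F}_q^{2n}$ with a nondegenerate alternating form. - $D_n$: $V=\mathbb{F}_q^{2n}$ with a nondegenerate hyperbolic quadratic form (Witt index $n$). - $B_n$: $V=\mathbb{F}_q^{2n+1}$ with a nondegenerate (parabolic) quadratic form. - ${}^2D_{n+1}$: $V=\mathbb{F}_q^{2n+2}$ with a nondegenerate elliptic quadratic form (Witt index $n$). A $t$-Steiner system in a polar space $\mathcal{P}$ of rank $n$ is a set $Y$ of generators of $\mathcal{P}$ such that every totally isotropic $t$-dimensional subspace of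 $V$ is contained in exactly one member of $Y$. *)

theory Defs
  imports "HOL-Analysis.Cartesian_Space" "HOL-Number_Theory.Prime_Powers"
begin

definition bilinear_form :: "('a::field ^ 'm \<Rightarrow> 'a ^ 'm \<Rightarrow> 'a) \<Rightarrow> bool" where
  "bilinear_form B \<longleftrightarrow>
     (\<forall>v. Vector_Spaces.linear (*s) (*) (\<lambda>u. B u v)) \<and>
     (\<forall>u. Vector_Spaces.linear (*s) (*) (\<lambda>v. B u v))"

definition alternating_form :: "('a::field ^ 'm \<Rightarrow> 'a ^ 'm \<Rightarrow> 'a) \<Rightarrow> bool" where
  "alternating_form B \<longleftrightarrow> bilinear_form B \<and> (\<forall>u. B u u = 0)"

text \<open>
  Over the field with \<open>q\<^sup>2\<close> elements the conjugation is \<open>x \<mapsto> x ^ q\<close>.  Conjugate-linearity in the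
  second argument follows from the two conditions below.
\<close>

definition hermitian_form :: "nat \<Rightarrow> ('a::field ^ 'm \<Rightarrow> 'a ^ 'm \<Rightarrow> 'a) \<Rightarrow> bool" where
  "hermitian_form q B \<longleftrightarrow>
     (\<forall>v. Vector_Spaces.linear (*s) (*) (\<lambda>u. B u v)) \<and>
     (\<forall>u v. B v u = B u v ^ q)"

definition nondegenerate :: "('a::field ^ 'm \<Rightarrow> 'a ^ 'm \<Rightarrow> 'a) \<Rightarrow> bool" where
  "nondegenerate B \<longleftrightarrow> (\<forall>u. (\<forall>v. B u v = 0) \<longrightarrow> u = 0)"

definition polarization :: "('a::field ^ 'm \<Rightarrow> 'a) \<Rightarrow> 'a ^ 'm \<Rightarrow> 'a ^ 'm \<Rightarrow> 'a" where
  "polarization Q u v = Q (u + v) - Q u - Q v"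

definition quadratic_form :: "('a::field ^ 'm \<Rightarrow> 'a) \<Rightarrow> bool" where
  "quadratic_form Q \<longleftrightarrow>
     (\<forall>c u. Q (c *s u) = c\<^sup>2 * Q u) \<and> bilinear_form (polarization Q)"

text \<open>
  In characteristic 2 and odd dimension the polarization always has a nonzero radical, so
  nondegeneracy of a quadratic form only asks that the radical contain no nonzero singular vector.
\<close>

definition nondegenerate_quadratic :: "('a::field ^ 'm \<Rightarrow> 'a) \<Rightarrow> bool" where
  "nondegenerate_quadratic Q \<longleftrightarrow>
     (\<forall>u. Q u = 0 \<and> (\<forall>v. polarization Q u v = 0) \<longrightarrow> u = 0)"

definition isotropic_subspaces :: "('a::field ^ 'm \<Rightarrow> 'a ^ 'm \<Rightarrow> 'a) \<Rightarrow> ('a ^ 'm) set set" where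
  "isotropic_subspaces B = {U. vec.subspace U \<and> (\<forall>u\<in>U. \<forall>v\<in>U. B u v = 0)}"

definition singular_subspaces :: "('a::field ^ 'm \<Rightarrow> 'a) \<Rightarrow> ('a ^ 'm) set set" where
  "singular_subspaces Q = {U. vec.subspace U \<and> (\<forall>u\<in>U. Q u = 0)}"

definition witt_index :: "('a::field ^ 'm \<Rightarrow> 'a) \<Rightarrow> nat" where
  "witt_index Q = Max (vec.dim ` singular_subspaces Q)"

text \<open>
  \<open>Two_A_odd\<close> and \<open>Two_A_even\<close> stand for \<open>\<^sup>2A\<close> with index \<open>2n - 1\<close> and \<open>2n\<close>, that is, Hermitian forms in
  dimension \<open>2n\<close> and \<open>2n + 1\<close>.
\<close>

datatype polar_type = Two_A_odd | Two_A_even | Type_C | Type_D | Type_B | Two_D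

text \<open>
  \<open>classical_polar_space T q n P\<close>: the set \<open>P\<close> of subspaces is the classical polar space of type \<open>T\<close>
  and rank \<open>n\<close> with parameter \<open>q\<close>.  In the Hermitian cases the underlying field has \<open>q\<^sup>2\<close> elements.
\<close>

fun classical_polar_space ::
  "polar_type \<Rightarrow> nat \<Rightarrow> nat \<Rightarrow> ('a::{field,finite} ^ 'm) set set \<Rightarrow> bool" where
  "classical_polar_space Two_A_odd q n P \<longleftrightarrow> CARD('a) = q\<^sup>2 \<and> CARD('m) = 2 * n \<and>
     (\<exists>B. hermitian_form q B \<and> nondegenerate B \<and> P = isotropic_subspaces B)"
| "classical_polar_space Two_A_even q n P \<longleftrightarrow> CARD('a) = q\<^sup>2 \<and> CARD('m) = 2 * n + 1 \<and>
     (\<exists>B. hermitian_form q B \<and> nondegenerate B \<and> P = isotropic_subspaces B)"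
| "classical_polar_space Type_C q n P \<longleftrightarrow> CARD('a) = q \<and> CARD('m) = 2 * n \<and>
     (\<exists>B. alternating_form B \<and> nondegenerate B \<and> P = isotropic_subspaces B)"
| "classical_polar_space Type_D q n P \<longleftrightarrow> CARD('a) = q \<and> CARD('m) = 2 * n \<and>
     (\<exists>Q. quadratic_form Q \<and> nondegenerate_quadratic Q \<and> witt_index Q = n \<and>
          P = singular_subspaces Q)"
| "classical_polar_space Type_B q n P \<longleftrightarrow> CARD('a) = q \<and> CARD('m) = 2 * n + 1 \<and>
     (\<exists>Q. quadratic_form Q \<and> nondegenerate_quadratic Q \<and> P = singular_subspaces Q)"
| "classical_polar_space Two_D q n P \<longleftrightarrow> CARD('a) = q \<and> CARD('m) = 2 * n + 2 \<and>
     (\<exists>Q. quadratic_form Q \<and> nondegenerate_quadratic Q \<and> witt_index Q = n \<and>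
          P = singular_subspaces Q)"

definition generators :: "('a::field ^ 'm) set set \<Rightarrow> ('a ^ 'm) set set" where
  "generators P = {U \<in> P. \<forall>W\<in>P. U \<subseteq> W \<longrightarrow> W = U}"

definition steiner_system ::
  "nat \<Rightarrow> ('a::field ^ 'm) set set \<Rightarrow> ('a ^ 'm) set set \<Rightarrow> bool" where
  "steiner_system t P Y \<longleftrightarrow>
     Y \<subseteq> generators P \<and> (\<forall>U\<in>P. vec.dim U = t \<longrightarrow> (\<exists>!W. W \<in> Y \<and> U \<subseteq> W))"

end

theory Submission
  imports Defs "HOL-Computational_Algebra.Polynomial"
begin

text \<open>
  Let \<open>Q\<close> be the order of the field and \<open>E + 1\<close> the number of generators through a totally isotropic
  subspace of dimension \<open>n - 1\<close>. Passing to the residue of a subspace of dimension \<open>t - 2\<close> or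
  \<open>t - 3\<close> reduces everything to \<open>t = 2\<close> and \<open>t = 3\<close>. Fix a member \<open>U\<close> of the system. The design
  equations express the number of members meeting \<open>U\<close> in a given dimension through few unknowns. On
  the totally isotropic subspaces of dimension \<open>n\<close> or \<open>n - 1\<close>, the function \<open>S \<mapsto> (-1/y)\<close> to the
  power \<open>k - dim (S \<inter> U)\<close> sums to zero over the subspaces through a fixed one of codimension one,
  for a suitable \<open>y\<close>; it generates an eigenspace of the association scheme, and positive
  semidefiniteness of the projection to it is a linear inequality for the intersection numbers. It
  excludes \<open>t = 2\<close> for even rank, \<open>t = 3\<close> for even rank at least \<open>6\<close>, and for \<open>E \<le> Q\<close> also \<open>t = 2\<close>
  for odd rank at least \<open>5\<close>.

  Rank 3 with \<open>1 < E \<le> Q\<close> and rank 4 with \<open>t = 3\<close> over the field with four elements need a finer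
  inequality, which lives on the generators opposite to a fixed member: there one projects the indicator
  function of the system to the functions with vanishing sums over the opposite generators through
  each subspace of dimension \<open>n - 1\<close>.

  For \<open>\<^sup>2D\<close> with \<open>q = 2\<close> the rank 3 residue is the elliptic quadric in projective dimension 7 over the
  field with two elements.  Two disjoint members span a hyperbolic quadric, which fixes coordinates up
  to a small group, and a case analysis shows that they cannot be completed to a Steiner system.
\<close>

section \<open>Counting subspaces over a finite field\<close>

lemma card_biregular:
  assumes "finite A" "finite B"
    and "\<And>x. x \<in> A \<Longrightarrow> card {y \<in> B. R x y} = a"
    and "\<And>y. y \<in> B \<Longrightarrow> card {x \<in> A. R x y} = b"
  shows "card A * a = card B * b"
  using sum_multicount[of A B R b] assms by simp

lemma CARD_field_gt_1: "1 < CARD('a::{field,finite})"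
proof -
  have "card {0, 1 :: 'a} \<le> CARD('a)" by (rule card_mono) auto
  then show ?thesis by simp
qed

lemma card_span_independent:
  fixes B :: "('a::{field,finite} ^ 'm) set"
  assumes "vec.independent B"
  shows "card (vec.span B) = CARD('a) ^ card B"
  using finite[of B] assms
proof (induction B)
  case (insert b B)
  then have b: "b \<notin> vec.span B" and B: "vec.independent B"
    by (simp_all add: vec.independent_insert)
  let ?f = "\<lambda>(c, x). c *s b + x"
  have "bij_betw ?f (UNIV \<times> vec.span B) (vec.span (insert b B))"
  proof (rule bij_betw_imageI)
    show "inj_on ?f (UNIV \<times> vec.span B)"
    proof (clarsimp intro!: inj_onI)
      fix c d x y
      assume xy: "x \<in> vec.span B" "y \<in> vec.span B" and comb_eq: "c *s b + x = d *s b + y"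
      have "(c - d) *s b = y - x"
        using comb_eq by (simp add: vec.scale_left_diff_distrib algebra_simps)
      then have "(c - d) *s b \<in> vec.span B"
        using xy by (simp only: vec.span_diff)
      then have "c = d"
        using b vec.span_scale[of "(c - d) *s b" B "1 / (c - d)"] by (cases "c = d") simp_all
      then show "c = d \<and> x = y" using comb_eq by simp
    qed
    show "?f ` (UNIV \<times> vec.span B) = vec.span (insert b B)"
    proof -
      have "x \<in> ?f ` (UNIV \<times> vec.span B)" if "x - c *s b \<in> vec.span B" for x c
        using that by (intro image_eqI[of _ _ "(c, x - c *s b)"]) auto
      moreover have "c *s b + x - c *s b \<in> vec.span B" if "x \<in> vec.span B" for x c
        using that by simp
      ultimately show ?thesis unfolding vec.span_insert by fast
    qed
  qed
  then have "card (vec.span (insert b B)) = CARD('a) * card (vec.span B)"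
    using bij_betw_same_card by (fastforce simp: card_cartesian_product)
  then show ?case using insert B by simp
qed simp

lemma card_subspace:
  fixes U :: "('a::{field,finite} ^ 'm) set"
  assumes "vec.subspace U"
  shows "card U = CARD('a) ^ vec.dim U"
proof -
  obtain B where "B \<subseteq> U" "vec.independent B" "U \<subseteq> vec.span B" "card B = vec.dim U"
    using vec.basis_exists by metis
  moreover from this have "vec.span B = U"
    using assms by (metis vec.span_minimal subset_antisym)
  ultimately show ?thesis using card_span_independent by metis
qed

lemma card_subspace_diff:
  fixes A B :: "('a::{field,finite} ^ 'm) set"
  assumes "vec.subspace A" "vec.subspace B" "A \<subseteq> B" "vec.dim B = vec.dim A + 1"
  shows "card (B - A) = CARD('a) ^ vec.dim A * (CARD('a) - 1)"
proof -
  have "card (B - A) = CARD('a) ^ (vec.dim A + 1) - CARD('a) ^ vec.dim A"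
    using card_Diff_subset[OF finite assms(3)] card_subspace[OF assms(1)] card_subspace[OF assms(2)]
      assms(4) by simp
  then show ?thesis by (simp add: diff_mult_distrib mult.commute)
qed

lemma span_Un_subspaces:
  fixes U W :: "('a::field ^ 'm) set"
  assumes "vec.subspace U" "vec.subspace W"
  shows "vec.span (U \<union> W) = {x + y |x y. x \<in> U \<and> y \<in> W}"
proof -
  have "vec.span U = U" "vec.span W = W" using assms by (auto simp: vec.span_eq_iff)
  then show ?thesis by (simp only: vec.span_Un)
qed

lemma modular_law:
  fixes A B S :: "('a::field ^ 'm) set"
  assumes "vec.subspace A" "vec.subspace B" "vec.subspace S" "A \<subseteq> S"
  shows "S \<inter> vec.span (A \<union> B) = vec.span (A \<union> (S \<inter> B))"
proof
  show "vec.span (A \<union> (S \<inter> B)) \<subseteq> S \<inter> vec.span (A \<union> B)"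
    using assms by (intro Int_greatest vec.span_minimal vec.span_mono) auto
  show "S \<inter> vec.span (A \<union> B) \<subseteq> vec.span (A \<union> (S \<inter> B))"
  proof
    fix x assume x: "x \<in> S \<inter> vec.span (A \<union> B)"
    then obtain a b where ab: "x = a + b" "a \<in> A" "b \<in> B"
      using span_Un_subspaces[OF assms(1,2)] by blast
    then have "b = x - a" by simp
    then have "b \<in> S \<inter> B" using x ab assms(3,4) vec.subspace_diff by blast
    then show "x \<in> vec.span (A \<union> (S \<inter> B))"
      unfolding ab(1) using ab(2) by (intro vec.span_add vec.span_base) auto
  qed
qed

lemma dim_span_Un:
  fixes U W :: "('a::field ^ 'm) set"
  assumes "vec.subspace U" "vec.subspace W"
  shows "vec.dim (vec.span (U \<union> W)) + vec.dim (U \<inter> W) = vec.dim U + vec.dim W"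
  using vec.dim_sums_Int[OF assms] by (simp only: span_Un_subspaces[OF assms])

lemma dim_span_insert:
  fixes U :: "('a::field ^ 'm) set"
  assumes "vec.subspace U" "x \<notin> U"
  shows "vec.dim (vec.span (insert x U)) = vec.dim U + 1"
proof -
  have "vec.span U = U" using assms by (auto simp: vec.span_eq_iff)
  then have "x \<notin> vec.span U" using assms(2) by metis
  then show ?thesis by (simp only: vec.dim_span vec.dim_insert if_False)
qed

lemma span_insert_eq:
  fixes U :: "('a::field ^ 'm) set"
  assumes "vec.subspace U"
  shows "vec.span (insert x U) = {c *s x + u |c u. u \<in> U}"
proof -
  have "vec.span (insert x U) = vec.span ({x} \<union> U)" by simp
  also have "\<dots> = {a + b |a b. a \<in> vec.span {x} \<and> b \<in> vec.span U}" by (rule vec.span_Un)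
  moreover have "vec.span U = U" using assms by (auto simp: vec.span_eq_iff)
  ultimately show ?thesis by (auto simp: vec.span_singleton)
qed

lemma subspace_eq_span_insert:
  fixes U W :: "('a::field ^ 'm) set"
  assumes "vec.subspace U" "vec.subspace W" "U \<subseteq> W" "vec.dim W = vec.dim U + 1" "x \<in> W" "x \<notin> U"
  shows "W = vec.span (insert x U)"
  using vec.subspace_dim_equal[OF vec.subspace_span assms(2), of "insert x U"]
    dim_span_insert[OF assms(1,6)] assms vec.span_minimal[of "insert x U" W] by auto

lemma Int_eq_hyperplane:
  fixes A S G :: "('a::field ^ 'm) set"
  assumes "vec.subspace A" "vec.subspace S" "vec.subspace G"
    and "A \<subseteq> S" "A \<subseteq> G" "vec.dim S = vec.dim A + 1" "\<not> S \<subseteq> G"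
  shows "S \<inter> G = A"
proof -
  have subspace: "vec.subspace (S \<inter> G)" by (rule vec.subspace_inter[OF assms(2,3)])
  have "\<not> vec.dim S \<le> vec.dim (S \<inter> G)"
    using vec.subspace_dim_equal[OF subspace assms(2)] assms(7) by blast
  then have "vec.dim (S \<inter> G) \<le> vec.dim A" using assms(6) by linarith
  then show ?thesis using vec.subspace_dim_equal[OF assms(1) subspace] assms(4,5) by blast
qed

lemma subspace_eq_span_Un_hyperplane:
  fixes L M W :: "('a::field ^ 'm) set"
  assumes L: "vec.subspace L" "L \<subseteq> W" "vec.dim L + 1 = vec.dim W"
    and M: "vec.subspace M" "M \<subseteq> W" "\<not> M \<subseteq> L"
    and W: "vec.subspace W"
  shows "W = vec.span (L \<union> M)" and "vec.dim (M \<inter> L) + 1 = vec.dim M"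
proof -
  have span_le: "vec.span (L \<union> M) \<subseteq> W" using L M W by (intro vec.span_minimal) auto
  have "vec.dim (L \<inter> M) < vec.dim M"
  proof (rule ccontr)
    assume "\<not> vec.dim (L \<inter> M) < vec.dim M"
    then have "L \<inter> M = M"
      using vec.subspace_dim_equal[OF vec.subspace_inter[OF L(1) M(1)] M(1)] by simp
    then show False using M(3) by blast
  qed
  then have "vec.dim (vec.span (L \<union> M)) = vec.dim W" "vec.dim (L \<inter> M) + 1 = vec.dim M"
    using dim_span_Un[OF L(1) M(1)] L(3) vec.dim_subset[OF span_le] by linarith+
  then show "W = vec.span (L \<union> M)" "vec.dim (M \<inter> L) + 1 = vec.dim M"
    using vec.subspace_dim_equal[OF vec.subspace_span W span_le] by (simp_all add: Int_commute)
qed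

lemma dim_Int_le_Suc:
  fixes A S G :: "('a::field ^ 'm) set"
  assumes "vec.subspace A" "vec.subspace S" "vec.subspace G" "A \<subseteq> S" "vec.dim S = vec.dim A + 1"
  shows "vec.dim (S \<inter> G) \<le> vec.dim (A \<inter> G) + 1"
proof -
  have "vec.subspace (S \<inter> G)" using assms vec.subspace_inter by blast
  moreover have "vec.span (A \<union> (S \<inter> G)) \<subseteq> S" using assms by (intro vec.span_minimal) auto
  then have "vec.dim (vec.span (A \<union> (S \<inter> G))) \<le> vec.dim S" by (rule vec.dim_subset)
  moreover have "A \<inter> (S \<inter> G) = A \<inter> G" using assms by blast
  ultimately show ?thesis using dim_span_Un[OF assms(1), of "S \<inter> G"] assms(5) by simp
qed

definition q_number :: "nat \<Rightarrow> nat \<Rightarrow> nat" where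
  "q_number q k = (\<Sum>i<k. q ^ i)"

lemma q_number_0 [simp]: "q_number q 0 = 0" and q_number_1 [simp]: "q_number q (Suc 0) = 1"
  by (simp_all add: q_number_def)

lemma q_number_Suc: "q_number q (Suc k) = q_number q k + q ^ k"
  by (simp add: q_number_def)

lemma q_number_add: "q_number q (x + y) = q_number q y + q ^ y * q_number q x"
  by (induction x) (simp_all add: q_number_Suc algebra_simps power_add)

lemma q_number_Suc_shift: "q_number q (Suc k) = 1 + q * q_number q k"
  using q_number_add[of q k 1] by simp

lemma q_number_pos: "k > 0 \<Longrightarrow> q_number q k > 0"
  by (cases k) (simp_all add: q_number_Suc_shift)

lemma q_number_mult: "q > 0 \<Longrightarrow> (q - 1) * q_number q k = q ^ k - 1"
proof (induction k)
  case (Suc k)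
  have "(q - 1) * q_number q (Suc k) = (q ^ k - 1) + (q - 1) * q ^ k"
    using Suc by (simp add: q_number_Suc algebra_simps)
  also have "\<dots> = q * q ^ k - 1"
    using Suc.prems by (simp add: diff_mult_distrib)
  finally show ?case by simp
qed simp

definition covers_above :: "('a::field ^ 'm) set \<Rightarrow> ('a ^ 'm) set \<Rightarrow> ('a ^ 'm) set set" where
  "covers_above A B = {S. vec.subspace S \<and> A \<subseteq> S \<and> S \<subseteq> B \<and> vec.dim S = vec.dim A + 1}"

definition covers_below :: "('a::field ^ 'm) set \<Rightarrow> ('a ^ 'm) set \<Rightarrow> ('a ^ 'm) set set" where
  "covers_below A B = {S. vec.subspace S \<and> A \<subseteq> S \<and> S \<subseteq> B \<and> vec.dim S + 1 = vec.dim B}"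

definition subs_between :: "('a::field ^ 'm) set \<Rightarrow> ('a ^ 'm) set \<Rightarrow> nat \<Rightarrow> ('a ^ 'm) set set" where
  "subs_between A B k = {S. vec.subspace S \<and> A \<subseteq> S \<and> S \<subseteq> B \<and> vec.dim S = vec.dim A + k}"

lemma covers_above_partition:
  fixes A B :: "('a::{field,finite} ^ 'm) set"
  assumes A: "vec.subspace A" and B: "vec.subspace B" and AB: "A \<subseteq> B"
  shows "(\<Union>S\<in>covers_above A B. S - A) = B - A"
    and "\<And>S T. S \<in> covers_above A B \<Longrightarrow> T \<in> covers_above A B \<Longrightarrow> S \<noteq> T \<Longrightarrow> (S - A) \<inter> (T - A) = {}"
proof -
  have eq_span: "S = vec.span (insert x A)" if "S \<in> covers_above A B" "x \<in> S" "x \<notin> A" for S x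
    using that A subspace_eq_span_insert[of A S x] by (simp add: covers_above_def)
  show "(S - A) \<inter> (T - A) = {}" if "S \<in> covers_above A B" "T \<in> covers_above A B" "S \<noteq> T" for S T
  proof (rule equals0I)
    fix x assume "x \<in> (S - A) \<inter> (T - A)"
    then have "S = vec.span (insert x A)" "T = vec.span (insert x A)"
      using that(1,2) eq_span by blast+
    then show False using that(3) by simp
  qed
  have "x \<in> (\<Union>S\<in>covers_above A B. S - A)" if x: "x \<in> B - A" for x
  proof -
    have supersets: "x \<in> vec.span (insert x A)" "A \<subseteq> vec.span (insert x A)"
      using vec.span_superset[of "insert x A"] by auto
    moreover have "vec.span (insert x A) \<subseteq> B" using x AB by (intro vec.span_minimal B) auto
    ultimately have "vec.span (insert x A) \<in> covers_above A B"
      using x dim_span_insert[OF A, of x] by (simp add: covers_above_def)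
    then show ?thesis using x supersets(1) by blast
  qed
  moreover have "S - A \<subseteq> B - A" if "S \<in> covers_above A B" for S
    using that by (auto simp: covers_above_def)
  ultimately show "(\<Union>S\<in>covers_above A B. S - A) = B - A" by blast
qed

lemma card_covers_above:
  fixes A B :: "('a::{field,finite} ^ 'm) set"
  assumes A: "vec.subspace A" and B: "vec.subspace B" and AB: "A \<subseteq> B"
  shows "card (covers_above A B) = q_number CARD('a) (vec.dim B - vec.dim A)"
proof -
  let ?q = "CARD('a)" and ?a = "vec.dim A" and ?b = "vec.dim B"
  have card_cell: "card (S - A) = ?q ^ ?a * (?q - 1)" if "S \<in> covers_above A B" for S
    using that card_subspace_diff[OF A, of S] by (auto simp: covers_above_def)
  have "card (B - A) = (\<Sum>S\<in>covers_above A B. card (S - A))"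
    unfolding covers_above_partition(1)[OF assms, symmetric]
    by (rule card_UN_disjoint) (simp_all add: covers_above_partition(2)[OF assms])
  also have "\<dots> = card (covers_above A B) * (?q ^ ?a * (?q - 1))" using card_cell by simp
  finally have "card (covers_above A B) * (?q ^ ?a * (?q - 1)) = ?q ^ ?b - ?q ^ ?a"
    using card_subspace[OF A] card_subspace[OF B] AB by (simp add: card_Diff_subset)
  also have "\<dots> = ?q ^ ?a * (?q ^ (?b - ?a) - 1)"
    using vec.dim_subset[OF AB] by (simp add: diff_mult_distrib2 flip: power_add)
  also have "\<dots> = ?q ^ ?a * ((?q - 1) * q_number ?q (?b - ?a))"
    by (subst q_number_mult) simp_all
  finally have "(?q ^ ?a * (?q - 1)) * card (covers_above A B)
      = (?q ^ ?a * (?q - 1)) * q_number ?q (?b - ?a)"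
    by (simp add: algebra_simps)
  moreover have "?q ^ ?a * (?q - 1) \<noteq> 0" using CARD_field_gt_1[where 'a = 'a] by simp
  ultimately show ?thesis by (metis mult_left_cancel)
qed

lemma subs_between_0:
  fixes A B :: "('a::field ^ 'm) set"
  assumes "vec.subspace A" "A \<subseteq> B"
  shows "subs_between A B 0 = {A}"
proof -
  have "S = A" if "vec.subspace S" "A \<subseteq> S" "vec.dim S = vec.dim A + 0" for S
    using vec.subspace_dim_equal[OF assms(1) that(1,2)] that(3) by simp
  then show ?thesis using assms unfolding subs_between_def by auto
qed

lemma subs_between_full:
  fixes A B :: "('a::field ^ 'm) set"
  assumes "vec.subspace B" "A \<subseteq> B" "vec.dim B = vec.dim A + k"
  shows "subs_between A B k = {B}"
proof -
  have "S = B" if "vec.subspace S" "S \<subseteq> B" "vec.dim S = vec.dim A + k" for S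
    using vec.subspace_dim_equal[OF that(1) assms(1) that(2)] that(3) assms(3) by simp
  then show ?thesis using assms unfolding subs_between_def by blast
qed

lemma card_covers_below:
  fixes A B :: "('a::{field,finite} ^ 'm) set"
  assumes "vec.subspace A" "vec.subspace B" "A \<subseteq> B"
  shows "card (covers_below A B) = q_number CARD('a) (vec.dim B - vec.dim A)"
  using assms
proof (induction "vec.dim B - vec.dim A" arbitrary: A)
  case 0
  then have "covers_below A B = {}" by (auto simp: covers_below_def dest: vec.dim_subset)
  then show ?case using 0 by simp
next
  case (Suc c)
  show ?case
  proof (cases "c = 0")
    case True
    then have "vec.dim B = vec.dim A + 1" using Suc.hyps(2) by simp
    then have "covers_below A B = subs_between A B 0"
      by (auto simp: covers_below_def subs_between_def)
    then show ?thesis using subs_between_0[OF Suc.prems(1,3)] True by (simp flip: Suc.hyps(2))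
  next
    case False
    have "card (covers_above A B) * q_number CARD('a) c = card (covers_below A B) * q_number CARD('a) c"
    proof (rule card_biregular[where R = "(\<subseteq>)"])
      fix S assume S: "S \<in> covers_above A B"
      then have "{T \<in> covers_below A B. S \<subseteq> T} = covers_below S B"
        by (auto simp: covers_above_def covers_below_def)
      moreover have "c = vec.dim B - vec.dim S" using S Suc.hyps(2) by (simp add: covers_above_def)
      ultimately show "card {T \<in> covers_below A B. S \<subseteq> T} = q_number CARD('a) c"
        using Suc.hyps(1)[of S] Suc.prems(2) S by (simp add: covers_above_def)
    next
      fix T assume T: "T \<in> covers_below A B"
      then have "{S \<in> covers_above A B. S \<subseteq> T} = covers_above A T"
        by (auto simp: covers_above_def covers_below_def)
      moreover have "vec.dim T - vec.dim A = c"
        using T Suc.hyps(2) unfolding covers_below_def by force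
      ultimately show "card {S \<in> covers_above A B. S \<subseteq> T} = q_number CARD('a) c"
        using card_covers_above[of A T] T Suc.prems by (auto simp: covers_below_def)
    qed auto
    then have "card (covers_below A B) = card (covers_above A B)"
      using q_number_pos[of c "CARD('a)"] False by simp
    then show ?thesis by (simp only: card_covers_above[OF Suc.prems])
  qed
qed

lemma card_covers_above_diff:
  fixes R A W :: "('a::{field,finite} ^ 'm) set"
  assumes "vec.subspace R" "vec.subspace A" "vec.subspace W" "R \<subseteq> A" "A \<subseteq> W"
  shows "card (covers_above R W - covers_above R A)
       = CARD('a) ^ (vec.dim A - vec.dim R) * q_number CARD('a) (vec.dim W - vec.dim A)"
proof -
  have "covers_above R A \<subseteq> covers_above R W" using assms(5) by (auto simp: covers_above_def)
  moreover have "vec.dim W - vec.dim R = (vec.dim W - vec.dim A) + (vec.dim A - vec.dim R)"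
    using vec.dim_subset[OF assms(4)] vec.dim_subset[OF assms(5)] by simp
  ultimately show ?thesis
    using assms by (simp add: card_Diff_subset card_covers_above q_number_add)
qed

lemma card_covers_below_diff:
  fixes R A W :: "('a::{field,finite} ^ 'm) set"
  assumes "vec.subspace R" "vec.subspace A" "vec.subspace W" "R \<subseteq> A" "A \<subseteq> W"
  shows "card (covers_below R W - covers_below A W)
       = CARD('a) ^ (vec.dim W - vec.dim A) * q_number CARD('a) (vec.dim A - vec.dim R)"
proof -
  have "covers_below A W \<subseteq> covers_below R W" using assms(4) by (auto simp: covers_below_def)
  moreover have "vec.dim W - vec.dim R = (vec.dim A - vec.dim R) + (vec.dim W - vec.dim A)"
    using vec.dim_subset[OF assms(4)] vec.dim_subset[OF assms(5)] by simp
  ultimately show ?thesis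
    using assms by (simp add: card_Diff_subset card_covers_below q_number_add)
qed

lemma covers_below_meet:
  fixes R S W :: "('a::field ^ 'm) set"
  assumes S: "vec.subspace S" and W: "vec.subspace W" and A: "A \<in> covers_below R S"
  shows covers_below_meet_cases:
      "vec.dim (A \<inter> W) = vec.dim (S \<inter> W) \<or> vec.dim (A \<inter> W) + 1 = vec.dim (S \<inter> W)"
    and covers_below_meet_equal_iff: "vec.dim (A \<inter> W) = vec.dim (S \<inter> W) \<longleftrightarrow> S \<inter> W \<subseteq> A"
proof -
  have A': "vec.subspace A" "A \<subseteq> S" "vec.dim S = vec.dim A + 1"
    using A by (auto simp: covers_below_def)
  have meet: "A \<inter> W \<subseteq> S \<inter> W" using A'(2) by blast
  show "vec.dim (A \<inter> W) = vec.dim (S \<inter> W) \<or> vec.dim (A \<inter> W) + 1 = vec.dim (S \<inter> W)"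
    using dim_Int_le_Suc[OF A'(1) S W A'(2,3)] vec.dim_subset[OF meet] by linarith
  have "vec.dim (A \<inter> W) = vec.dim (S \<inter> W) \<longleftrightarrow> A \<inter> W = S \<inter> W"
    using vec.subspace_dim_equal[OF vec.subspace_inter[OF A'(1) W] vec.subspace_inter[OF S W] meet]
    by auto
  also have "\<dots> \<longleftrightarrow> S \<inter> W \<subseteq> A" using A'(2) by blast
  finally show "vec.dim (A \<inter> W) = vec.dim (S \<inter> W) \<longleftrightarrow> S \<inter> W \<subseteq> A" .
qed

lemma card_covers_below_meet:
  fixes R S W :: "('a::{field,finite} ^ 'm) set"
  assumes "vec.subspace R" "vec.subspace S" "vec.subspace W" "R \<subseteq> S" "R \<subseteq> W"
  shows card_covers_below_meet_equal:
      "card {A \<in> covers_below R S. vec.dim (A \<inter> W) = vec.dim (S \<inter> W)}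
       = q_number CARD('a) (vec.dim S - vec.dim (S \<inter> W))"
    and card_covers_below_meet_smaller:
      "card {A \<in> covers_below R S. vec.dim (A \<inter> W) + 1 = vec.dim (S \<inter> W)}
       = CARD('a) ^ (vec.dim S - vec.dim (S \<inter> W)) * q_number CARD('a) (vec.dim (S \<inter> W) - vec.dim R)"
proof -
  note meet = covers_below_meet[OF assms(2,3)]
  have subspace: "vec.subspace (S \<inter> W)" by (rule vec.subspace_inter[OF assms(2,3)])
  have "{A \<in> covers_below R S. vec.dim (A \<inter> W) = vec.dim (S \<inter> W)} = {A \<in> covers_below R S. S \<inter> W \<subseteq> A}"
    using meet(2) by blast
  also have "\<dots> = covers_below (S \<inter> W) S" using assms(4,5) by (auto simp: covers_below_def)
  finally show "card {A \<in> covers_below R S. vec.dim (A \<inter> W) = vec.dim (S \<inter> W)}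
      = q_number CARD('a) (vec.dim S - vec.dim (S \<inter> W))"
    using card_covers_below[OF subspace assms(2)] by simp
  have "{A \<in> covers_below R S. vec.dim (A \<inter> W) + 1 = vec.dim (S \<inter> W)}
      = {A \<in> covers_below R S. \<not> S \<inter> W \<subseteq> A}"
    using meet by fastforce
  also have "\<dots> = covers_below R S - covers_below (S \<inter> W) S" by (auto simp: covers_below_def)
  finally show "card {A \<in> covers_below R S. vec.dim (A \<inter> W) + 1 = vec.dim (S \<inter> W)}
      = CARD('a) ^ (vec.dim S - vec.dim (S \<inter> W)) * q_number CARD('a) (vec.dim (S \<inter> W) - vec.dim R)"
    using card_covers_below_diff[OF assms(1) subspace assms(2)] assms(4,5) by simp
qed

fun q_binomial :: "nat \<Rightarrow> nat \<Rightarrow> nat \<Rightarrow> real" where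
  "q_binomial q c 0 = 1"
| "q_binomial q c (Suc k) = q_binomial q c k * q_number q (c - k) / q_number q (Suc k)"

lemma q_binomial_2: "q_binomial q c 2 = q_number q c * q_number q (c - 1) / (1 + q)"
  by (simp add: numeral_2_eq_2 q_number_Suc)

lemma q_binomial_pos: "k \<le> c \<Longrightarrow> q_binomial q c k > 0"
  by (induction k) (simp_all add: q_number_pos)

lemma Int_eq_iff_not_subset_span_Un:
  fixes M N A :: "('a::field ^ 'm) set"
  assumes M: "vec.subspace M" and N: "vec.subspace N" and A: "vec.subspace A"
    and MN: "M \<subseteq> N" "vec.dim N = vec.dim M + 1"
  shows "N \<inter> A = M \<inter> A \<longleftrightarrow> \<not> N \<subseteq> vec.span (M \<union> A)"
proof -
  have meet: "M \<inter> A \<subseteq> N \<inter> A" using MN(1) by blast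
  have span_mono: "vec.span (M \<union> A) \<subseteq> vec.span (N \<union> A)" using MN(1) by (intro vec.span_mono) blast
  have "N \<subseteq> vec.span (M \<union> A) \<longleftrightarrow> vec.span (N \<union> A) = vec.span (M \<union> A)"
    using vec.span_superset[of "N \<union> A"] vec.span_superset[of "M \<union> A"] span_mono
      vec.span_minimal[of "N \<union> A" "vec.span (M \<union> A)"] by auto
  also have "\<dots> \<longleftrightarrow> vec.dim (vec.span (N \<union> A)) = vec.dim (vec.span (M \<union> A))"
    using vec.subspace_dim_equal[OF vec.subspace_span vec.subspace_span span_mono]
    by (metis order_refl)
  also have "\<dots> \<longleftrightarrow> vec.dim (N \<inter> A) \<noteq> vec.dim (M \<inter> A)"
    using dim_span_Un[OF M A] dim_span_Un[OF N A] MN(2) dim_Int_le_Suc[OF M N A MN]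
      vec.dim_subset[OF meet]
    by linarith
  also have "\<dots> \<longleftrightarrow> N \<inter> A \<noteq> M \<inter> A"
    using vec.subspace_dim_equal[OF vec.subspace_inter[OF M A] vec.subspace_inter[OF N A] meet]
    by (metis order_refl)
  finally show ?thesis by blast
qed

lemma card_covers_above_Int_eq:
  fixes M A W :: "('a::{field,finite} ^ 'm) set"
  assumes M: "vec.subspace M" and A: "vec.subspace A" and W: "vec.subspace W"
    and MW: "M \<subseteq> W" and AW: "A \<subseteq> W"
  shows "card {N \<in> covers_above M W. N \<inter> A = M \<inter> A}
       = CARD('a) ^ (vec.dim A - vec.dim (M \<inter> A)) * q_number CARD('a) (vec.dim W - vec.dim (vec.span (M \<union> A)))"
proof -
  let ?T = "vec.span (M \<union> A)"
  have T: "M \<subseteq> ?T" "?T \<subseteq> W"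
    using vec.span_superset[of "M \<union> A"] vec.span_minimal[of "M \<union> A" W] MW AW W by auto
  have "N \<inter> A = M \<inter> A \<longleftrightarrow> \<not> N \<subseteq> ?T" if "N \<in> covers_above M W" for N
    using Int_eq_iff_not_subset_span_Un[OF M _ A] that by (simp add: covers_above_def)
  then have "{N \<in> covers_above M W. N \<inter> A = M \<inter> A} = covers_above M W - covers_above M ?T"
    by (auto simp: covers_above_def)
  moreover have "vec.dim ?T - vec.dim M = vec.dim A - vec.dim (M \<inter> A)"
    using dim_span_Un[OF M A] by linarith
  ultimately show ?thesis using card_covers_above_diff[OF M vec.subspace_span W T] by simp
qed

lemma card_subs_between_disjoint:
  fixes R A W :: "('a::{field,finite} ^ 'm) set"
  assumes R: "vec.subspace R" and A: "vec.subspace A" and W: "vec.subspace W" and RA: "R \<subseteq> A"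
    and AW: "A \<subseteq> W"
  shows "real (card {M \<in> subs_between R W k. M \<inter> A = R})
       = real CARD('a) ^ ((vec.dim A - vec.dim R) * k) * q_binomial CARD('a) (vec.dim W - vec.dim A) k"
proof (induction k)
  case 0
  have "R \<subseteq> W" using RA AW by blast
  then have "{M \<in> subs_between R W 0. M \<inter> A = R} = {R}" using subs_between_0[OF R] RA by auto
  then show ?case by simp
next
  case (Suc k)
  let ?q = "CARD('a)" and ?r = "vec.dim R" and ?a = "vec.dim A" and ?w = "vec.dim W"
  let ?X = "\<lambda>k. {M \<in> subs_between R W k. M \<inter> A = R}"
  have "card (?X k) * (?q ^ (?a - ?r) * q_number ?q (?w - ?a - k))
      = card (?X (Suc k)) * q_number ?q (Suc k)"
  proof (rule card_biregular[where R = "(\<subseteq>)"])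
    fix M assume "M \<in> ?X k"
    then have M: "vec.subspace M" "R \<subseteq> M" "M \<subseteq> W" "vec.dim M = ?r + k" "M \<inter> A = R"
      by (auto simp: subs_between_def)
    then have "{N \<in> ?X (Suc k). M \<subseteq> N} = {N \<in> covers_above M W. N \<inter> A = M \<inter> A}"
      by (auto simp: subs_between_def covers_above_def)
    moreover have "?w - vec.dim (vec.span (M \<union> A)) = ?w - ?a - k"
      using dim_span_Un[OF M(1) A] M(4,5) by simp
    ultimately show "card {N \<in> ?X (Suc k). M \<subseteq> N} = ?q ^ (?a - ?r) * q_number ?q (?w - ?a - k)"
      using card_covers_above_Int_eq[OF M(1) A W M(3) AW] M(5) by simp
  next
    fix N assume "N \<in> ?X (Suc k)"
    then have N: "vec.subspace N" "R \<subseteq> N" "N \<subseteq> W" "vec.dim N = ?r + Suc k" "N \<inter> A = R"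
      by (auto simp: subs_between_def)
    then have "{M \<in> ?X k. M \<subseteq> N} = covers_below R N"
      using RA by (auto simp: subs_between_def covers_below_def)
    then show "card {M \<in> ?X k. M \<subseteq> N} = q_number ?q (Suc k)"
      using card_covers_below[OF R N(1,2)] N(4) by simp
  qed auto
  then have "real (card (?X k)) * (?q ^ (?a - ?r) * q_number ?q (?w - ?a - k))
      = real (card (?X (Suc k))) * q_number ?q (Suc k)"
    by (simp only: flip: of_nat_mult)
  moreover have "q_number ?q (Suc k) > 0" by (rule q_number_pos) simp
  ultimately show ?case using Suc by (simp add: field_simps power_add)
qed

corollary card_subs_between:
  fixes A B :: "('a::{field,finite} ^ 'm) set"
  assumes A: "vec.subspace A" and B: "vec.subspace B" and AB: "A \<subseteq> B"
  shows "real (card (subs_between A B k)) = q_binomial CARD('a) (vec.dim B - vec.dim A) k"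
proof -
  have "{M \<in> subs_between A B k. M \<inter> A = A} = subs_between A B k" by (auto simp: subs_between_def)
  then show ?thesis using card_subs_between_disjoint[OF A A B subset_refl AB, of k] by simp
qed

lemma subs_between_nonempty:
  fixes A B :: "('a::{field,finite} ^ 'm) set"
  assumes "vec.subspace A" "vec.subspace B" "A \<subseteq> B" "vec.dim A + k \<le> vec.dim B"
  obtains S where "vec.subspace S" "A \<subseteq> S" "S \<subseteq> B" "vec.dim S = vec.dim A + k"
proof -
  have "real (card (subs_between A B k)) > 0"
    unfolding card_subs_between[OF assms(1-3)] by (rule q_binomial_pos) (use assms(4) in simp)
  then have "subs_between A B k \<noteq> {}" by auto
  then show ?thesis using that by (auto simp: subs_between_def)
qed

section \<open>Polar spaces\<close>

locale perp_space =
  fixes perp :: "'a::{field,finite} ^ 'm \<Rightarrow> 'a ^ 'm \<Rightarrow> bool"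
  assumes perp_sym: "perp x y \<Longrightarrow> perp y x"
    and perp_subspace: "vec.subspace {y. perp x y}"
    and perp_codim: "vec.subspace C \<Longrightarrow> vec.dim C \<le> vec.dim (C \<inter> {y. perp x y}) + 1"
begin

definition orth :: "('a ^ 'm) set \<Rightarrow> ('a ^ 'm) set" where
  "orth A = {y. \<forall>x\<in>A. perp x y}"

lemma orthI: "(\<And>x. x \<in> A \<Longrightarrow> perp x y) \<Longrightarrow> y \<in> orth A"
  by (simp add: orth_def)

lemma orthD: "y \<in> orth A \<Longrightarrow> x \<in> A \<Longrightarrow> perp x y"
  by (simp add: orth_def)

lemma subspace_orth: "vec.subspace (orth A)"
proof -
  have "orth A = \<Inter> ((\<lambda>x. {y. perp x y}) ` A)" by (auto simp: orth_def)
  then show ?thesis by (metis (mono_tags, lifting) imageE perp_subspace vec.subspace_Inter)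
qed

lemma orth_antimono: "A \<subseteq> B \<Longrightarrow> orth B \<subseteq> orth A"
  by (auto simp: orth_def)

lemma subset_orth_sym: "A \<subseteq> orth B \<Longrightarrow> B \<subseteq> orth A"
  by (auto simp: orth_def intro: perp_sym)

lemma orth_Un: "orth (A \<union> B) = orth A \<inter> orth B"
  by (auto simp: orth_def)

lemma orth_span: "orth (vec.span A) = orth A"
proof
  show "orth (vec.span A) \<subseteq> orth A" by (intro orth_antimono vec.span_superset)
  have "vec.span A \<subseteq> orth (orth A)"
    by (rule vec.span_minimal[OF subset_orth_sym[OF subset_refl] subspace_orth])
  then show "orth A \<subseteq> orth (vec.span A)" by (rule subset_orth_sym)
qed

lemma dim_le_orth_card:
  assumes C: "vec.subspace C" and X: "finite X"
  shows "vec.dim C \<le> vec.dim (C \<inter> orth X) + card X"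
  using X
proof (induction X)
  case empty
  then show ?case by (simp add: orth_def)
next
  case (insert x X)
  have "vec.subspace (C \<inter> orth X)" using C subspace_orth vec.subspace_inter by blast
  from perp_codim[OF this, of x]
  have "vec.dim (C \<inter> orth X) \<le> vec.dim ((C \<inter> orth X) \<inter> {y. perp x y}) + 1" .
  moreover have "(C \<inter> orth X) \<inter> {y. perp x y} = C \<inter> orth (insert x X)" by (auto simp: orth_def)
  ultimately show ?case using insert by simp
qed

lemma dim_pairing_le:
  assumes A: "vec.subspace A" and C: "vec.subspace C"
  shows "vec.dim C + vec.dim (A \<inter> orth C) \<le> vec.dim (C \<inter> orth A) + vec.dim A"
proof -
  obtain B0 where B0: "B0 \<subseteq> A \<inter> orth C" "vec.independent B0" "card B0 = vec.dim (A \<inter> orth C)"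
    using vec.basis_exists by metis
  obtain B where B: "B0 \<subseteq> B" "B \<subseteq> A" "vec.independent B" "A \<subseteq> vec.span B"
    using vec.maximal_independent_subset_extend[of B0 A] B0 by auto
  have span_B: "vec.span B = A" using B A by (metis vec.span_minimal subset_antisym)
  have "card B = vec.dim A" using vec.basis_card_eq_dim B by blast
  then have card_complement: "card (B - B0) + vec.dim (A \<inter> orth C) = vec.dim A"
    using B0(3) B(1) by (metis card_Diff_subset card_mono finite le_add_diff_inverse2)
  have "C \<subseteq> orth B0" by (rule subset_orth_sym) (use B0(1) in blast)
  moreover have "orth A = orth (B0 \<union> (B - B0))"
    using orth_span[of B] B(1) span_B by (simp add: Un_absorb1)
  ultimately have "C \<inter> orth A = C \<inter> orth (B - B0)" unfolding orth_Un by blast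
  then have "vec.dim C \<le> vec.dim (C \<inter> orth A) + card (B - B0)"
    using dim_le_orth_card[OF C finite, of "B - B0"] by simp
  then show ?thesis using card_complement by linarith
qed

lemma dim_pairing:
  assumes "vec.subspace A" "vec.subspace C"
  shows "vec.dim C + vec.dim (A \<inter> orth C) = vec.dim (C \<inter> orth A) + vec.dim A"
  using dim_pairing_le[OF assms] dim_pairing_le[OF assms(2,1)] by linarith

end

locale singular_space = perp_space perp
  for perp :: "'a::{field,finite} ^ 'm \<Rightarrow> 'a ^ 'm \<Rightarrow> bool" +
  fixes sing :: "'a ^ 'm \<Rightarrow> bool"
  assumes sing_0: "sing 0"
    and sing_scale: "sing x \<Longrightarrow> sing (c *s x)"
    and sing_add: "sing x \<Longrightarrow> sing y \<Longrightarrow> perp x y \<Longrightarrow> sing (x + y)"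
    and sing_perp: "sing x \<Longrightarrow> perp x x"
begin

definition ts_subspaces :: "('a ^ 'm) set set" where
  "ts_subspaces = {U. vec.subspace U \<and> (\<forall>u\<in>U. sing u) \<and> U \<subseteq> orth U}"

lemma ts_subspace: "U \<in> ts_subspaces \<Longrightarrow> vec.subspace U"
  and ts_sing: "U \<in> ts_subspaces \<Longrightarrow> u \<in> U \<Longrightarrow> sing u"
  and ts_subset_orth: "U \<in> ts_subspaces \<Longrightarrow> U \<subseteq> orth U"
  by (auto simp: ts_subspaces_def)

lemma ts_zero: "{0} \<in> ts_subspaces"
  using sing_perp[OF sing_0] by (simp add: ts_subspaces_def sing_0 orth_def)

lemma ts_perp: "U \<in> ts_subspaces \<Longrightarrow> u \<in> U \<Longrightarrow> v \<in> U \<Longrightarrow> perp u v"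
  using ts_subset_orth orthD by blast

lemma ts_subset: "U \<in> ts_subspaces \<Longrightarrow> vec.subspace W \<Longrightarrow> W \<subseteq> U \<Longrightarrow> W \<in> ts_subspaces"
  unfolding ts_subspaces_def orth_def by blast

lemma ts_Int: "U \<in> ts_subspaces \<Longrightarrow> vec.subspace W \<Longrightarrow> U \<inter> W \<in> ts_subspaces"
  by (rule ts_subset[of U]) (auto intro: vec.subspace_inter ts_subspace)

lemma ts_span_Un:
  assumes S: "S \<in> ts_subspaces" and T: "T \<in> ts_subspaces" and ST: "S \<subseteq> orth T"
  shows "vec.span (S \<union> T) \<in> ts_subspaces"
proof -
  have T_orth_S: "T \<subseteq> orth S" using ST by (rule subset_orth_sym)
  have "S \<union> T \<subseteq> orth (S \<union> T)" using ST T_orth_S S T ts_subset_orth by (auto simp: orth_Un)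
  then have "vec.span (S \<union> T) \<subseteq> orth (vec.span (S \<union> T))"
    unfolding orth_span by (intro vec.span_minimal subspace_orth)
  moreover have "sing u" if u: "u \<in> vec.span (S \<union> T)" for u
  proof -
    obtain x y where "u = x + y" "x \<in> S" "y \<in> T"
      using u span_Un_subspaces[OF ts_subspace[OF S] ts_subspace[OF T]] by blast
    then show ?thesis using ts_sing[OF S] ts_sing[OF T] T_orth_S orthD sing_add by blast
  qed
  ultimately show ?thesis by (simp add: ts_subspaces_def)
qed

lemma ts_span_insert:
  assumes U: "U \<in> ts_subspaces" and x: "sing x" "x \<in> orth U"
  shows "vec.span (insert x U) \<in> ts_subspaces"
proof -
  have "x \<in> orth {x}" using sing_perp[OF x(1)] by (simp add: orth_def)
  moreover have "U \<subseteq> orth {x}" using x(2) by (auto simp: orth_def intro: perp_sym)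
  ultimately have "insert x U \<subseteq> orth (insert x U)"
    using ts_subset_orth[OF U] x(2) by (auto simp: orth_def)
  then have "vec.span (insert x U) \<subseteq> orth (vec.span (insert x U))"
    unfolding orth_span by (intro vec.span_minimal subspace_orth)
  moreover have "sing u" if u: "u \<in> vec.span (insert x U)" for u
  proof -
    obtain c y where cy: "u = c *s x + y" "y \<in> U"
      using u span_insert_eq[OF ts_subspace[OF U]] by blast
    have "perp y x" using cy(2) x(2) orthD by blast
    then have "c *s x \<in> {z. perp y z}" using vec.subspace_scale[OF perp_subspace] by blast
    then have "perp (c *s x) y" using perp_sym by blast
    then show ?thesis unfolding cy(1) by (intro sing_add sing_scale x(1) ts_sing[OF U cy(2)])
  qed
  ultimately show ?thesis by (simp add: ts_subspaces_def)
qed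

end

text \<open>
  Over a field with \<open>Q\<close> elements the parameter \<open>E\<close> is \<open>1\<close> for \<open>D\<^sub>n\<close>, \<open>Q\<close> for \<open>B\<^sub>n\<close> and \<open>C\<^sub>n\<close>, and \<open>Q\<^sup>2\<close> for
  \<open>\<^sup>2D\<close>.  For \<open>Q = q\<^sup>2\<close> and a Hermitian form it is \<open>q\<close> in even and \<open>q\<^sup>3\<close> in odd dimension.
\<close>

locale polar_space = singular_space perp sing
  for perp :: "'a::{field,finite} ^ 'm \<Rightarrow> 'a ^ 'm \<Rightarrow> bool" and sing +
  fixes n E :: nat
  assumes gens_exists: "U \<in> ts_subspaces \<Longrightarrow> \<exists>G\<in>ts_subspaces. U \<subseteq> G \<and> vec.dim G = n"
    and ts_dim_le: "U \<in> ts_subspaces \<Longrightarrow> vec.dim U \<le> n"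
    and card_gens_through: "S \<in> ts_subspaces \<Longrightarrow> vec.dim S + 1 = n \<Longrightarrow>
      card {G \<in> ts_subspaces. vec.dim G = n \<and> S \<subseteq> G} = E + 1"
begin

definition gens :: "('a ^ 'm) set set" where
  "gens = {G \<in> ts_subspaces. vec.dim G = n}"

definition level :: "('a ^ 'm) set \<Rightarrow> nat \<Rightarrow> ('a ^ 'm) set set" where
  "level R k = {S \<in> ts_subspaces. R \<subseteq> S \<and> vec.dim S = k}"

lemma gens_ts: "G \<in> gens \<Longrightarrow> G \<in> ts_subspaces" and gens_dim: "G \<in> gens \<Longrightarrow> vec.dim G = n"
  and gens_subspace: "G \<in> gens \<Longrightarrow> vec.subspace G"
  by (auto simp: gens_def ts_subspaces_def)

lemma obtain_gens: assumes "U \<in> ts_subspaces" obtains G where "G \<in> gens" "U \<subseteq> G"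
  using gens_exists[OF assms] by (auto simp: gens_def)

lemma card_gens_above: "S \<in> ts_subspaces \<Longrightarrow> vec.dim S + 1 = n \<Longrightarrow> card {G \<in> gens. S \<subseteq> G} = E + 1"
  using card_gens_through[of S] by (simp add: gens_def conj_ac)

lemma gens_eqI: "G \<in> gens \<Longrightarrow> G' \<in> gens \<Longrightarrow> G \<subseteq> G' \<Longrightarrow> G = G'"
  using vec.subspace_dim_equal[of G G'] by (simp add: gens_dim gens_subspace)

lemma gens_Int_eq:
  assumes "G \<in> gens" "W \<in> gens" "W \<noteq> G" "vec.subspace H" "vec.dim H + 1 = n" "H \<subseteq> G" "H \<subseteq> W"
  shows "W \<inter> G = H"
  by (rule Int_eq_hyperplane) (use assms gens_eqI[of W G] in \<open>auto simp: gens_subspace gens_dim\<close>)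

lemma gens_maximal: assumes "G \<in> gens" "sing x" "x \<in> orth G" shows "x \<in> G"
proof (rule ccontr)
  assume "x \<notin> G"
  then have "vec.dim (vec.span (insert x G)) = n + 1"
    using dim_span_insert[of G x] assms by (simp add: gens_subspace gens_dim)
  then show False using ts_dim_le[OF ts_span_insert[OF gens_ts[OF assms(1)] assms(2,3)]] by simp
qed

lemma ts_Int_orth_gens: assumes "S \<in> ts_subspaces" "G \<in> gens" shows "S \<inter> orth G = S \<inter> G"
proof -
  have "x \<in> G" if "x \<in> S" "x \<in> orth G" for x
    using gens_maximal[OF assms(2) ts_sing[OF assms(1) that(1)] that(2)] .
  then show ?thesis using ts_subset_orth[OF gens_ts[OF assms(2)]] by blast
qed

lemma dim_gens_Int_orth:
  assumes S: "S \<in> ts_subspaces" and G: "G \<in> gens"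
  shows "vec.dim (G \<inter> orth S) + vec.dim S = n + vec.dim (S \<inter> G)"
  using dim_pairing[OF ts_subspace[OF S] gens_subspace[OF G]] ts_Int_orth_gens[OF assms]
    gens_dim[OF G]
  by simp

definition proj :: "('a ^ 'm) set \<Rightarrow> ('a ^ 'm) set \<Rightarrow> ('a ^ 'm) set" where
  "proj S G = vec.span (S \<union> (G \<inter> orth S))"

lemma subspace_Int_orth: "vec.subspace G \<Longrightarrow> vec.subspace (G \<inter> orth S)"
  by (rule vec.subspace_inter[OF _ subspace_orth])

lemma subset_proj: "S \<subseteq> proj S G" and Int_orth_subset_proj: "G \<inter> orth S \<subseteq> proj S G"
  unfolding proj_def using vec.span_superset[of "S \<union> (G \<inter> orth S)"] by auto

lemma proj_gens:
  assumes S: "S \<in> ts_subspaces" and G: "G \<in> gens"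
  shows "proj S G \<in> gens"
proof -
  have G_orth_ts: "G \<inter> orth S \<in> ts_subspaces" using gens_ts[OF G] subspace_orth by (rule ts_Int)
  have "S \<subseteq> orth (G \<inter> orth S)" by (rule subset_orth_sym) simp
  then have proj_ts: "proj S G \<in> ts_subspaces"
    unfolding proj_def by (rule ts_span_Un[OF S G_orth_ts])
  have "S \<inter> (G \<inter> orth S) = S \<inter> G" using ts_subset_orth[OF S] by blast
  then have "vec.dim (proj S G) + vec.dim (S \<inter> G) = vec.dim S + vec.dim (G \<inter> orth S)"
    using dim_span_Un[OF ts_subspace[OF S] ts_subspace[OF G_orth_ts]] by (simp add: proj_def)
  then have "vec.dim (proj S G) = n" using dim_gens_Int_orth[OF assms] by simp
  then show ?thesis using proj_ts by (simp add: gens_def)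
qed

lemma proj_subset_orth: "S \<in> ts_subspaces \<Longrightarrow> proj S G \<subseteq> orth S"
  unfolding proj_def by (intro vec.span_minimal subspace_orth) (use ts_subset_orth in auto)

lemma proj_Int: "S \<in> ts_subspaces \<Longrightarrow> proj S G \<inter> G = G \<inter> orth S"
  using proj_subset_orth[of S G] Int_orth_subset_proj[of G S] by blast

lemma ts_subset_orth_of: "W \<in> ts_subspaces \<Longrightarrow> S \<subseteq> W \<Longrightarrow> W \<subseteq> orth S"
  by (rule subset_trans[OF ts_subset_orth orth_antimono])

lemma Int_subset_proj: "W \<in> ts_subspaces \<Longrightarrow> S \<subseteq> W \<Longrightarrow> W \<inter> G \<subseteq> proj S G"
  using ts_subset_orth_of[of W S] Int_orth_subset_proj[of G S] by blast

lemma dim_proj_Int: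
  assumes "S \<in> ts_subspaces" "G \<in> gens"
  shows "vec.dim (proj S G \<inter> G) + vec.dim S = n + vec.dim (S \<inter> G)"
  using dim_gens_Int_orth[OF assms] proj_Int[OF assms(1)] by simp

lemma proj_of_gens: "S \<in> gens \<Longrightarrow> F \<in> gens \<Longrightarrow> proj S F = S"
  using gens_eqI[of S "proj S F"] proj_gens[OF gens_ts[of S], of F] subset_proj[of S F] by simp

lemma proj_onto_superset:
  assumes "R \<in> ts_subspaces" "F \<in> gens" "R \<subseteq> F"
  shows "proj R F = F"
proof -
  have "F \<subseteq> proj R F"
    using ts_subset_orth_of[OF gens_ts[OF assms(2)] assms(3)] Int_orth_subset_proj[of F R] by blast
  then show ?thesis using gens_eqI[OF assms(2) proj_gens[OF assms(1,2)]] by simp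
qed

lemma proj_eqI:
  assumes "M \<in> ts_subspaces" "F \<in> gens" "W \<in> gens" "M \<subseteq> W" "F \<inter> orth M \<subseteq> W"
  shows "proj M F = W"
proof -
  have "proj M F \<subseteq> W"
    unfolding proj_def using assms(4,5) by (intro vec.span_minimal gens_subspace[OF assms(3)]) simp
  then show ?thesis using gens_eqI[OF proj_gens[OF assms(1,2)] assms(3)] by simp
qed

lemma proj_Int_eq:
  assumes "M \<in> ts_subspaces" "vec.subspace F" "vec.subspace S" "M \<subseteq> S" "S \<inter> F \<subseteq> M"
  shows "proj M F \<inter> S = M"
proof -
  have M_subspace: "vec.subspace M" by (rule ts_subspace[OF assms(1)])
  have "S \<inter> proj M F = vec.span (M \<union> (S \<inter> (F \<inter> orth M)))"
    unfolding proj_def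
    by (rule modular_law[OF M_subspace subspace_Int_orth[OF assms(2)] assms(3,4)])
  moreover have "M \<union> (S \<inter> (F \<inter> orth M)) = M" using assms(5) by blast
  moreover have "vec.span M = M" using M_subspace by (simp add: vec.span_eq_iff)
  ultimately show ?thesis by (simp add: Int_commute)
qed

lemma subset_proj_iff:
  assumes A: "A \<in> ts_subspaces" and G: "G \<in> gens" and S: "S \<in> level A (vec.dim A + 1)"
  shows "S \<subseteq> proj A G \<longleftrightarrow> vec.dim (S \<inter> G) = vec.dim (A \<inter> G) + 1"
proof -
  have S_ts: "S \<in> ts_subspaces" and AS: "A \<subseteq> S" "vec.dim S = vec.dim A + 1"
    using S by (auto simp: level_def)
  have subspaces: "vec.subspace A" "vec.subspace S" "vec.subspace G"
    using A S_ts G by (auto simp: ts_subspace gens_subspace)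
  have dim_le: "vec.dim (S \<inter> G) \<le> vec.dim (A \<inter> G) + 1" by (rule dim_Int_le_Suc[OF subspaces AS])
  have "S \<subseteq> proj A G \<longleftrightarrow> \<not> S \<inter> G \<subseteq> A"
  proof
    assume "S \<subseteq> proj A G"
    moreover have "S \<noteq> A" using AS(2) by auto
    ultimately show "\<not> S \<inter> G \<subseteq> A" using proj_Int_eq[OF A subspaces(3,2) AS(1)] by blast
  next
    assume "\<not> S \<inter> G \<subseteq> A"
    then obtain g where g: "g \<in> S \<inter> G" "g \<notin> A" by blast
    have "S = vec.span (insert g A)"
      using subspace_eq_span_insert[OF subspaces(1,2) AS] g by blast
    moreover have "g \<in> proj A G" using g(1) Int_subset_proj[OF S_ts AS(1)] by blast
    ultimately show "S \<subseteq> proj A G"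
      using subset_proj[of A G] vec.span_minimal[OF _ gens_subspace[OF proj_gens[OF A G]]] by simp
  qed
  also have "\<dots> \<longleftrightarrow> A \<inter> G \<noteq> S \<inter> G" using AS(1) by blast
  also have "\<dots> \<longleftrightarrow> vec.dim (S \<inter> G) = vec.dim (A \<inter> G) + 1"
  proof
    assume "A \<inter> G \<noteq> S \<inter> G"
    moreover have "A \<inter> G \<subseteq> S \<inter> G" using AS(1) by blast
    ultimately have "\<not> vec.dim (S \<inter> G) \<le> vec.dim (A \<inter> G)"
      using vec.subspace_dim_equal[OF vec.subspace_inter[OF subspaces(1,3)] vec.subspace_inter[OF subspaces(2,3)]] by blast
    then show "vec.dim (S \<inter> G) = vec.dim (A \<inter> G) + 1" using dim_le by simp
  qed auto
  finally show ?thesis .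
qed

lemma level_Suc_inside:
  assumes "A \<in> ts_subspaces" "G \<in> gens"
  shows "{S \<in> level A (vec.dim A + 1). S \<subseteq> G} = covers_above A G"
  using assms ts_subset[OF gens_ts[OF assms(2)]] ts_subspace
  unfolding covers_above_def level_def by blast

lemma card_level_Suc_inside:
  assumes A: "A \<in> ts_subspaces" and G: "G \<in> gens" "A \<subseteq> G"
  shows "card {S \<in> level A (vec.dim A + 1). S \<subseteq> G} = q_number CARD('a) (n - vec.dim A)"
  unfolding level_Suc_inside[OF A G(1)]
  using card_covers_above[OF ts_subspace[OF A] gens_subspace[OF G(1)] G(2)] gens_dim[OF G(1)]
  by simp

definition adjacent :: "('a ^ 'm) set \<Rightarrow> ('a ^ 'm) set \<Rightarrow> ('a ^ 'm) set set" where
  "adjacent A G = {W \<in> gens. A \<subseteq> W \<and> vec.dim (W \<inter> G) + 1 = n}"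

lemma card_adjacent:
  assumes A: "A \<in> ts_subspaces" and G: "G \<in> gens" "A \<subseteq> G"
  shows "card (adjacent A G) = q_number CARD('a) (n - vec.dim A) * E"
proof -
  have "card (covers_below A G) * E = card (adjacent A G) * 1"
  proof (rule card_biregular[where R = "(\<subseteq>)"])
    fix H assume "H \<in> covers_below A G"
    then have H: "vec.subspace H" "A \<subseteq> H" "H \<subseteq> G" "vec.dim H + 1 = n"
      using gens_dim[OF G(1)] by (auto simp: covers_below_def)
    have "W \<in> adjacent A G \<longleftrightarrow> W \<noteq> G" if "W \<in> gens" "H \<subseteq> W" for W
      using gens_Int_eq[OF G(1) that(1) _ H(1,4,3) that(2)] that H(2,4) gens_dim[OF G(1)]
      by (auto simp: adjacent_def)
    then have "{W \<in> adjacent A G. H \<subseteq> W} = {W \<in> gens. H \<subseteq> W} - {G}" by (auto simp: adjacent_def)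
    moreover have "card {W \<in> gens. H \<subseteq> W} = E + 1"
      by (rule card_gens_above[OF ts_subset[OF gens_ts[OF G(1)] H(1,3)] H(4)])
    ultimately show "card {W \<in> adjacent A G. H \<subseteq> W} = E"
      using G(1) H(3) by (simp add: card_Diff_singleton)
  next
    fix W assume "W \<in> adjacent A G"
    then have W: "W \<in> gens" "A \<subseteq> W" "vec.dim (W \<inter> G) + 1 = n" by (auto simp: adjacent_def)
    have Int_subspace: "vec.subspace (W \<inter> G)"
      using W(1) G(1) by (simp add: gens_subspace vec.subspace_inter)
    have "H = W \<inter> G" if "H \<in> covers_below A G" "H \<subseteq> W" for H
      using that vec.subspace_dim_equal[OF _ Int_subspace, of H] W(3) gens_dim[OF G(1)]
      by (auto simp: covers_below_def)
    moreover have "W \<inter> G \<in> covers_below A G"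
      using Int_subspace W G by (auto simp: covers_below_def gens_dim)
    ultimately have "{H \<in> covers_below A G. H \<subseteq> W} = {W \<inter> G}" by blast
    then show "card {H \<in> covers_below A G. H \<subseteq> W} = 1" by simp
  qed auto
  then show ?thesis
    using card_covers_below[OF ts_subspace[OF A] gens_subspace[OF G(1)] G(2)] gens_dim[OF G(1)]
    by simp
qed

lemma adjacent_above_eq_proj:
  assumes A: "A \<in> ts_subspaces" and G: "G \<in> gens" "A \<subseteq> G"
    and S: "S \<in> level A (vec.dim A + 1)" "\<not> S \<subseteq> G"
  shows "{W \<in> adjacent A G. S \<subseteq> W} = {proj S G}"
proof -
  have S_ts: "S \<in> ts_subspaces" and AS: "A \<subseteq> S" "vec.dim S = vec.dim A + 1"
    using S(1) by (auto simp: level_def)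
  have "S \<inter> G = A"
    by (rule Int_eq_hyperplane) (use A S_ts G AS S(2) in \<open>auto simp: ts_subspace gens_subspace\<close>)
  then have dim_meet: "vec.dim (G \<inter> orth S) + 1 = n"
    using dim_gens_Int_orth[OF S_ts G(1)] AS(2) by simp
  then have "proj S G \<in> adjacent A G"
    using proj_gens[OF S_ts G(1)] proj_Int[OF S_ts] AS(1) subset_proj[of S G]
    by (auto simp: adjacent_def)
  moreover have "W = proj S G" if W: "W \<in> adjacent A G" "S \<subseteq> W" for W
  proof -
    have W': "W \<in> gens" "vec.dim (W \<inter> G) + 1 = n" using W(1) by (auto simp: adjacent_def)
    have "W \<inter> G \<subseteq> G \<inter> orth S" using ts_subset_orth_of[OF gens_ts[OF W'(1)] W(2)] by blast
    then have "W \<inter> G = G \<inter> orth S"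
      using vec.subspace_dim_equal[OF vec.subspace_inter subspace_Int_orth, of W G G S] W' dim_meet
        G(1)
      by (simp add: gens_subspace)
    then show ?thesis using proj_eqI[OF S_ts G(1) W'(1) W(2)] by blast
  qed
  ultimately show ?thesis using subset_proj[of S G] by blast
qed

lemma card_level_Suc_outside:
  assumes A: "A \<in> ts_subspaces" and G: "G \<in> gens" "A \<subseteq> G"
  shows "card {S \<in> level A (vec.dim A + 1). \<not> S \<subseteq> G}
       = q_number CARD('a) (n - vec.dim A) * (E * CARD('a) ^ (n - vec.dim A - 1))"
proof -
  have "card {S \<in> level A (vec.dim A + 1). \<not> S \<subseteq> G} * 1
      = card (adjacent A G) * CARD('a) ^ (n - vec.dim A - 1)"
  proof (rule card_biregular[where R = "(\<subseteq>)"])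
    fix S assume "S \<in> {S \<in> level A (vec.dim A + 1). \<not> S \<subseteq> G}"
    then show "card {W \<in> adjacent A G. S \<subseteq> W} = 1" using adjacent_above_eq_proj[OF A G] by simp
  next
    fix W assume "W \<in> adjacent A G"
    then have W: "W \<in> gens" "A \<subseteq> W" "vec.dim (W \<inter> G) + 1 = n" by (auto simp: adjacent_def)
    have "{S \<in> {S \<in> level A (vec.dim A + 1). \<not> S \<subseteq> G}. S \<subseteq> W}
        = covers_above A W - covers_above A (W \<inter> G)"
      using level_Suc_inside[OF A W(1)] by (auto simp: covers_above_def)
    moreover have "card \<dots> = CARD('a) ^ (vec.dim (W \<inter> G) - vec.dim A)
        * q_number CARD('a) (vec.dim W - vec.dim (W \<inter> G))"
      by (rule card_covers_above_diff)
        (use A G W in \<open>auto simp: ts_subspace gens_subspace vec.subspace_inter\<close>)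
    moreover have "vec.dim W - vec.dim (W \<inter> G) = Suc 0" "vec.dim (W \<inter> G) - vec.dim A = n - vec.dim A - 1"
      using W(3) gens_dim[OF W(1)] by auto
    ultimately show "card {S \<in> {S \<in> level A (vec.dim A + 1). \<not> S \<subseteq> G}. S \<subseteq> W}
        = CARD('a) ^ (n - vec.dim A - 1)"
      by simp
  qed auto
  then show ?thesis using card_adjacent[OF A G] by (simp add: algebra_simps)
qed

lemma card_level_Suc:
  assumes A: "A \<in> ts_subspaces"
  shows "card (level A (vec.dim A + 1))
       = q_number CARD('a) (n - vec.dim A) * (E * CARD('a) ^ (n - vec.dim A - 1) + 1)"
proof -
  obtain G where G: "G \<in> gens" "A \<subseteq> G" using obtain_gens[OF A] .
  let ?L = "level A (vec.dim A + 1)"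
  have "card ?L = card {S \<in> ?L. S \<subseteq> G} + card {S \<in> ?L. \<not> S \<subseteq> G}"
    by (subst card_Un_disjoint[symmetric]) (auto intro!: arg_cong[where f = card])
  then show ?thesis
    unfolding card_level_Suc_inside[OF A G] card_level_Suc_outside[OF A G]
    by (simp add: algebra_simps)
qed

lemma card_level_Suc_meet:
  assumes A: "A \<in> ts_subspaces" and G: "G \<in> gens"
  shows card_level_Suc_meet_larger:
      "card {S \<in> level A (vec.dim A + 1). vec.dim (S \<inter> G) = vec.dim (A \<inter> G) + 1}
          = q_number CARD('a) (n - vec.dim A)"
    and card_level_Suc_meet_equal:
      "card {S \<in> level A (vec.dim A + 1). vec.dim (S \<inter> G) = vec.dim (A \<inter> G)}
       = q_number CARD('a) (n - vec.dim A) * (E * CARD('a) ^ (n - vec.dim A - 1))"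
proof -
  note P = proj_gens[OF A G] subset_proj[of A G]
  show "card {S \<in> level A (vec.dim A + 1). vec.dim (S \<inter> G) = vec.dim (A \<inter> G) + 1}
      = q_number CARD('a) (n - vec.dim A)"
    using card_level_Suc_inside[OF A P] subset_proj_iff[OF A G] by (simp cong: conj_cong)
  have "vec.dim (S \<inter> G) = vec.dim (A \<inter> G) \<longleftrightarrow> \<not> S \<subseteq> proj A G" if S: "S \<in> level A (vec.dim A + 1)"
    for S
  proof -
    have S': "vec.subspace S" "A \<subseteq> S" "vec.dim S = vec.dim A + 1"
      using S by (auto simp: level_def ts_subspace)
    have "vec.dim (A \<inter> G) \<le> vec.dim (S \<inter> G)" using S'(2) by (intro vec.dim_subset) blast
    then show ?thesis
      using dim_Int_le_Suc[OF ts_subspace[OF A] S'(1) gens_subspace[OF G] S'(2,3)]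
        subset_proj_iff[OF A G S]
      by linarith
  qed
  then show "card {S \<in> level A (vec.dim A + 1). vec.dim (S \<inter> G) = vec.dim (A \<inter> G)}
       = q_number CARD('a) (n - vec.dim A) * (E * CARD('a) ^ (n - vec.dim A - 1))"
    using card_level_Suc_outside[OF A P] by (simp cong: conj_cong)
qed

section \<open>Steiner systems in residues\<close>

text \<open>
  All members contain \<open>R\<close>: this is a Steiner system in the residue of \<open>R\<close>.  Dimensions are not
  reduced modulo \<open>R\<close>.
\<close>

definition steiner :: "('a ^ 'm) set \<Rightarrow> nat \<Rightarrow> ('a ^ 'm) set set \<Rightarrow> bool" where
  "steiner R t Y \<longleftrightarrow> R \<in> ts_subspaces \<and> vec.dim R \<le> t \<and> t \<le> n \<and> Y \<subseteq> gens \<and> (\<forall>W\<in>Y. R \<subseteq> W) \<and>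
     (\<forall>S\<in>level R t. \<exists>!W. W \<in> Y \<and> S \<subseteq> W)"

definition blocks_through :: "nat \<Rightarrow> nat \<Rightarrow> nat" where
  "blocks_through t j = (\<Prod>i\<in>{j..<t}. E * CARD('a) ^ (n - Suc i) + 1)"

lemma steiner_gens: "steiner R t Y \<Longrightarrow> W \<in> Y \<Longrightarrow> W \<in> gens"
  and steiner_base_subset: "steiner R t Y \<Longrightarrow> W \<in> Y \<Longrightarrow> R \<subseteq> W"
  and steiner_base_ts: "steiner R t Y \<Longrightarrow> R \<in> ts_subspaces"
  and steiner_ex1: "steiner R t Y \<Longrightarrow> S \<in> level R t \<Longrightarrow> \<exists>!W. W \<in> Y \<and> S \<subseteq> W"
  by (auto simp: steiner_def)

lemma steiner_residue:
  assumes "steiner R t Y" "A \<in> ts_subspaces" "R \<subseteq> A" "vec.dim A \<le> t"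
  shows "steiner A t {W \<in> Y. A \<subseteq> W}"
  unfolding steiner_def
proof (intro conjI ballI)
  fix S assume "S \<in> level A t"
  then have S: "S \<in> level R t" "A \<subseteq> S" using assms(3) by (auto simp: level_def)
  show "\<exists>!W. W \<in> {W \<in> Y. A \<subseteq> W} \<and> S \<subseteq> W" using steiner_ex1[OF assms(1) S(1)] S(2) by blast
qed (use assms in \<open>auto simp: steiner_def\<close>)

lemma steiner_eq:
  assumes steiner: "steiner R t Y" and S: "S \<in> ts_subspaces" "R \<subseteq> S" "t \<le> vec.dim S"
    and W: "W \<in> Y" "W' \<in> Y" "S \<subseteq> W" "S \<subseteq> W'"
  shows "W = W'"
proof -
  have R: "vec.subspace R" "vec.dim R \<le> t" using steiner by (auto simp: steiner_def ts_subspace)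
  obtain T where "vec.subspace T" "R \<subseteq> T" "T \<subseteq> S" "vec.dim T = vec.dim R + (t - vec.dim R)"
    by (rule subs_between_nonempty[OF R(1) ts_subspace[OF S(1)] S(2), of "t - vec.dim R"])
      (use R S in auto)
  then have "T \<in> level R t" "T \<subseteq> W" "T \<subseteq> W'"
    using R(2) ts_subset[OF S(1)] W by (auto simp: level_def)
  then show ?thesis using steiner_ex1[OF steiner, of T] W(1,2) by blast
qed

lemma steiner_dim_Int:
  assumes "steiner R t Y" "W \<in> Y" "W' \<in> Y" "W \<noteq> W'"
  shows "vec.dim (W \<inter> W') < t"
proof (rule ccontr)
  assume "\<not> vec.dim (W \<inter> W') < t"
  moreover have "W \<inter> W' \<in> ts_subspaces"
    using assms ts_Int[OF gens_ts gens_subspace] steiner_gens by blast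
  ultimately show False
    using steiner_eq[OF assms(1), of "W \<inter> W'" W W'] assms steiner_base_subset[OF assms(1)] by auto
qed

lemma blocks_through_self [simp]: "blocks_through t t = 1"
  by (simp add: blocks_through_def)

lemma blocks_through_Suc:
  "j < t \<Longrightarrow> blocks_through t j = (E * CARD('a) ^ (n - Suc j) + 1) * blocks_through t (Suc j)"
  by (simp add: blocks_through_def prod.atLeast_Suc_lessThan)

lemma card_steiner_above:
  assumes steiner: "steiner R t Y" and A: "A \<in> ts_subspaces" "R \<subseteq> A" "vec.dim A \<le> t"
  shows "card {W \<in> Y. A \<subseteq> W} = blocks_through t (vec.dim A)"
  using A
proof (induction "t - vec.dim A" arbitrary: A)
  case 0
  then have "\<exists>!W. W \<in> Y \<and> A \<subseteq> W" by (intro steiner_ex1[OF steiner]) (auto simp: level_def)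
  then obtain W where "{W \<in> Y. A \<subseteq> W} = {W}" by blast
  then show ?case using 0 by simp
next
  case (Suc d)
  let ?k = "vec.dim A" and ?Y = "{W \<in> Y. A \<subseteq> W}"
  have k_less: "?k < t" "t \<le> n" using Suc.hyps(2) steiner by (auto simp: steiner_def)
  have "card (level A (?k + 1)) * blocks_through t (Suc ?k) = card ?Y * q_number CARD('a) (n - ?k)"
  proof (rule card_biregular[where R = "(\<subseteq>)"])
    fix S assume "S \<in> level A (?k + 1)"
    then have S: "S \<in> ts_subspaces" "A \<subseteq> S" "vec.dim S = Suc ?k" by (auto simp: level_def)
    then have "{W \<in> ?Y. S \<subseteq> W} = {W \<in> Y. S \<subseteq> W}" by blast
    also have "card \<dots> = blocks_through t (vec.dim S)"
      using S Suc.hyps(2) Suc.prems k_less by (intro Suc.hyps(1)) auto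
    finally show "card {W \<in> ?Y. S \<subseteq> W} = blocks_through t (Suc ?k)" using S(3) by simp
  next
    fix W assume "W \<in> ?Y"
    then show "card {S \<in> level A (?k + 1). S \<subseteq> W} = q_number CARD('a) (n - ?k)"
      using card_level_Suc_inside[OF Suc.prems(1)] steiner_gens[OF steiner] by simp
  qed auto
  then have "q_number CARD('a) (n - ?k) * ((E * CARD('a) ^ (n - Suc ?k) + 1) * blocks_through t (Suc ?k))
      = q_number CARD('a) (n - ?k) * card ?Y"
    unfolding card_level_Suc[OF Suc.prems(1)] by (simp add: algebra_simps)
  moreover have "q_number CARD('a) (n - ?k) > 0" using k_less by (intro q_number_pos) simp
  ultimately show ?case using blocks_through_Suc[OF k_less(1)] by simp
qed

lemma steiner_design_sum:
  assumes steiner: "steiner R t Y" and G: "G \<in> gens" "R \<subseteq> G" and j: "vec.dim R + j \<le> t"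
  shows "(\<Sum>W\<in>Y. q_binomial CARD('a) (vec.dim (G \<inter> W) - vec.dim R) j)
       = q_binomial CARD('a) (n - vec.dim R) j * blocks_through t (vec.dim R + j)"
proof -
  have R_subspace: "vec.subspace R" using steiner_base_ts[OF steiner] by (rule ts_subspace)
  have below: "q_binomial CARD('a) (vec.dim (G \<inter> W) - vec.dim R) j
      = real (card {S \<in> subs_between R G j. S \<subseteq> W})"
    if W: "W \<in> Y" for W
  proof -
    have "{S \<in> subs_between R G j. S \<subseteq> W} = subs_between R (G \<inter> W) j"
      by (auto simp: subs_between_def)
    moreover have "vec.subspace (G \<inter> W)" "R \<subseteq> G \<inter> W"
      using vec.subspace_inter[OF gens_subspace[OF G(1)] gens_subspace[OF steiner_gens[OF steiner W]]]
        G(2) steiner_base_subset[OF steiner W] by auto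
    ultimately show ?thesis using card_subs_between[OF R_subspace] by simp
  qed
  have above: "card {W \<in> Y. S \<subseteq> W} = blocks_through t (vec.dim R + j)"
    if S: "S \<in> subs_between R G j" for S
  proof -
    have "S \<in> ts_subspaces" "R \<subseteq> S" "vec.dim S = vec.dim R + j"
      using S ts_subset[OF gens_ts[OF G(1)]] by (auto simp: subs_between_def)
    then show ?thesis using card_steiner_above[OF steiner, of S] j by simp
  qed
  have "(\<Sum>W\<in>Y. card {S \<in> subs_between R G j. S \<subseteq> W})
      = blocks_through t (vec.dim R + j) * card (subs_between R G j)"
    by (rule sum_multicount) (use above in auto)
  then have "(\<Sum>W\<in>Y. real (card {S \<in> subs_between R G j. S \<subseteq> W}))
      = real (card (subs_between R G j)) * blocks_through t (vec.dim R + j)"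
    by (simp only: mult.commute flip: of_nat_sum of_nat_mult)
  then show ?thesis
    using below card_subs_between[OF R_subspace gens_subspace[OF G(1)] G(2)] gens_dim[OF G(1)]
    by simp
qed

lemma steiner_nonempty: "steiner R t Y \<Longrightarrow> Y \<noteq> {}"
proof
  assume steiner: "steiner R t Y" and "Y = {}"
  then have "blocks_through t (vec.dim R) = 0"
    using card_steiner_above[OF steiner steiner_base_ts[OF steiner] subset_refl]
    by (simp add: steiner_def)
  then show False by (simp add: blocks_through_def)
qed

section \<open>The linear programming inequality\<close>

definition zonal :: "nat \<Rightarrow> ('a ^ 'm) set \<Rightarrow> ('a ^ 'm) set \<Rightarrow> real" where
  "zonal k U S = (- 1 / (E * CARD('a) ^ (n - k))) ^ (k - vec.dim (S \<inter> U))"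

lemma sum_zonal_above:
  assumes A: "A \<in> level R k" and U: "U \<in> gens" and E: "E > 0"
  shows "(\<Sum>S | S \<in> level R (Suc k) \<and> A \<subseteq> S. zonal (Suc k) U S) = 0"
proof -
  define y where "y = real (E * CARD('a) ^ (n - Suc k))"
  have y: "y > 0" using E by (simp add: y_def)
  have A': "A \<in> ts_subspaces" "R \<subseteq> A" "vec.dim A = k" using A by (auto simp: level_def)
  let ?m = "k - vec.dim (A \<inter> U)"
  let ?L = "level A (vec.dim A + 1)"
  let ?larger = "{S \<in> ?L. vec.dim (S \<inter> U) = vec.dim (A \<inter> U) + 1}"
  let ?equal = "{S \<in> ?L. vec.dim (S \<inter> U) = vec.dim (A \<inter> U)}"
  have dim_le: "vec.dim (A \<inter> U) \<le> k" using vec.dim_subset[of "A \<inter> U" A] A'(3) by simp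
  have "vec.dim (S \<inter> U) = vec.dim (A \<inter> U) + 1 \<or> vec.dim (S \<inter> U) = vec.dim (A \<inter> U)" if "S \<in> ?L" for S
  proof -
    have S: "vec.subspace S" "A \<subseteq> S" "vec.dim S = vec.dim A + 1"
      using that by (auto simp: level_def ts_subspace)
    have "vec.dim (A \<inter> U) \<le> vec.dim (S \<inter> U)" using S(2) by (intro vec.dim_subset) blast
    then show ?thesis
      using dim_Int_le_Suc[OF ts_subspace[OF A'(1)] S(1) gens_subspace[OF U] S(2,3)] by linarith
  qed
  then have split: "{S. S \<in> level R (Suc k) \<and> A \<subseteq> S} = ?larger \<union> ?equal"
    using A' by (auto simp: level_def)
  have "sum (zonal (Suc k) U) (?larger \<union> ?equal)
      = sum (zonal (Suc k) U) ?larger + sum (zonal (Suc k) U) ?equal"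
    by (rule sum.union_disjoint) auto
  also have "sum (zonal (Suc k) U) ?larger = (\<Sum>S\<in>?larger. (- 1 / y) ^ ?m)"
    by (intro sum.cong) (auto simp: zonal_def y_def)
  also have "\<dots> = q_number CARD('a) (n - k) * (- 1 / y) ^ ?m"
    using card_level_Suc_meet_larger[OF A'(1) U] A'(3) by simp
  also have "sum (zonal (Suc k) U) ?equal = (\<Sum>S\<in>?equal. (- 1 / y) ^ Suc ?m)"
    using dim_le by (intro sum.cong) (auto simp: zonal_def y_def Suc_diff_le)
  also have "\<dots> = (q_number CARD('a) (n - k) * y) * (- 1 / y) ^ Suc ?m"
    using card_level_Suc_meet_equal[OF A'(1) U] A'(3) by (simp add: y_def)
  also have "\<dots> = - (q_number CARD('a) (n - k) * (- 1 / y) ^ ?m)"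
    using y by simp
  finally show ?thesis unfolding split by simp
qed

definition layer :: "('a ^ 'm) set \<Rightarrow> nat \<Rightarrow> ('a ^ 'm) set \<Rightarrow> nat \<Rightarrow> ('a ^ 'm) set set" where
  "layer R k W d = {S \<in> level R k. vec.dim (S \<inter> W) + d = k}"

lemma layer_0: "W \<in> gens \<Longrightarrow> layer R k W 0 = {S \<in> level R k. S \<subseteq> W}"
proof -
  assume W: "W \<in> gens"
  have "vec.dim (S \<inter> W) = k \<longleftrightarrow> S \<subseteq> W" if "S \<in> level R k" for S
  proof -
    have S: "vec.subspace S" "vec.dim S = k" using that by (auto simp: level_def ts_subspace)
    then show ?thesis
      using vec.subspace_dim_equal[OF vec.subspace_inter[OF S(1) gens_subspace[OF W]] S(1)]
      by (auto simp: Int_absorb2)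
  qed
  then show ?thesis by (auto simp: layer_def)
qed

lemma card_layer_below:
  assumes R: "R \<in> ts_subspaces" and W: "W \<in> gens" "R \<subseteq> W" and S: "S \<in> layer R (Suc k) W e"
  shows "card {A \<in> layer R k W d. A \<subseteq> S} =
    (if e = d then CARD('a) ^ d * q_number CARD('a) (Suc k - vec.dim R - d)
     else if e = Suc d then q_number CARD('a) (Suc d) else 0)"
proof -
  have S': "S \<in> ts_subspaces" "R \<subseteq> S" "vec.dim S = Suc k" "vec.dim (S \<inter> W) + e = Suc k"
    using S by (auto simp: layer_def level_def)
  have subspaces: "vec.subspace R" "vec.subspace S" "vec.subspace W"
    using R S' W by (auto simp: ts_subspace gens_subspace)
  have below: "{A \<in> layer R k W d. A \<subseteq> S} = {A \<in> covers_below R S. vec.dim (A \<inter> W) + d = k}"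
    using S' ts_subset[OF S'(1)] by (auto simp: layer_def level_def covers_below_def ts_subspace)
  note cases = covers_below_meet_cases[OF subspaces(2,3)]
    and count = card_covers_below_meet[OF subspaces S'(2) W(2)]
  consider "e = d" | "e = Suc d" | "e \<noteq> d" "e \<noteq> Suc d" by blast
  then show ?thesis
  proof cases
    case 1
    then have "{A \<in> covers_below R S. vec.dim (A \<inter> W) + d = k}
        = {A \<in> covers_below R S. vec.dim (A \<inter> W) + 1 = vec.dim (S \<inter> W)}" using S'(4) by auto
    moreover have "vec.dim S - vec.dim (S \<inter> W) = d" "vec.dim (S \<inter> W) - vec.dim R = Suc k - vec.dim R - d"
      using S'(3,4) 1 by auto
    ultimately show ?thesis unfolding below using count(2) 1 by simp
  next
    case 2
    then have "{A \<in> covers_below R S. vec.dim (A \<inter> W) + d = k}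
        = {A \<in> covers_below R S. vec.dim (A \<inter> W) = vec.dim (S \<inter> W)}" using S'(4) by auto
    moreover have "vec.dim S - vec.dim (S \<inter> W) = Suc d" using S'(3,4) 2 by auto
    ultimately show ?thesis unfolding below using count(1) 2 by simp
  next
    case 3
    have "\<not> vec.dim (A \<inter> W) + d = k" if "A \<in> covers_below R S" for A
      using cases[OF that] S'(4) 3 by linarith
    then show ?thesis unfolding below using 3 by simp
  qed
qed

lemma sum_sum_above_eq:
  fixes f :: "('a ^ 'm) set \<Rightarrow> real"
  shows "(\<Sum>A\<in>\<A>. \<Sum>S | S \<in> \<S> \<and> A \<subseteq> S. f S) = (\<Sum>S\<in>\<S>. card {A \<in> \<A>. A \<subseteq> S} * f S)"
  using sum.swap_restrict[of \<A> \<S> "\<lambda>A S. f S" "\<lambda>A S. A \<subseteq> S"] by (simp add: Collect_conj_eq)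

lemma layer_recursion:
  fixes f :: "('a ^ 'm) set \<Rightarrow> real"
  assumes R: "R \<in> ts_subspaces" and W: "W \<in> gens" "R \<subseteq> W"
    and f: "\<And>A. A \<in> level R k \<Longrightarrow> (\<Sum>S | S \<in> level R (Suc k) \<and> A \<subseteq> S. f S) = 0"
  shows "q_number CARD('a) (Suc d) * sum f (layer R (Suc k) W (Suc d))
    = - (CARD('a) ^ d * q_number CARD('a) (Suc k - vec.dim R - d) * sum f (layer R (Suc k) W d))"
proof -
  let ?L = "level R (Suc k)" and ?layer = "layer R (Suc k) W"
  let ?a = "real (CARD('a) ^ d * q_number CARD('a) (Suc k - vec.dim R - d))"
    and ?b = "real (q_number CARD('a) (Suc d))"
  have count: "real (card {A \<in> layer R k W d. A \<subseteq> S}) * f S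
      = (if S \<in> ?layer d then ?a * f S else 0) + (if S \<in> ?layer (Suc d) then ?b * f S else 0)" if S: "S \<in> ?L" for S
  proof -
    have "vec.dim (S \<inter> W) \<le> Suc k" using S vec.dim_subset[of "S \<inter> W" S] by (auto simp: level_def)
    then obtain e where e: "S \<in> ?layer e" using S by (auto simp: layer_def dest: le_Suc_ex)
    then have "S \<in> ?layer i \<longleftrightarrow> i = e" for i by (auto simp: layer_def)
    then show ?thesis using card_layer_below[OF R W e, of d] by auto
  qed
  have "0 = (\<Sum>A\<in>layer R k W d. \<Sum>S | S \<in> ?L \<and> A \<subseteq> S. f S)" using f by (simp add: layer_def)
  also have "\<dots> = (\<Sum>S\<in>?L. (if S \<in> ?layer d then ?a * f S else 0) + (if S \<in> ?layer (Suc d) then ?b * f S else 0))"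
    unfolding sum_sum_above_eq by (intro sum.cong refl count)
  also have "\<dots> = ?a * sum f (?layer d) + ?b * sum f (?layer (Suc d))"
  proof -
    have "?layer i \<subseteq> ?L" for i by (auto simp: layer_def)
    then have "(\<Sum>S\<in>?L. if S \<in> ?layer i then c * f S else 0) = c * sum f (?layer i)" for i
      and c :: real
      by (simp add: sum.inter_restrict[symmetric] Int_absorb1 sum_distrib_left)
    then show ?thesis by (simp only: sum.distrib)
  qed
  finally show ?thesis by simp
qed

lemma sum_layer:
  fixes f :: "('a ^ 'm) set \<Rightarrow> real"
  assumes R: "R \<in> ts_subspaces" and W: "W \<in> gens" "R \<subseteq> W"
    and f: "\<And>A. A \<in> level R k \<Longrightarrow> (\<Sum>S | S \<in> level R (Suc k) \<and> A \<subseteq> S. f S) = 0"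
  shows "sum f (layer R (Suc k) W d)
    = (- 1) ^ d * (CARD('a) ^ (d choose 2) * q_binomial CARD('a) (Suc k - vec.dim R) d) * sum f (layer R (Suc k) W 0)"
proof (induction d)
  case (Suc d)
  have "real (q_number CARD('a) (Suc d)) > 0" using q_number_pos by simp
  moreover have "Suc d choose 2 = d + (d choose 2)" by (simp add: numeral_2_eq_2)
  ultimately show ?case
    using layer_recursion[OF R W f, of d] unfolding Suc by (simp add: field_simps power_add)
qed (simp add: numeral_2_eq_2)

definition zonal_norm :: "('a ^ 'm) set \<Rightarrow> nat \<Rightarrow> real" where
  "zonal_norm R k =
     (\<Sum>d\<le>k. CARD('a) ^ (d choose 2) * q_binomial CARD('a) (k - vec.dim R) d / (real E * real CARD('a) ^ (n - k)) ^ d)"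

lemma zonal_norm_pos: "zonal_norm R k > 0"
proof -
  let ?term = "\<lambda>d. CARD('a) ^ (d choose 2)
      * q_binomial CARD('a) (k - vec.dim R) d / (real E * real CARD('a) ^ (n - k)) ^ d"
  have "q_binomial q c d \<ge> 0" for q c d by (induction d) simp_all
  then have "?term 0 \<le> zonal_norm R k" unfolding zonal_norm_def by (intro member_le_sum) simp_all
  then show ?thesis by (simp add: numeral_2_eq_2)
qed

lemma sum_mult_zonal:
  fixes f :: "('a ^ 'm) set \<Rightarrow> real"
  assumes R: "R \<in> ts_subspaces" and W: "W \<in> gens" "R \<subseteq> W"
    and f: "\<And>A. A \<in> level R k \<Longrightarrow> (\<Sum>S | S \<in> level R (Suc k) \<and> A \<subseteq> S. f S) = 0"
  shows "(\<Sum>S\<in>level R (Suc k). f S * zonal (Suc k) W S)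
    = zonal_norm R (Suc k) * (\<Sum>S | S \<in> level R (Suc k) \<and> S \<subseteq> W. f S)"
proof -
  let ?layer = "layer R (Suc k) W"
  let ?coeff = "\<lambda>d. CARD('a) ^ (d choose 2) * q_binomial CARD('a) (Suc k - vec.dim R) d"
  define y where "y = real E * real CARD('a) ^ (n - Suc k)"
  have "S \<in> (\<Union>d\<in>{..Suc k}. ?layer d)" if S: "S \<in> level R (Suc k)" for S
  proof -
    have "vec.dim (S \<inter> W) \<le> Suc k" using S vec.dim_subset[of "S \<inter> W" S] by (auto simp: level_def)
    then have "S \<in> ?layer (Suc k - vec.dim (S \<inter> W))" using S by (simp add: layer_def)
    then show ?thesis by auto
  qed
  then have "level R (Suc k) = (\<Union>d\<in>{..Suc k}. ?layer d)" by (auto simp: layer_def)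
  then have "(\<Sum>S\<in>level R (Suc k). f S * zonal (Suc k) W S)
      = (\<Sum>d\<le>Suc k. \<Sum>S\<in>?layer d. f S * zonal (Suc k) W S)"
    by (simp only:) (rule sum.UNION_disjoint, auto simp: layer_def)
  also have "\<dots> = (\<Sum>d\<le>Suc k. sum f (?layer d) * (- 1 / y) ^ d)"
  proof (rule sum.cong[OF refl])
    fix d
    have "zonal (Suc k) W S = (- 1 / y) ^ d" if "S \<in> ?layer d" for S
    proof -
      have "Suc k - vec.dim (S \<inter> W) = d" using that by (auto simp: layer_def)
      then show ?thesis by (simp add: zonal_def y_def)
    qed
    then show "(\<Sum>S\<in>?layer d. f S * zonal (Suc k) W S) = sum f (?layer d) * (- 1 / y) ^ d"
      by (simp add: sum_distrib_right)
  qed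
  also have "\<dots> = (\<Sum>d\<le>Suc k. ?coeff d / y ^ d * sum f (?layer 0))"
  proof (rule sum.cong[OF refl])
    fix d
    have "sum f (?layer d) * (- 1 / y) ^ d = ((- 1) ^ d * (- 1 / y) ^ d) * (?coeff d * sum f (?layer 0))"
      by (simp only: sum_layer[OF R W f, of d] mult_ac)
    also have "(- 1) ^ d * (- 1 / y) ^ d = 1 / y ^ d"
      by (simp only: flip: power_mult_distrib) (simp add: power_divide)
    finally show "sum f (?layer d) * (- 1 / y) ^ d = ?coeff d / y ^ d * sum f (?layer 0)" by simp
  qed
  also have "\<dots> = zonal_norm R (Suc k) * sum f (?layer 0)"
    by (simp only: zonal_norm_def sum_distrib_right y_def)
  finally show ?thesis unfolding layer_0[OF W(1)] .
qed

theorem lp_inequality: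
  assumes R: "R \<in> ts_subspaces" and k: "vec.dim R < k" "k \<le> n" and E: "E > 0"
    and Y: "Y \<subseteq> gens" "\<And>W. W \<in> Y \<Longrightarrow> R \<subseteq> W"
  shows "0 \<le> (\<Sum>U\<in>Y. \<Sum>W\<in>Y. \<Sum>S | S \<in> level R k \<and> S \<subseteq> W. zonal k U S)"
proof -
  obtain i where i: "k = Suc i" using k(1) by (cases k) auto
  let ?L = "level R k"
  have "0 \<le> (\<Sum>S\<in>?L. (\<Sum>U\<in>Y. zonal k U S)\<^sup>2)" by (intro sum_nonneg) simp
  also have "\<dots> = (\<Sum>S\<in>?L. \<Sum>U\<in>Y. \<Sum>W\<in>Y. zonal k U S * zonal k W S)"
    by (simp add: power2_eq_square sum_product)
  also have "\<dots> = (\<Sum>U\<in>Y. \<Sum>S\<in>?L. \<Sum>W\<in>Y. zonal k U S * zonal k W S)"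
    by (rule sum.swap)
  also have "\<dots> = (\<Sum>U\<in>Y. \<Sum>W\<in>Y. \<Sum>S\<in>?L. zonal k U S * zonal k W S)"
    by (rule sum.cong[OF refl]) (rule sum.swap)
  also have "\<dots> = (\<Sum>U\<in>Y. \<Sum>W\<in>Y. zonal_norm R k * (\<Sum>S | S \<in> ?L \<and> S \<subseteq> W. zonal k U S))"
    unfolding i using Y k(2) i E by (intro sum.cong refl sum_mult_zonal[OF R] sum_zonal_above) auto
  also have "\<dots> = zonal_norm R k * (\<Sum>U\<in>Y. \<Sum>W\<in>Y. \<Sum>S | S \<in> ?L \<and> S \<subseteq> W. zonal k U S)"
    by (simp add: sum_distrib_left)
  finally show ?thesis using zonal_norm_pos[of R k] by (simp add: zero_le_mult_iff)
qed

lemma sum_zonal_inside_top: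
  assumes "U \<in> gens" "W \<in> gens" "R \<subseteq> W"
  shows "(\<Sum>S | S \<in> level R n \<and> S \<subseteq> W. zonal n U S) = (- 1 / E) ^ (n - vec.dim (U \<inter> W))"
proof -
  have "S = W" if "S \<in> level R n" "S \<subseteq> W" for S
    using that assms(2) gens_eqI[of S W] by (auto simp: level_def gens_def)
  then have "{S. S \<in> level R n \<and> S \<subseteq> W} = {W}" using assms by (auto simp: level_def gens_def)
  then show ?thesis by (simp add: zonal_def Int_commute)
qed

lemma sum_zonal_inside_below_top:
  assumes R: "R \<in> ts_subspaces" "vec.dim R < n" and U: "U \<in> gens" "R \<subseteq> U" and W: "W \<in> gens" "R \<subseteq> W"
    and i: "i = vec.dim (U \<inter> W)"
  shows "(\<Sum>S | S \<in> level R (n - 1) \<and> S \<subseteq> W. zonal (n - 1) U S)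
    = q_number CARD('a) (n - i) * (- 1 / (E * CARD('a))) ^ (n - 1 - i)
    + CARD('a) ^ (n - i) * q_number CARD('a) (i - vec.dim R) * (- 1 / (E * CARD('a))) ^ (n - i)"
proof -
  let ?y = "- 1 / (E * CARD('a)) :: real"
  let ?equal = "{S \<in> covers_below R W. vec.dim (S \<inter> U) = vec.dim (W \<inter> U)}"
  let ?smaller = "{S \<in> covers_below R W. vec.dim (S \<inter> U) + 1 = vec.dim (W \<inter> U)}"
  have subspaces: "vec.subspace R" "vec.subspace W" "vec.subspace U"
    using R W U by (auto simp: ts_subspace gens_subspace)
  have n: "n > 0" using R(2) by simp
  have "{S. S \<in> level R (n - 1) \<and> S \<subseteq> W} = covers_below R W"
    using ts_subset[OF gens_ts[OF W(1)]] gens_dim[OF W(1)] n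
    by (auto simp: level_def covers_below_def ts_subspace)
  also have "\<dots> = ?equal \<union> ?smaller" using covers_below_meet_cases[OF subspaces(2,3)] by blast
  finally have "(\<Sum>S | S \<in> level R (n - 1) \<and> S \<subseteq> W. zonal (n - 1) U S)
      = sum (zonal (n - 1) U) (?equal \<union> ?smaller)" by (rule arg_cong)
  also have "\<dots> = sum (zonal (n - 1) U) ?equal + sum (zonal (n - 1) U) ?smaller"
    by (rule sum.union_disjoint) auto
  also have "sum (zonal (n - 1) U) ?equal = (\<Sum>S\<in>?equal. ?y ^ (n - 1 - i))"
    using n unfolding zonal_def i by (intro sum.cong refl) (simp add: Int_commute)
  also have "sum (zonal (n - 1) U) ?smaller = (\<Sum>S\<in>?smaller. ?y ^ (n - i))"
  proof (rule sum.cong[OF refl])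
    fix S assume "S \<in> ?smaller"
    then have "n - 1 - vec.dim (S \<inter> U) = n - i" using i by (simp add: Int_commute)
    then show "zonal (n - 1) U S = ?y ^ (n - i)" using n by (simp add: zonal_def)
  qed
  finally show ?thesis
    using card_covers_below_meet[OF subspaces W(2) U(2)] gens_dim[OF W(1)] i
    by (simp add: Int_commute)
qed

section \<open>Nonexistence from intersection numbers and linear programming\<close>

lemma blocks_through_2:
  assumes "n = r + (j + 2)"
  shows "real (blocks_through (r + 2) r)
      = (real E * real CARD('a) ^ (j + 1) + 1) * (real E * real CARD('a) ^ j + 1)"
    and "real (blocks_through (r + 2) (r + 1)) = real E * real CARD('a) ^ j + 1"
proof -
  have intervals: "{r..<r + 2} = {r, r + 1}" "{r + 1..<r + 2} = {r + 1}" by auto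
  have "n - Suc r = j + 1" "n - Suc (r + 1) = j" using assms by auto
  then show "real (blocks_through (r + 2) r)
      = (real E * real CARD('a) ^ (j + 1) + 1) * (real E * real CARD('a) ^ j + 1)"
    and "real (blocks_through (r + 2) (r + 1)) = real E * real CARD('a) ^ j + 1"
    unfolding blocks_through_def intervals by (simp_all add: algebra_simps)
qed

lemma blocks_through_3:
  assumes "n = r + (j + 3)"
  shows "real (blocks_through (r + 3) r) = (real E * real CARD('a) ^ (j + 2) + 1) *
      (real E * real CARD('a) ^ (j + 1) + 1) * (real E * real CARD('a) ^ j + 1)"
    and "real (blocks_through (r + 3) (r + 1))
        = (real E * real CARD('a) ^ (j + 1) + 1) * (real E * real CARD('a) ^ j + 1)"
    and "real (blocks_through (r + 3) (r + 2)) = real E * real CARD('a) ^ j + 1"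
proof -
  have intervals: "{r..<r + 3} = {r, r + 1, r + 2}" "{r + 1..<r + 3} = {r + 1, r + 2}"
    "{r + 2..<r + 3} = {r + 2}"
    by auto
  have "n - Suc r = j + 2" "n - Suc (r + 1) = j + 1" "n - Suc (r + 2) = j" using assms by auto
  then show "real (blocks_through (r + 3) r) = (real E * real CARD('a) ^ (j + 2) + 1) *
      (real E * real CARD('a) ^ (j + 1) + 1) * (real E * real CARD('a) ^ j + 1)"
    and "real (blocks_through (r + 3) (r + 1))
        = (real E * real CARD('a) ^ (j + 1) + 1) * (real E * real CARD('a) ^ j + 1)"
    and "real (blocks_through (r + 3) (r + 2)) = real E * real CARD('a) ^ j + 1"
    unfolding blocks_through_def intervals by (simp_all add: algebra_simps)
qed

lemma steiner_dim_Int_bounds: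
  assumes "steiner R t Y" "U \<in> Y" "W \<in> Y"
  shows "vec.dim R \<le> vec.dim (U \<inter> W)" "vec.dim (U \<inter> W) \<le> n"
proof -
  show "vec.dim R \<le> vec.dim (U \<inter> W)"
    using assms(2,3) steiner_base_subset[OF assms(1)] by (intro vec.dim_subset) auto
  show "vec.dim (U \<inter> W) \<le> n"
    using vec.dim_subset[of "U \<inter> W" U] gens_dim[OF steiner_gens[OF assms(1,2)]] by simp
qed

lemma steiner_sum:
  fixes c :: "nat \<Rightarrow> real"
  assumes steiner: "steiner R t Y" and G: "G \<in> gens" "R \<subseteq> G" and s: "vec.dim R + s \<le> t"
    and F: "\<And>W. W \<in> Y - {G} \<Longrightarrow> F (vec.dim (G \<inter> W) - vec.dim R)
      = (\<Sum>j\<le>s. c j * q_binomial CARD('a) (vec.dim (G \<inter> W) - vec.dim R) j)"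
  shows "(\<Sum>W\<in>Y - {G}. F (vec.dim (G \<inter> W) - vec.dim R))
    = (\<Sum>j\<le>s. c j * (q_binomial CARD('a) (n - vec.dim R) j
        * (real (blocks_through t (vec.dim R + j)) - of_bool (G \<in> Y))))"
proof -
  let ?b = "\<lambda>j W. q_binomial CARD('a) (vec.dim (G \<inter> W) - vec.dim R) j"
  have "(\<Sum>W\<in>Y - {G}. F (vec.dim (G \<inter> W) - vec.dim R)) = (\<Sum>W\<in>Y - {G}. \<Sum>j\<le>s. c j * ?b j W)"
    by (intro sum.cong refl F)
  also have "\<dots> = (\<Sum>j\<le>s. c j * (\<Sum>W\<in>Y - {G}. ?b j W))"
    unfolding sum_distrib_left by (rule sum.swap)
  also have "\<dots> = (\<Sum>j\<le>s. c j * (q_binomial CARD('a) (n - vec.dim R) j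
        * (real (blocks_through t (vec.dim R + j)) - of_bool (G \<in> Y))))"
  proof (rule sum.cong[OF refl])
    fix j assume "j \<in> {..s}"
    then have "vec.dim R + j \<le> t" using s by simp
    then have "(\<Sum>W\<in>Y. ?b j W) = q_binomial CARD('a) (n - vec.dim R) j * blocks_through t (vec.dim R + j)"
      by (rule steiner_design_sum[OF steiner G])
    moreover have "?b j G = q_binomial CARD('a) (n - vec.dim R) j" using gens_dim[OF G(1)] by simp
    ultimately have "(\<Sum>W\<in>Y - {G}. ?b j W)
        = q_binomial CARD('a) (n - vec.dim R) j * (real (blocks_through t (vec.dim R + j)) - of_bool (G \<in> Y))"
      by (simp add: sum_diff1 algebra_simps)
    then show "c j * (\<Sum>W\<in>Y - {G}. ?b j W)
        = c j * (q_binomial CARD('a) (n - vec.dim R) j * (real (blocks_through t (vec.dim R + j)) - of_bool (G \<in> Y)))"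
      by simp
  qed
  finally show ?thesis .
qed

lemma steiner_sum_remove:
  fixes F :: "nat \<Rightarrow> real"
  assumes "steiner R t Y" "U \<in> Y"
  shows "(\<Sum>W\<in>Y. F (vec.dim (U \<inter> W))) = F n + (\<Sum>W\<in>Y - {U}. F (vec.dim (U \<inter> W)))"
  using sum.remove[of Y U "\<lambda>W. F (vec.dim (U \<inter> W))"] assms gens_dim[OF steiner_gens[OF assms]]
  by simp

lemma steiner2_sum:
  fixes F :: "nat \<Rightarrow> real"
  assumes steiner: "steiner R (vec.dim R + 2) Y" and U: "U \<in> Y"
  defines "g \<equiv> real (q_number CARD('a) (n - vec.dim R))"
    and "l0 \<equiv> real (blocks_through (vec.dim R + 2) (vec.dim R))"
    and "l1 \<equiv> real (blocks_through (vec.dim R + 2) (vec.dim R + 1))"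
  shows "(\<Sum>W\<in>Y. F (vec.dim (U \<inter> W) - vec.dim R))
    = F (n - vec.dim R) + F 0 * (l0 - 1) + (F 1 - F 0) * (g * (l1 - 1))"
proof -
  define c where "c j = (if j = 0 then F 0 else F 1 - F 0)" for j :: nat
  have "(\<Sum>W\<in>Y - {U}. F (vec.dim (U \<inter> W) - vec.dim R)) = (\<Sum>j\<le>1. c j *
      (q_binomial CARD('a) (n - vec.dim R) j * (real (blocks_through (vec.dim R + 2) (vec.dim R + j)) - of_bool (U \<in> Y))))"
  proof (rule steiner_sum[OF steiner steiner_gens[OF steiner U] steiner_base_subset[OF steiner U]])
    fix W assume "W \<in> Y - {U}"
    then have "vec.dim (U \<inter> W) < vec.dim R + 2" using steiner_dim_Int[OF steiner U, of W] by auto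
    then have "vec.dim (U \<inter> W) - vec.dim R = 0 \<or> vec.dim (U \<inter> W) - vec.dim R = 1" by linarith
    then show "F (vec.dim (U \<inter> W) - vec.dim R)
        = (\<Sum>j\<le>1. c j * q_binomial CARD('a) (vec.dim (U \<inter> W) - vec.dim R) j)"
      by (elim disjE) (simp_all add: c_def)
  qed simp
  then show ?thesis
    using steiner_sum_remove[OF steiner U, of "\<lambda>i. F (i - vec.dim R)"] U
    by (simp add: c_def g_def l0_def l1_def)
qed

lemma steiner3_sum:
  fixes F :: "nat \<Rightarrow> real"
  assumes steiner: "steiner R (vec.dim R + 3) Y" and U: "U \<in> Y"
  defines "g \<equiv> real (q_number CARD('a) (n - vec.dim R))"
    and "l0 \<equiv> real (blocks_through (vec.dim R + 3) (vec.dim R))"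
    and "l1 \<equiv> real (blocks_through (vec.dim R + 3) (vec.dim R + 1))"
    and "l2 \<equiv> real (blocks_through (vec.dim R + 3) (vec.dim R + 2))"
  shows "(\<Sum>W\<in>Y. F (vec.dim (U \<inter> W) - vec.dim R))
    = F (n - vec.dim R) + F 0 * (l0 - 1) + (F 1 - F 0) * (g * (l1 - 1))
     + (F 2 - F 0 - (F 1 - F 0) * (1 + CARD('a))) * (q_binomial CARD('a) (n - vec.dim R) 2 * (l2 - 1))"
proof -
  define c where "c j = (if j = 0 then F 0 else if j = 1 then F 1 - F 0
    else F 2 - F 0 - (F 1 - F 0) * (1 + real CARD('a)))" for j :: nat
  have "(\<Sum>W\<in>Y - {U}. F (vec.dim (U \<inter> W) - vec.dim R)) = (\<Sum>j\<le>2. c j *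
      (q_binomial CARD('a) (n - vec.dim R) j * (real (blocks_through (vec.dim R + 3) (vec.dim R + j)) - of_bool (U \<in> Y))))"
  proof (rule steiner_sum[OF steiner steiner_gens[OF steiner U] steiner_base_subset[OF steiner U]])
    fix W assume "W \<in> Y - {U}"
    then have "vec.dim (U \<inter> W) < vec.dim R + 3" using steiner_dim_Int[OF steiner U, of W] by auto
    then have "vec.dim (U \<inter> W) - vec.dim R = 0 \<or> vec.dim (U \<inter> W) - vec.dim R = 1
        \<or> vec.dim (U \<inter> W) - vec.dim R = 2"
      by linarith
    then show "F (vec.dim (U \<inter> W) - vec.dim R)
        = (\<Sum>j\<le>2. c j * q_binomial CARD('a) (vec.dim (U \<inter> W) - vec.dim R) j)"
      by (elim disjE) (simp_all add: c_def numeral_2_eq_2 q_number_Suc algebra_simps)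
  qed simp
  then show ?thesis
    using steiner_sum_remove[OF steiner U, of "\<lambda>i. F (i - vec.dim R)"] U
    by (simp add: c_def g_def l0_def l1_def l2_def numeral_2_eq_2)
qed

lemma card_steiner2_disjoint:
  assumes steiner: "steiner R (vec.dim R + 2) Y" and U: "U \<in> Y" and r: "vec.dim R < n"
  shows "real (card {W \<in> Y. U \<inter> W = R}) = real (blocks_through (vec.dim R + 2) (vec.dim R)) - 1
    - q_number CARD('a) (n - vec.dim R) * (real (blocks_through (vec.dim R + 2) (vec.dim R + 1)) - 1)"
proof -
  let ?F = "\<lambda>i::nat. if i = 0 then 1 else 0 :: real"
  have "vec.dim (U \<inter> W) - vec.dim R = 0 \<longleftrightarrow> U \<inter> W = R" if "W \<in> Y" for W
  proof -
    have base: "R \<subseteq> U \<inter> W"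
      using steiner_base_subset[OF steiner U] steiner_base_subset[OF steiner that] by blast
    have "vec.subspace (U \<inter> W)"
      using U that steiner_gens[OF steiner] by (intro vec.subspace_inter gens_subspace) auto
    then show ?thesis
      using vec.subspace_dim_equal[OF ts_subspace[OF steiner_base_ts[OF steiner]] _ base] by auto
  qed
  then have "(\<Sum>W\<in>Y. ?F (vec.dim (U \<inter> W) - vec.dim R)) = (\<Sum>W\<in>Y. if U \<inter> W = R then 1 else 0)"
    by (intro sum.cong) auto
  also have "\<dots> = real (card {W \<in> Y. U \<inter> W = R})" by (simp add: sum.If_cases Int_def)
  finally show ?thesis using steiner2_sum[OF steiner U, of ?F] r by simp
qed

lemma real_q_number_Suc: "real (q_number CARD('a) (Suc k)) = q_number CARD('a) k + real CARD('a) ^ k"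
  and real_q_number_Suc_shift: "real (q_number CARD('a) (Suc k))
      = 1 + CARD('a) * real (q_number CARD('a) k)"
  by (simp add: q_number_Suc) (simp add: q_number_Suc_shift)

lemma real_CARD_power: "real CARD('a) ^ k = 1 + CARD('a) * real (q_number CARD('a) k) - q_number CARD('a) k"
  using real_q_number_Suc[of k] real_q_number_Suc_shift[of k] by simp

lemma CARD_ge_2: "real CARD('a) \<ge> 2"
  using CARD_field_gt_1[where 'a = 'a] by linarith

lemma power_le_q_number_Suc: "real CARD('a) ^ k \<le> q_number CARD('a) (Suc k)"
  by (simp add: real_q_number_Suc)

theorem no_steiner2_hyperbolic:
  assumes steiner: "steiner R (vec.dim R + 2) Y" and E: "E = 1" and n: "n \<ge> vec.dim R + 4"
  shows False
proof -
  let ?r = "vec.dim R" and ?q = "real CARD('a)" and ?g = "\<lambda>k. real (q_number CARD('a) k)"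
  obtain U where U: "U \<in> Y" using steiner_nonempty[OF steiner] by blast
  define i where "i = n - ?r - 4"
  define j where "j = i + 2"
  have j: "n = ?r + (j + 2)" using n by (auto simp: j_def i_def)
  have "0 \<le> real (card {W \<in> Y. U \<inter> W = R})" by simp
  also have "\<dots> = (?q ^ (j + 1) + 1) * (?q ^ j + 1) - 1 - ?g (j + 2) * ?q ^ j"
    using card_steiner2_disjoint[OF steiner U] j E unfolding blocks_through_2[OF j] by simp
  also have "?g (j + 2) = ?g (j + 1) + ?q ^ (j + 1)"
    using real_q_number_Suc[of "j + 1"] by simp
  finally have "0 \<le> ?q ^ j * (?q + 1 - ?g (j + 1))" by (simp add: algebra_simps)
  moreover have "?q + 1 - ?g (j + 1) < 0"
  proof -
    have "?g (Suc i) > 0" using q_number_pos by simp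
    then have "?q * (?q * ?g (Suc i)) > 0" using CARD_ge_2 by simp
    then show ?thesis
      using real_q_number_Suc_shift[of j] real_q_number_Suc_shift[of "Suc i"]
      by (simp add: j_def algebra_simps)
  qed
  moreover have "?q ^ j > 0" by simp
  ultimately show False by (meson mult_pos_neg not_less)
qed

lemma steiner_lp:
  fixes F :: "nat \<Rightarrow> real"
  assumes steiner: "steiner R t Y" and E: "E > 0" and k: "vec.dim R < k" "k \<le> n" and s: "s > 0"
    and kernel: "\<And>U W. U \<in> Y \<Longrightarrow> W \<in> Y \<Longrightarrow>
      s * (\<Sum>S | S \<in> level R k \<and> S \<subseteq> W. zonal k U S) = F (vec.dim (U \<inter> W) - vec.dim R)"
    and row: "\<And>U. U \<in> Y \<Longrightarrow> (\<Sum>W\<in>Y. F (vec.dim (U \<inter> W) - vec.dim R)) = c"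
  shows "0 \<le> c"
proof -
  have "0 \<le> s * (\<Sum>U\<in>Y. \<Sum>W\<in>Y. \<Sum>S | S \<in> level R k \<and> S \<subseteq> W. zonal k U S)"
    using s lp_inequality[OF steiner_base_ts[OF steiner] k E, of Y] steiner
    by (simp add: steiner_def)
  also have "\<dots> = (\<Sum>U\<in>Y. \<Sum>W\<in>Y. F (vec.dim (U \<inter> W) - vec.dim R))"
    unfolding sum_distrib_left[where A = Y] by (intro sum.cong refl kernel)
  also have "\<dots> = card Y * c" using row by simp
  finally have "0 \<le> real (card Y) * c" .
  moreover have "real (card Y) > 0" using steiner_nonempty[OF steiner] by (simp add: card_gt_0_iff)
  ultimately show ?thesis by (meson mult_pos_neg not_less)
qed

definition top_kernel :: "nat \<Rightarrow> nat \<Rightarrow> real" where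
  "top_kernel m i = (- 1) ^ (m - i) * E ^ i"

definition below_top_kernel :: "nat \<Rightarrow> nat \<Rightarrow> real" where
  "below_top_kernel m i = (- 1) ^ (m - 1 - i) * real (q_number CARD('a) (m - i))
      * (real E * real CARD('a)) ^ i
     + (- 1) ^ (m - i) * real CARD('a) ^ (m - i) * real (q_number CARD('a) i) * (real E * real CARD('a)) ^ (i - 1)"

lemma steiner_lp_top:
  assumes steiner: "steiner R t Y" and E: "E > 0" and r: "vec.dim R + m = n" "m > 0"
    and row: "\<And>U. U \<in> Y \<Longrightarrow> (\<Sum>W\<in>Y. top_kernel m (vec.dim (U \<inter> W) - vec.dim R)) = c"
  shows "0 \<le> c"
proof (rule steiner_lp[OF steiner E, of n "real E ^ m"])
  fix U W assume UW: "U \<in> Y" "W \<in> Y"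
  define i where "i = vec.dim (U \<inter> W) - vec.dim R"
  have i: "n - vec.dim (U \<inter> W) = m - i" "i \<le> m"
    using steiner_dim_Int_bounds[OF steiner UW] r by (auto simp: i_def)
  have "real E ^ m = real E ^ (m - i) * real E ^ i" using i(2) by (simp flip: power_add)
  then have "real E ^ m * (- 1 / E) ^ (m - i) = (real E * (- 1 / E)) ^ (m - i) * real E ^ i"
    by (simp only: power_mult_distrib mult_ac)
  also have "\<dots> = top_kernel m i" using E by (simp add: top_kernel_def)
  finally show "real E ^ m * (\<Sum>S | S \<in> level R n \<and> S \<subseteq> W. zonal n U S)
      = top_kernel m (vec.dim (U \<inter> W) - vec.dim R)"
    using sum_zonal_inside_top[OF steiner_gens[OF steiner UW(1)] steiner_gens[OF steiner UW(2)]
        steiner_base_subset[OF steiner UW(2)]] i(1)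
    by (simp add: i_def)
qed (use r E row in auto)

lemma steiner_lp_below_top:
  assumes steiner: "steiner R t Y" and E: "E > 0" and r: "vec.dim R + m = n" "m > 1"
    and row: "\<And>U. U \<in> Y \<Longrightarrow> (\<Sum>W\<in>Y. below_top_kernel m (vec.dim (U \<inter> W) - vec.dim R)) = c"
  shows "0 \<le> c"
proof (rule steiner_lp[OF steiner E, of "n - 1" "(real E * CARD('a)) ^ (m - 1)"])
  define y where "y = real E * CARD('a)"
  have y: "y > 0" using E by (simp add: y_def)
  have cancel: "y ^ l * (- 1 / y) ^ i = (- 1) ^ i * y ^ (l - i)" if "i \<le> l" for l i
  proof -
    have "y ^ l = y ^ i * y ^ (l - i)" using that by (simp flip: power_add)
    then have "y ^ l * (- 1 / y) ^ i = (y * (- 1 / y)) ^ i * y ^ (l - i)"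
      by (simp only: power_mult_distrib mult_ac)
    then show ?thesis using y by simp
  qed
  fix U W assume UW: "U \<in> Y" "W \<in> Y"
  define i where "i = vec.dim (U \<inter> W) - vec.dim R"
  have i: "n - vec.dim (U \<inter> W) = m - i" "n - 1 - vec.dim (U \<inter> W) = m - 1 - i" "i \<le> m"
    using steiner_dim_Int_bounds[OF steiner UW] r by (auto simp: i_def)
  let ?g = "\<lambda>k. real (q_number CARD('a) k)"
  have "(\<Sum>S | S \<in> level R (n - 1) \<and> S \<subseteq> W. zonal (n - 1) U S)
      = ?g (m - i) * (- 1 / y) ^ (m - 1 - i) + real CARD('a) ^ (m - i) * (?g i * (- 1 / y) ^ (m - i))"
    using sum_zonal_inside_below_top[OF steiner_base_ts[OF steiner] _
        steiner_gens[OF steiner UW(1)] steiner_base_subset[OF steiner UW(1)]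
        steiner_gens[OF steiner UW(2)] steiner_base_subset[OF steiner UW(2)] refl] r
    unfolding i(1,2) i_def[symmetric] y_def by simp
  then have "y ^ (m - 1) * (\<Sum>S | S \<in> level R (n - 1) \<and> S \<subseteq> W. zonal (n - 1) U S)
      = ?g (m - i) * (y ^ (m - 1) * (- 1 / y) ^ (m - 1 - i))
        + real CARD('a) ^ (m - i) * (?g i * (y ^ (m - 1) * (- 1 / y) ^ (m - i)))"
    by (simp only: distrib_left mult_ac)
  also have "?g (m - i) * (y ^ (m - 1) * (- 1 / y) ^ (m - 1 - i))
      = (- 1) ^ (m - 1 - i) * ?g (m - i) * y ^ i"
    using cancel[of "m - 1 - i" "m - 1"] i(3) by (cases "i = m") simp_all
  also have "?g i * (y ^ (m - 1) * (- 1 / y) ^ (m - i)) = (- 1) ^ (m - i) * ?g i * y ^ (i - 1)"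
    using cancel[of "m - i" "m - 1"] i(3) by (cases i) simp_all
  finally show "(real E * CARD('a)) ^ (m - 1) * (\<Sum>S | S \<in> level R (n - 1) \<and> S \<subseteq> W. zonal (n - 1) U S)
      = below_top_kernel m (vec.dim (U \<inter> W) - vec.dim R)"
    by (simp add: below_top_kernel_def i_def y_def mult_ac)
qed (use r E row in auto)

lemma steiner2_top_inequality:
  assumes steiner: "steiner R (vec.dim R + 2) Y" and E: "E > 0"
    and j: "n = vec.dim R + (j + 2)" "even j"
  defines "g \<equiv> \<lambda>k. real (q_number CARD('a) k)" and "q \<equiv> real CARD('a)" and "e \<equiv> real E"
  shows "0 \<le> e\<^sup>2 * (e ^ j - q ^ j * g (j + 1)) - q\<^sup>2 * q ^ j * e * g j"
proof -
  define P where "P = q ^ j"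
  have m: "n - vec.dim R = j + 2" using j by simp
  let ?row = "e ^ (j + 2) + ((e * (q * P) + 1) * (e * P + 1) - 1) + (- e - 1) * (g (j + 2) * (e * P))"
  have "0 \<le> ?row"
  proof (rule steiner_lp_top[OF steiner E, of "j + 2"])
    fix U assume "U \<in> Y"
    have "top_kernel (j + 2) (j + 2) = e ^ (j + 2)" "top_kernel (j + 2) 1 = - e"
      "top_kernel (j + 2) 0 = 1"
      using j(2) by (simp_all add: top_kernel_def e_def)
    then show "(\<Sum>W\<in>Y. top_kernel (j + 2) (vec.dim (U \<inter> W) - vec.dim R)) = ?row"
      using steiner2_sum[OF steiner \<open>U \<in> Y\<close>, of "top_kernel (j + 2)"]
      unfolding blocks_through_2[OF j(1)] m
      by (simp add: e_def q_def P_def g_def)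
  qed (use j in auto)
  moreover have g: "g (j + 2) = 1 + q * (1 + q * g j)" "g (j + 1) = 1 + q * g j"
    using real_q_number_Suc_shift[of "j + 1"] real_q_number_Suc_shift[of j]
    by (simp_all add: g_def q_def)
  have P: "P = 1 + q * g j - g j" unfolding P_def q_def g_def by (rule real_CARD_power)
  ultimately show ?thesis
    unfolding g P_def[symmetric] power_add by (simp add: P power2_eq_square algebra_simps)
qed

theorem no_steiner2_even:
  assumes steiner: "steiner R (vec.dim R + 2) Y" and E: "E > 0" "E \<le> CARD('a)\<^sup>2"
    and n: "n \<ge> vec.dim R + 4" "even (n - vec.dim R)"
  shows False
proof -
  let ?q = "real CARD('a)" and ?e = "real E" and ?g = "\<lambda>k. real (q_number CARD('a) k)"
  define j where "j = n - vec.dim R - 2"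
  have j: "n = vec.dim R + (j + 2)" "even j" "j > 0" using n by (auto simp: j_def)
  have "?e \<le> ?q\<^sup>2" using E(2) by (metis of_nat_le_iff of_nat_power)
  then have "?e ^ j \<le> (?q\<^sup>2) ^ j" by (intro power_mono) auto
  also have "\<dots> = ?q ^ j * ?q ^ j" by (simp add: power2_eq_square power_mult_distrib)
  also have "\<dots> \<le> ?q ^ j * ?g (j + 1)"
    using power_le_q_number_Suc[of j] by (intro mult_left_mono) auto
  finally have "?e\<^sup>2 * (?e ^ j - ?q ^ j * ?g (j + 1)) \<le> 0" by (simp add: mult_nonneg_nonpos)
  moreover have "?q\<^sup>2 * ?q ^ j * ?e * ?g j > 0"
    using q_number_pos[OF j(3), of "CARD('a)"] E(1) CARD_ge_2 by simp
  ultimately show False using steiner2_top_inequality[OF steiner E(1) j(1,2)] by linarith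
qed

lemma steiner2_below_top_inequality:
  assumes steiner: "steiner R (vec.dim R + 2) Y" and E: "E > 0"
    and j: "n = vec.dim R + (j + 3)" "even j"
  defines "g \<equiv> \<lambda>k. real (q_number CARD('a) k)" and "q \<equiv> real CARD('a)" and "e \<equiv> real E"
  shows "0 \<le> q * e * (e ^ j - g (j + 1)) - q\<^sup>2 * g j"
proof -
  define y P where "y = e * q" and "P = q ^ j"
  have m: "n - vec.dim R = j + 3" and j': "n = vec.dim R + (j + 1 + 2)" using j by simp_all
  let ?l0 = "(e * (q\<^sup>2 * P) + 1) * (e * (q * P) + 1)"
  let ?row = "g (j + 3) * y ^ (j + 2) + g (j + 3) * (?l0 - 1)
    + (q\<^sup>2 * P - g (j + 2) * y - g (j + 3)) * (g (j + 3) * (e * (q * P)))"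
  have "0 \<le> ?row"
  proof (rule steiner_lp_below_top[OF steiner E, of "j + 3"])
    fix U assume "U \<in> Y"
    have "below_top_kernel (j + 3) (j + 3) = g (j + 3) * y ^ (j + 2)"
      "below_top_kernel (j + 3) 0 = g (j + 3)"
      "below_top_kernel (j + 3) 1 = q\<^sup>2 * P - g (j + 2) * y"
      using j(2)
      by (simp_all add: below_top_kernel_def g_def q_def y_def e_def P_def power_add power2_eq_square)
    moreover have "real E * real CARD('a) ^ (j + 1) = e * (q * P)"
      "real E * real CARD('a) ^ (j + 1 + 1) = e * (q\<^sup>2 * P)"
      by (simp_all add: e_def q_def P_def power2_eq_square)
    ultimately show "(\<Sum>W\<in>Y. below_top_kernel (j + 3) (vec.dim (U \<inter> W) - vec.dim R)) = ?row"
      using steiner2_sum[OF steiner \<open>U \<in> Y\<close>, of "below_top_kernel (j + 3)"]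
      unfolding blocks_through_2[OF j'] m
      by (simp add: g_def)
  qed (use j in auto)
  also have "?row = g (j + 3) * (y ^ (j + 2) + (?l0 - 1) + (q\<^sup>2 * P - g (j + 2) * y - g (j + 3)) * (e * (q * P)))"
    by (simp add: algebra_simps)
  finally have "0 \<le> y ^ (j + 2) + (?l0 - 1) + (q\<^sup>2 * P - g (j + 2) * y - g (j + 3)) * (e * (q * P))"
    using q_number_pos[of "j + 3" "CARD('a)"] by (simp add: g_def zero_le_mult_iff)
  moreover have g: "g (j + 3) = 1 + q * (1 + q * (1 + q * g j))" "g (j + 2) = 1 + q * (1 + q * g j)"
      "g (j + 1) = 1 + q * g j"
    using real_q_number_Suc_shift[of "j + 2"] real_q_number_Suc_shift[of "j + 1"]
      real_q_number_Suc_shift[of j]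
    by (simp_all add: g_def q_def numeral_3_eq_3)
  have P: "P = 1 + q * g j - g j" unfolding P_def q_def g_def by (rule real_CARD_power)
  ultimately have "0 \<le> (q * P * e) * (q * e * (e ^ j - g (j + 1)) - q\<^sup>2 * g j)"
    unfolding g y_def power_add power_mult_distrib P_def[symmetric]
    by (simp add: P power2_eq_square algebra_simps)
  moreover have "q * P * e > 0" using E CARD_ge_2 by (simp add: q_def P_def e_def)
  ultimately show ?thesis by (meson mult_pos_neg not_less)
qed

theorem no_steiner2_odd:
  assumes steiner: "steiner R (vec.dim R + 2) Y" and E: "E > 0" "E \<le> CARD('a)"
    and n: "n \<ge> vec.dim R + 5" "odd (n - vec.dim R)"
  shows False
proof -
  let ?q = "real CARD('a)" and ?e = "real E" and ?g = "\<lambda>k. real (q_number CARD('a) k)"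
  define j where "j = n - vec.dim R - 3"
  have j: "n = vec.dim R + (j + 3)" "even j" "j > 0" using n by (auto simp: j_def)
  have "?e ^ j \<le> ?q ^ j" using E(2) by (intro power_mono) auto
  also have "\<dots> \<le> ?g (j + 1)" using power_le_q_number_Suc[of j] by simp
  finally have "?q * ?e * (?e ^ j - ?g (j + 1)) \<le> 0" by (simp add: mult_nonneg_nonpos)
  moreover have "?q\<^sup>2 * ?g j > 0" using q_number_pos[OF j(3), of "CARD('a)"] CARD_ge_2 by simp
  ultimately show False using steiner2_below_top_inequality[OF steiner E(1) j(1,2)] by linarith
qed

lemma steiner3_below_top_inequality:
  assumes steiner: "steiner R (vec.dim R + 3) Y" and E: "E > 0"
    and j: "n = vec.dim R + (j + 3)" "odd j"
  defines "g \<equiv> \<lambda>k. real (q_number CARD('a) k)" and "q \<equiv> real CARD('a)" and "e \<equiv> real E"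
  defines "z \<equiv> e * q ^ j" and "y \<equiv> e * q"
  shows "0 \<le> (1 + q) * y ^ (j + 2) - (1 + q) * ((q\<^sup>2 * z + 1) * (q * z + 1) * (z + 1) - 1)
    + (1 + q) * g (j + 2) * (y + 1) * ((q * z + 1) * (z + 1) - 1)
    + (g (j + 3) - g (j + 1) * y\<^sup>2 + (q\<^sup>2 + q) * q ^ j * y - (1 + q) * g (j + 2) * (y + 1)) * g (j + 2) * z"
    (is "0 \<le> ?bound")
proof -
  have m: "n - vec.dim R = j + 3" using j by simp
  have q: "q > 0" using CARD_ge_2 by (simp add: q_def)
  let ?l0 = "(q\<^sup>2 * z + 1) * (q * z + 1) * (z + 1)" and ?l1 = "(q * z + 1) * (z + 1)"
  let ?f1 = "g (j + 2) * y - q\<^sup>2 * q ^ j" and ?f2 = "(q\<^sup>2 + q) * q ^ j * y - g (j + 1) * y\<^sup>2"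
  let ?row = "g (j + 3) * y ^ (j + 2) - g (j + 3) * (?l0 - 1)
      + (?f1 + g (j + 3)) * (g (j + 3) * (?l1 - 1))
    + (?f2 + g (j + 3) - (?f1 + g (j + 3)) * (1 + q)) * (g (j + 3) * g (j + 2) / (1 + q) * z)"
  have "0 \<le> ?row"
  proof (rule steiner_lp_below_top[OF steiner E, of "j + 3"])
    fix U assume U: "U \<in> Y"
    have F: "below_top_kernel (j + 3) (j + 3) = g (j + 3) * y ^ (j + 2)"
      "below_top_kernel (j + 3) 0 = - g (j + 3)"
      "below_top_kernel (j + 3) 1 = ?f1" "below_top_kernel (j + 3) 2 = ?f2"
      using j(2)
      by (simp_all add: below_top_kernel_def g_def q_def y_def e_def power_add power2_eq_square
          q_number_Suc numeral_2_eq_2 numeral_3_eq_3 algebra_simps)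
    have blocks: "real (blocks_through (vec.dim R + 3) (vec.dim R)) = ?l0"
      "real (blocks_through (vec.dim R + 3) (vec.dim R + 1)) = ?l1"
      "real (blocks_through (vec.dim R + 3) (vec.dim R + 2)) = z + 1"
      unfolding blocks_through_3[OF j(1)]
      by (simp_all add: z_def e_def q_def power_add power2_eq_square algebra_simps)
    have "q_binomial CARD('a) (j + 3) 2 = g (j + 3) * g (j + 2) / (1 + q)"
      by (simp add: q_binomial_2 g_def q_def)
    then show "(\<Sum>W\<in>Y. below_top_kernel (j + 3) (vec.dim (U \<inter> W) - vec.dim R)) = ?row"
      using steiner3_sum[OF steiner U, of "below_top_kernel (j + 3)"]
      unfolding m F blocks by (simp add: g_def q_def)
  qed (use j in auto)
  also have "?f1 + g (j + 3) = g (j + 2) * (y + 1)"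
    using real_q_number_Suc[of "j + 2"]
    by (simp add: g_def q_def power_add algebra_simps numeral_3_eq_3 power2_eq_square)
  finally have "0 \<le> g (j + 3) / (1 + q) * ?bound" using q by (simp add: field_simps)
  moreover have "g (j + 3) / (1 + q) > 0"
    using q_number_pos[of "j + 3" "CARD('a)"] q by (simp add: g_def)
  ultimately show ?thesis by (meson mult_pos_neg not_less)
qed

end

lemma steiner3_bound_neg:
  fixes q e G w :: real
  defines "P \<equiv> 1 + q * G - G" and "g1 \<equiv> 1 + q * G" and "g2 \<equiv> 1 + q * (1 + q * G)"
    and "g3 \<equiv> 1 + q * (1 + q * (1 + q * G))"
  defines "z \<equiv> e * P" and "y \<equiv> e * q"
  assumes q: "q \<ge> 2" and e: "e > 0" and G: "G > 1" and w: "w \<le> z ^ 3"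
  shows "(1 + q) * w - (1 + q) * ((q\<^sup>2 * z + 1) * (q * z + 1) * (z + 1) - 1)
    + (1 + q) * g2 * (y + 1) * ((q * z + 1) * (z + 1) - 1)
    + (g3 - g1 * y\<^sup>2 + (q\<^sup>2 + q) * P * y - (1 + q) * g2 * (y + 1)) * g2 * z < 0"
    (is "_ * w - ?A + ?B + ?C < 0")
proof -
  have "(1 + q) * w - ?A + ?B + ?C \<le> (1 + q) * z ^ 3 - ?A + ?B + ?C"
    using mult_left_mono[OF w, of "1 + q"] q by simp
  also have "\<dots> = - (z * (G - 1) *
      (e\<^sup>2 * (q + 1 + (q\<^sup>2 + q - 1) * G) + e * (1 + q) * q\<^sup>2 * (1 + q * G) + q ^ 4 * G))"
    unfolding P_def g1_def g2_def g3_def z_def y_def by algebra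
  also have "\<dots> < 0"
  proof -
    have "q\<^sup>2 + q - 1 \<ge> 0" using q zero_le_power2[of q] by linarith
    then have "e\<^sup>2 * (q + 1 + (q\<^sup>2 + q - 1) * G) > 0"
      using q e G by (intro mult_pos_pos add_pos_nonneg mult_nonneg_nonneg) auto
    moreover have "e * (1 + q) * q\<^sup>2 * (1 + q * G) > 0" "q ^ 4 * G > 0"
      using q e G by (auto intro!: mult_pos_pos add_pos_pos)
    moreover have "P > 0" using mult_right_mono[of 2 q G] q G unfolding P_def by linarith
    then have "z * (G - 1) > 0" using e G by (simp add: z_def)
    ultimately show ?thesis by (simp add: add_pos_pos)
  qed
  finally show ?thesis .
qed

context polar_space
begin

theorem no_steiner3_even:
  assumes steiner: "steiner R (vec.dim R + 3) Y" and E: "E > 0" "E \<le> CARD('a)\<^sup>2"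
    and n: "n \<ge> vec.dim R + 6" "even (n - vec.dim R)"
  shows False
proof -
  let ?q = "real CARD('a)" and ?e = "real E"
  define j where "j = n - vec.dim R - 3"
  have j: "n = vec.dim R + (j + 3)" "odd j" "j \<ge> 3" using n by (auto simp: j_def)
  define G where "G = real (q_number CARD('a) j)"
  have g: "real (q_number CARD('a) (j + 3)) = 1 + ?q * (1 + ?q * (1 + ?q * G))"
      "real (q_number CARD('a) (j + 2)) = 1 + ?q * (1 + ?q * G)"
      "real (q_number CARD('a) (j + 1)) = 1 + ?q * G" "?q ^ j = 1 + ?q * G - G"
    using real_q_number_Suc_shift[of "j + 2"] real_q_number_Suc_shift[of "j + 1"]
      real_q_number_Suc_shift[of j] real_CARD_power[of j]
    by (simp_all add: G_def numeral_3_eq_3)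
  have power_le: "(?e * ?q) ^ (j + 2) \<le> (?e * ?q ^ j) ^ 3"
  proof -
    have "?e \<le> ?q\<^sup>2" using E(2) by (metis of_nat_le_iff of_nat_power)
    then have "?e ^ (j - 1) \<le> (?q\<^sup>2) ^ (j - 1)" by (intro power_mono) auto
    then have "?e ^ (j - 1) * (?e ^ 3 * ?q ^ (j + 2)) \<le> (?q\<^sup>2) ^ (j - 1) * (?e ^ 3 * ?q ^ (j + 2))"
      by (intro mult_right_mono) auto
    moreover have "j - 1 + 3 = j + 2" "2 * (j - 1) + (j + 2) = j * 3" using j(3) by auto
    then have "?e ^ (j - 1) * ?e ^ 3 = ?e ^ (j + 2)" "(?q\<^sup>2) ^ (j - 1) * ?q ^ (j + 2) = (?q ^ j) ^ 3"
      by (simp_all only: flip: power_add power_mult)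
    ultimately have "?e ^ (j + 2) * ?q ^ (j + 2) \<le> ?e ^ 3 * (?q ^ j) ^ 3"
      by (simp only: mult_ac) (simp only: mult.assoc[symmetric])
    then show ?thesis by (simp only: power_mult_distrib)
  qed
  obtain i where "j = Suc (Suc i)" using j(3) by (cases j; cases "j - 1") auto
  then have "q_number CARD('a) j > 1" by (simp add: q_number_Suc_shift)
  then have "G > 1" by (simp add: G_def)
  from steiner3_bound_neg[OF CARD_ge_2 _ this power_le[unfolded g(4)]]
    steiner3_below_top_inequality[OF steiner E(1) j(1,2), unfolded g] E(1)
  show False by (meson not_less of_nat_0_less_iff)
qed

section \<open>The generators opposite to a fixed one\<close>

definition opposite :: "('a ^ 'm) set \<Rightarrow> ('a ^ 'm) set \<Rightarrow> ('a ^ 'm) set set" where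
  "opposite R F = {S \<in> gens. S \<inter> F = R}"

lemma opposite_above:
  assumes F: "F \<in> gens" and L: "L \<in> ts_subspaces" "L \<inter> F = R" "vec.dim L + 1 = n"
    and S: "S \<in> gens" "L \<subseteq> S"
  shows "S \<in> opposite R F \<longleftrightarrow> S \<noteq> proj L F"
proof
  assume "S \<in> opposite R F"
  then have "S \<inter> F = R" by (simp add: opposite_def)
  moreover have "vec.dim (proj L F \<inter> F) = vec.dim R + 1"
    using dim_proj_Int[OF L(1) F] L(2,3) by simp
  ultimately show "S \<noteq> proj L F" by auto
next
  assume "S \<noteq> proj L F"
  then have "proj L F \<inter> S = L"
    using gens_Int_eq[OF S(1) proj_gens[OF L(1) F] _ ts_subspace[OF L(1)] L(3) S(2) subset_proj]
    by blast
  moreover have "S \<inter> F \<subseteq> proj L F" using Int_subset_proj[OF gens_ts[OF S(1)] S(2)] .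
  ultimately have "S \<inter> F \<subseteq> L" by blast
  then show "S \<in> opposite R F" using L(2) S by (auto simp: opposite_def)
qed

lemma card_opposite_above:
  assumes F: "F \<in> gens" and L: "L \<in> ts_subspaces" "L \<inter> F = R" "vec.dim L + 1 = n"
  shows "card {S \<in> opposite R F. L \<subseteq> S} = E"
proof -
  have "{S \<in> opposite R F. L \<subseteq> S} = {S \<in> gens. L \<subseteq> S} - {proj L F}"
    using opposite_above[OF F L] by (auto simp: opposite_def)
  moreover have "proj L F \<in> {S \<in> gens. L \<subseteq> S}" using proj_gens[OF L(1) F] subset_proj by blast
  ultimately show ?thesis using card_gens_above[OF L(1,3)] by (simp add: card_Diff_singleton)
qed

end

text \<open>
  The subspaces \<open>M\<close> with \<open>M \<inter> L = M'\<close> that lie in an opposite generator through \<open>L\<close> correspond to the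
  generators \<open>W\<close> adjacent to \<open>F' = proj M' F\<close>: the projection of \<open>F\<close> to \<open>M\<close> is \<open>W\<close>, and \<open>M\<close> is the part of
  \<open>W\<close> orthogonal to \<open>L\<close>.
\<close>

locale opposite_hyperplane = polar_space perp sing n E
  for perp :: "'a::{field,finite} ^ 'm \<Rightarrow> 'a ^ 'm \<Rightarrow> bool" and sing n E +
  fixes F L M' :: "('a ^ 'm) set"
  assumes F_gens: "F \<in> gens"
    and L_ts: "L \<in> ts_subspaces" and dim_L: "vec.dim L + 1 = n"
    and M'_subspace: "vec.subspace M'" and R_subset_M': "L \<inter> F \<subseteq> M'" and M'_subset_L: "M' \<subseteq> L"
begin

abbreviation R :: "('a ^ 'm) set" where "R \<equiv> L \<inter> F"
abbreviation F' :: "('a ^ 'm) set" where "F' \<equiv> proj M' F"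
abbreviation X :: "('a ^ 'm) set" where "X \<equiv> F' \<inter> orth L"

definition extensions :: "('a ^ 'm) set set" where
  "extensions = {M. vec.subspace M \<and> M \<inter> L = M' \<and> vec.dim M = vec.dim M' + 1
      \<and> vec.span (L \<union> M) \<in> opposite R F}"

definition transversal :: "('a ^ 'm) set set" where
  "transversal = {W \<in> adjacent M' F'. \<not> X \<subseteq> W}"

lemma F_subspace: "vec.subspace F" and L_subspace: "vec.subspace L"
  using F_gens L_ts by (simp_all add: gens_subspace ts_subspace)

lemma M'_ts: "M' \<in> ts_subspaces"
  by (rule ts_subset[OF L_ts M'_subspace M'_subset_L])

lemma M'_Int_F: "M' \<inter> F = R"
  using R_subset_M' M'_subset_L by blast

lemma F'_gens: "F' \<in> gens" and F'_subspace: "vec.subspace F'"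
  using proj_gens[OF M'_ts F_gens] by (simp_all add: gens_subspace)

lemma M'_subset_F': "M' \<subseteq> F'"
  by (rule subset_proj)

lemma dim_F'_Int_F: "vec.dim (F' \<inter> F) + vec.dim M' = n + vec.dim R"
  using dim_proj_Int[OF M'_ts F_gens] by (simp add: M'_Int_F)

lemma F'_Int_eq:
  assumes "vec.subspace S" "M' \<subseteq> S" "S \<inter> F = R"
  shows "F' \<inter> S = M'"
  by (rule proj_Int_eq[OF M'_ts F_subspace assms(1,2)]) (use assms(3) R_subset_M' in simp)

lemma X_subspace: "vec.subspace X"
  by (rule subspace_Int_orth[OF F'_subspace])

lemma M'_subset_X: "M' \<subseteq> X"
  using M'_subset_F' M'_subset_L ts_subset_orth[OF L_ts] by blast

lemma dim_X: "vec.dim X = vec.dim M' + 1"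
  using dim_gens_Int_orth[OF L_ts F'_gens] dim_L F'_Int_eq[OF L_subspace M'_subset_L refl]
  by (simp add: Int_commute)

lemma L_subset_orth_X: "L \<subseteq> orth X"
  by (rule subset_orth_sym) simp

lemma extensionsD:
  assumes "M \<in> extensions"
  shows "M \<in> ts_subspaces" "M' \<subseteq> M" "M \<inter> F = R" "vec.dim M = vec.dim M' + 1" "M \<subseteq> orth L"
proof -
  have M: "vec.subspace M" "M \<inter> L = M'" "vec.dim M = vec.dim M' + 1"
    and S: "vec.span (L \<union> M) \<in> gens" "vec.span (L \<union> M) \<inter> F = R"
    using assms by (auto simp: extensions_def opposite_def)
  have supersets: "L \<subseteq> vec.span (L \<union> M)" "M \<subseteq> vec.span (L \<union> M)"
    using vec.span_superset[of "L \<union> M"] by auto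
  show "M \<in> ts_subspaces" by (rule ts_subset[OF gens_ts[OF S(1)] M(1) supersets(2)])
  show "M' \<subseteq> M" using M(2) by blast
  then show "M \<inter> F = R" using R_subset_M' supersets(2) S(2) by blast
  show "vec.dim M = vec.dim M' + 1" by (rule M(3))
  show "M \<subseteq> orth L" using supersets(2) ts_subset_orth_of[OF gens_ts[OF S(1)] supersets(1)] by blast
qed

lemma transversalD:
  assumes "W \<in> transversal"
  shows "W \<in> gens" "M' \<subseteq> W" "vec.subspace (W \<inter> F')" "vec.dim (W \<inter> F') + 1 = n"
    "vec.span ((W \<inter> F') \<union> X) = F'" "X \<inter> W = M'"
proof -
  show W: "W \<in> gens" "M' \<subseteq> W" "vec.dim (W \<inter> F') + 1 = n"
    using assms by (auto simp: transversal_def adjacent_def)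
  show H: "vec.subspace (W \<inter> F')"
    by (rule vec.subspace_inter[OF gens_subspace[OF W(1)] F'_subspace])
  have "\<not> X \<subseteq> W \<inter> F'" using assms by (auto simp: transversal_def)
  then have "F' = vec.span ((W \<inter> F') \<union> X)" "vec.dim (X \<inter> (W \<inter> F')) + 1 = vec.dim X"
    using subspace_eq_span_Un_hyperplane[OF H _ _ X_subspace _ _ F'_subspace] W(3)
      gens_dim[OF F'_gens] by auto
  moreover have "X \<inter> (W \<inter> F') = X \<inter> W" by blast
  ultimately show "vec.span ((W \<inter> F') \<union> X) = F'" "X \<inter> W = M'"
    using vec.subspace_dim_equal[OF M'_subspace vec.subspace_inter[OF X_subspace gens_subspace[OF W(1)]]]
      M'_subset_X W(2) dim_X by auto
qed

lemma L_Int_orth_transversal: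
  assumes W: "W \<in> transversal" and z: "z \<in> L" "z \<in> orth (W \<inter> F')"
  shows "z \<in> M'"
proof -
  have "z \<in> orth (vec.span ((W \<inter> F') \<union> X))"
    using z L_subset_orth_X by (auto simp: orth_span orth_Un)
  then have "z \<in> F'"
    using gens_maximal[OF F'_gens ts_sing[OF L_ts z(1)]] transversalD(5)[OF W] by simp
  then show ?thesis using F'_Int_eq[OF L_subspace M'_subset_L refl] z(1) by blast
qed

lemma L_Int_transversal:
  assumes W: "W \<in> transversal"
  shows "L \<inter> W = M'" and "vec.dim (W \<inter> orth L) = vec.dim M' + 1"
proof -
  note w = transversalD[OF W]
  have "W \<subseteq> orth (W \<inter> F')" using ts_subset_orth_of[OF gens_ts[OF w(1)]] by blast
  then show L_W: "L \<inter> W = M'" using L_Int_orth_transversal[OF W] M'_subset_L w(2) by blast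
  show "vec.dim (W \<inter> orth L) = vec.dim M' + 1"
    using dim_gens_Int_orth[OF L_ts w(1)] dim_L L_W by simp
qed

lemma dim_proj_Int_F':
  assumes "M \<in> extensions"
  shows "vec.dim (proj M F \<inter> F') + 1 = n"
proof -
  note m = extensionsD[OF assms]
  have W: "proj M F \<in> gens" "M' \<subseteq> proj M F"
    using proj_gens[OF m(1) F_gens] subset_proj[of M F] m(2) by auto
  have W_subspace: "vec.subspace (proj M F)" using W(1) by (rule gens_subspace)
  have dim_WF: "vec.dim (proj M F \<inter> F) + vec.dim M' + 1 = n + vec.dim R"
    using dim_proj_Int[OF m(1) F_gens] m(3,4) by simp
  have "vec.span (M' \<union> (proj M F \<inter> F)) \<subseteq> proj M F \<inter> F'"
    using Int_subset_proj[OF gens_ts[OF W(1)] W(2)] W(2) M'_subset_F' W_subspace F'_subspace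
    by (intro vec.span_minimal vec.subspace_inter) auto
  then have "vec.dim (vec.span (M' \<union> (proj M F \<inter> F))) \<le> vec.dim (proj M F \<inter> F')"
    by (rule vec.dim_subset)
  moreover have "M' \<inter> (proj M F \<inter> F) = R" using M'_Int_F W(2) by blast
  ultimately have "n \<le> vec.dim (proj M F \<inter> F') + 1"
    using dim_span_Un[OF M'_subspace vec.subspace_inter[OF W_subspace F_subspace]] dim_WF by simp
  moreover have "proj M F \<noteq> F'" using dim_WF dim_F'_Int_F by auto
  then have "\<not> F' \<subseteq> proj M F" using gens_eqI[OF F'_gens W(1)] by blast
  then have "\<not> vec.dim F' \<le> vec.dim (proj M F \<inter> F')"
    using vec.subspace_dim_equal[OF vec.subspace_inter[OF W_subspace F'_subspace] F'_subspace]
    by blast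
  ultimately show ?thesis using gens_dim[OF F'_gens] by linarith
qed

lemma proj_extension_transversal:
  assumes M: "M \<in> extensions"
  shows "proj M F \<in> transversal"
proof -
  note m = extensionsD[OF M]
  have S: "vec.span (L \<union> M) \<in> gens" "vec.span (L \<union> M) \<inter> F = R"
    using M by (auto simp: extensions_def opposite_def)
  have W: "proj M F \<in> gens" "M \<subseteq> proj M F" using proj_gens[OF m(1) F_gens] subset_proj by auto
  have "\<not> X \<subseteq> proj M F"
  proof
    assume X: "X \<subseteq> proj M F"
    have "x \<in> vec.span (L \<union> M)" if x: "x \<in> X" for x
    proof (rule gens_maximal[OF S(1)])
      show "sing x" using x ts_sing[OF gens_ts[OF F'_gens]] by blast
      have "x \<in> orth M" using x X ts_subset_orth_of[OF gens_ts[OF W(1)] W(2)] by blast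
      then show "x \<in> orth (vec.span (L \<union> M))" using x by (simp add: orth_span orth_Un)
    qed
    then have "X \<subseteq> F' \<inter> vec.span (L \<union> M)" by blast
    also have "\<dots> = M'"
      using M'_subset_L vec.span_superset[of "L \<union> M"]
      by (intro F'_Int_eq[OF vec.subspace_span _ S(2)]) blast
    finally show False using vec.dim_subset[of X M'] dim_X by simp
  qed
  then show ?thesis
    using W m(2) dim_proj_Int_F'[OF M] by (auto simp: transversal_def adjacent_def)
qed

lemma proj_extension_Int_orth:
  assumes "M \<in> extensions"
  shows "proj M F \<inter> orth L = M"
proof -
  note m = extensionsD[OF assms] and W = proj_extension_transversal[OF assms]
  have "M = proj M F \<inter> orth L"
    by (rule vec.subspace_dim_equal[OF ts_subspace[OF m(1)] subspace_Int_orth[OF gens_subspace[OF transversalD(1)[OF W]]]])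
      (use subset_proj m(4,5) L_Int_transversal(2)[OF W] in auto)
  then show ?thesis by (rule sym)
qed

lemma transversal_span_opposite:
  assumes W: "W \<in> transversal"
  shows "vec.span (L \<union> (W \<inter> orth L)) \<in> opposite R F"
proof -
  let ?M = "W \<inter> orth L" and ?S = "vec.span (L \<union> (W \<inter> orth L))"
  note w = transversalD[OF W] and LW = L_Int_transversal[OF W]
  have M_subspace: "vec.subspace ?M" by (rule subspace_Int_orth[OF gens_subspace[OF w(1)]])
  have "?M \<in> ts_subspaces" by (rule ts_subset[OF gens_ts[OF w(1)] M_subspace]) simp
  moreover have "L \<subseteq> orth ?M" by (rule subset_orth_sym) simp
  ultimately have "?S \<in> ts_subspaces" by (rule ts_span_Un[OF L_ts])
  moreover have "L \<inter> ?M = M'" using LW(1) ts_subset_orth[OF L_ts] by blast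
  then have "vec.dim ?S = n" using dim_span_Un[OF L_subspace M_subspace] LW(2) dim_L by simp
  ultimately have S: "?S \<in> gens" "L \<subseteq> ?S"
    using vec.span_superset[of "L \<union> ?M"] by (auto simp: gens_def)
  have "?S \<noteq> proj L F"
  proof
    assume S_eq: "?S = proj L F"
    then have "vec.dim (?S \<inter> F) = vec.dim R + 1" using dim_proj_Int[OF L_ts F_gens] dim_L by simp
    then have "?S \<inter> F \<noteq> R" by auto
    then obtain f where f: "f \<in> ?S" "f \<in> F" "f \<notin> M'" using S(2) M'_Int_F by blast
    then have "f \<in> orth L" using S_eq proj_subset_orth[OF L_ts] by blast
    then have f_F': "f \<in> F'" using f(2) orth_antimono[OF M'_subset_L] Int_orth_subset_proj by blast
    obtain l y where ly: "f = l + y" "l \<in> L" "y \<in> ?M"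
      using f(1) span_Un_subspaces[OF L_subspace M_subspace] by blast
    have "f \<in> orth (W \<inter> F')" "y \<in> orth (W \<inter> F')"
      using f_F' ly(3) ts_subset_orth_of[OF gens_ts[OF F'_gens]]
        ts_subset_orth_of[OF gens_ts[OF w(1)]] by blast+
    moreover have "l = f - y" using ly(1) by simp
    ultimately have "l \<in> M'"
      using vec.subspace_diff[OF subspace_orth] L_Int_orth_transversal[OF W ly(2)] by blast
    then have "y \<in> F'"
      using ly(1) f_F' M'_subset_F' vec.subspace_diff[OF F'_subspace, of f l] by auto
    then have "y \<in> M'" using ly(3) w(6) by blast
    then show False using f(3) ly(1) \<open>l \<in> M'\<close> vec.subspace_add[OF M'_subspace] by blast
  qed
  then show ?thesis using opposite_above[OF F_gens L_ts refl dim_L S] by simp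
qed

lemma transversal_Int_orth_extension:
  assumes W: "W \<in> transversal"
  shows "W \<inter> orth L \<in> extensions"
  using transversal_span_opposite[OF W] L_Int_transversal[OF W] ts_subset_orth[OF L_ts]
    subspace_Int_orth[OF gens_subspace[OF transversalD(1)[OF W]]]
  by (auto simp: extensions_def)

lemma proj_transversal_Int_orth:
  assumes W: "W \<in> transversal"
  shows "proj (W \<inter> orth L) F = W"
proof -
  let ?M = "W \<inter> orth L" and ?H = "W \<inter> F'"
  note w = transversalD[OF W] and m = extensionsD[OF transversal_Int_orth_extension[OF W]]
  have F'F: "vec.subspace (F' \<inter> F)" by (rule vec.subspace_inter[OF F'_subspace F_subspace])
  have "F' \<subseteq> vec.span (?H \<union> (F' \<inter> F))"
    using w(2) M'_subset_F' Int_orth_subset_proj[of F M'] unfolding proj_def[of M' F]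
    by (intro vec.span_mono) auto
  then have "n \<le> vec.dim (vec.span (?H \<union> (F' \<inter> F)))"
    using vec.dim_subset gens_dim[OF F'_gens] by metis
  moreover have "vec.span (?H \<union> (F' \<inter> F)) \<subseteq> F'" by (rule vec.span_minimal[OF _ F'_subspace]) auto
  then have "vec.dim (vec.span (?H \<union> (F' \<inter> F))) \<le> n"
    using vec.dim_subset gens_dim[OF F'_gens] by metis
  moreover have "?H \<inter> (F' \<inter> F) \<subseteq> W \<inter> F" by blast
  then have "vec.dim (?H \<inter> (F' \<inter> F)) \<le> vec.dim (W \<inter> F)" by (rule vec.dim_subset)
  moreover have "vec.dim (F \<inter> orth ?M) + vec.dim M' + 1 = n + vec.dim R"
    using dim_gens_Int_orth[OF m(1) F_gens] m(3,4) by simp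
  ultimately have "vec.dim (F \<inter> orth ?M) \<le> vec.dim (W \<inter> F)"
    using dim_span_Un[OF w(3) F'F] w(4) dim_F'_Int_F by linarith
  moreover have "W \<inter> F \<subseteq> F \<inter> orth ?M" using ts_subset_orth_of[OF gens_ts[OF w(1)], of ?M] by blast
  ultimately have "W \<inter> F = F \<inter> orth ?M"
    using vec.subspace_dim_equal[OF vec.subspace_inter[OF gens_subspace[OF w(1)] F_subspace]
        subspace_Int_orth[OF F_subspace]] by blast
  then show ?thesis by (intro proj_eqI[OF m(1) F_gens w(1)]) auto
qed

lemma bij_betw_proj_extensions: "bij_betw (\<lambda>M. proj M F) extensions transversal"
  by (rule bij_betwI[where g = "\<lambda>W. W \<inter> orth L"])
    (auto simp: proj_extension_transversal transversal_Int_orth_extension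
      proj_extension_Int_orth proj_transversal_Int_orth)

lemma bij_betw_steiner_transversal:
  assumes steiner: "steiner R t Y" and t: "t + 1 = n" and F'_Y: "F' \<notin> Y"
  shows "bij_betw (\<lambda>W. W \<inter> F') {W \<in> transversal. W \<in> Y} (covers_below M' F' - covers_below X F')"
proof -
  have hyperplane: "\<exists>!W. W \<in> Y \<and> H \<subseteq> W" if "H \<in> covers_below M' F'" for H
  proof (rule steiner_ex1[OF steiner])
    show "H \<in> level R t"
      using that R_subset_M' ts_subset[OF gens_ts[OF F'_gens]] gens_dim[OF F'_gens] t
      by (auto simp: covers_below_def level_def)
  qed
  show ?thesis
  proof (rule bij_betwI')
    fix W W' assume W: "W \<in> {W \<in> transversal. W \<in> Y}" "W' \<in> {W \<in> transversal. W \<in> Y}"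
    have "W = W'" if "W \<inter> F' = W' \<inter> F'"
    proof -
      have "W \<inter> F' \<in> covers_below M' F'"
        using W(1) transversalD[of W] M'_subset_F' gens_dim[OF F'_gens]
        by (auto simp: covers_below_def)
      then show ?thesis using hyperplane[of "W \<inter> F'"] W that by blast
    qed
    then show "W \<inter> F' = W' \<inter> F' \<longleftrightarrow> W = W'" by blast
  next
    fix W assume W: "W \<in> {W \<in> transversal. W \<in> Y}"
    then have "\<not> X \<subseteq> W" by (simp add: transversal_def)
    then show "W \<inter> F' \<in> covers_below M' F' - covers_below X F'"
      using W transversalD[of W] M'_subset_F' gens_dim[OF F'_gens] by (auto simp: covers_below_def)
  next
    fix H assume H: "H \<in> covers_below M' F' - covers_below X F'"
    then have H': "vec.subspace H" "M' \<subseteq> H" "H \<subseteq> F'" "vec.dim H + 1 = n" "\<not> X \<subseteq> H"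
      using gens_dim[OF F'_gens] by (auto simp: covers_below_def)
    obtain W where W: "W \<in> Y" "H \<subseteq> W" using hyperplane[of H] H by blast
    have W_gens: "W \<in> gens" by (rule steiner_gens[OF steiner W(1)])
    have meet: "W \<inter> F' = H"
      using gens_Int_eq[OF F'_gens W_gens _ H'(1,4,3) W(2)] W(1) F'_Y by blast
    then have "W \<in> transversal"
      using W_gens W(2) H' by (auto simp: transversal_def adjacent_def)
    then show "\<exists>W\<in>{W \<in> transversal. W \<in> Y}. H = W \<inter> F'" using W(1) meet by blast
  qed
qed

lemma card_steiner_transversal:
  assumes steiner: "steiner R t Y" and t: "t + 1 = n"
  shows "card {W \<in> transversal. W \<in> Y} = (if F' \<in> Y then 0 else CARD('a) ^ (n - vec.dim M' - 1))"
proof (cases "F' \<in> Y")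
  case True
  have "W \<notin> Y" if "W \<in> transversal" for W
  proof
    assume "W \<in> Y"
    moreover have "F' \<noteq> W" using transversalD(4)[OF that] gens_dim[OF F'_gens] by auto
    ultimately show False
      using steiner_dim_Int[OF steiner \<open>W \<in> Y\<close> True] transversalD(4)[OF that] t by auto
  qed
  then have "{W \<in> transversal. W \<in> Y} = {}" by blast
  then show ?thesis using True by simp
next
  case False
  have "card {W \<in> transversal. W \<in> Y} = card (covers_below M' F' - covers_below X F')"
    by (rule bij_betw_same_card[OF bij_betw_steiner_transversal[OF steiner t False]])
  also have "\<dots> = CARD('a) ^ (vec.dim F' - vec.dim X) * q_number CARD('a) (vec.dim X - vec.dim M')"
    by (rule card_covers_below_diff[OF M'_subspace X_subspace F'_subspace M'_subset_X]) simp
  finally show ?thesis using False dim_X gens_dim[OF F'_gens] by simp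
qed

lemma card_extensions:
  assumes "steiner R t Y" "t + 1 = n"
  shows "card {M \<in> extensions. proj M F \<in> Y} = (if F' \<in> Y then 0 else CARD('a) ^ (n - vec.dim M' - 1))"
proof -
  have "bij_betw (\<lambda>M. proj M F) {M \<in> extensions. proj M F \<in> Y} {W \<in> transversal. W \<in> Y}"
  proof (rule bij_betw_subset[OF bij_betw_proj_extensions])
    show "(\<lambda>M. proj M F) ` {M \<in> extensions. proj M F \<in> Y} = {W \<in> transversal. W \<in> Y}"
      unfolding bij_betw_imp_surj_on[OF bij_betw_proj_extensions, symmetric] by blast
  qed blast
  then show ?thesis
    unfolding card_steiner_transversal[OF assms, symmetric] by (rule bij_betw_same_card)
qed

end

context polar_space
begin

definition subcount :: "('a ^ 'm) set \<Rightarrow> (('a ^ 'm) set \<Rightarrow> bool) \<Rightarrow> nat \<Rightarrow> ('a ^ 'm) set \<Rightarrow> nat" where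
  "subcount R p k S = card {M \<in> subs_between R S k. p M}"

lemma subcount_0:
  assumes "R \<in> ts_subspaces" "R \<subseteq> S"
  shows "subcount R p 0 S = of_bool (p R)"
proof -
  have "{M \<in> subs_between R S 0. p M} = (if p R then {R} else {})"
    using subs_between_0[OF ts_subspace[OF assms(1)] assms(2)] by auto
  then show ?thesis by (simp add: subcount_def)
qed

lemma subcount_base:
  assumes "R \<in> ts_subspaces" "F \<in> gens" "R \<subseteq> F" "S \<in> opposite R F"
  shows "subcount R (\<lambda>M. proj M F \<in> Y) 0 S = of_bool (F \<in> Y)"
  using subcount_0[OF assms(1), of S] proj_onto_superset[OF assms(1-3)] assms(4)
  by (auto simp: opposite_def)

lemma subcount_top:
  assumes "S \<in> opposite R F" "F \<in> gens" "vec.dim R + m = n"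
  shows "subcount R (\<lambda>M. proj M F \<in> Y) m S = of_bool (S \<in> Y)"
proof -
  have S: "S \<in> gens" "R \<subseteq> S" using assms by (auto simp: opposite_def)
  have "subs_between R S m = {S}"
    using subs_between_full[OF gens_subspace[OF S(1)] S(2)] gens_dim[OF S(1)] assms(3) by simp
  then have "{M \<in> subs_between R S m. proj M F \<in> Y} = (if S \<in> Y then {S} else {})"
    using proj_of_gens[OF S(1) assms(2)] by auto
  then show ?thesis by (simp add: subcount_def)
qed

lemma opposite_hyperplane_subs_between:
  assumes "F \<in> gens" and "L \<in> ts_subspaces" "L \<inter> F = R" "vec.dim L + 1 = n"
    and "M' \<in> subs_between R L k"
  shows "opposite_hyperplane perp sing n E F L M'"
  by unfold_locales (use assms in \<open>auto simp: subs_between_def\<close>)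

lemma new_subs_eq_extensions:
  assumes F: "F \<in> gens" and L: "L \<in> ts_subspaces" "L \<inter> F = R" "vec.dim L + 1 = n"
  shows "(\<Union>S\<in>{S \<in> opposite R F. L \<subseteq> S}. {M \<in> subs_between R S (Suc k). \<not> M \<subseteq> L})
    = (\<Union>M'\<in>subs_between R L k. opposite_hyperplane.extensions perp sing n F L M')" (is "?new = ?ext")
proof -
  have L_subspace: "vec.subspace L" using L(1) by (rule ts_subspace)
  note hyperplane = opposite_hyperplane_subs_between[OF F L]
  show ?thesis
  proof (intro subset_antisym subsetI)
    fix M assume "M \<in> ?new"
    then obtain S where S: "S \<in> opposite R F" "S \<in> gens" "L \<subseteq> S"
      and M: "vec.subspace M" "R \<subseteq> M" "M \<subseteq> S" "vec.dim M = vec.dim R + Suc k" "\<not> M \<subseteq> L"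
      by (auto simp: opposite_def subs_between_def)
    have S_eq: "S = vec.span (L \<union> M)" and dim_meet: "vec.dim (M \<inter> L) + 1 = vec.dim M"
      using subspace_eq_span_Un_hyperplane[OF L_subspace S(3) _ M(1,3,5) gens_subspace[OF S(2)]]
        gens_dim[OF S(2)] L(3) by auto
    then have meet: "M \<inter> L \<in> subs_between R L k"
      using M L(2) vec.subspace_inter[OF M(1) L_subspace] by (auto simp: subs_between_def)
    then have "M \<in> opposite_hyperplane.extensions perp sing n F L (M \<inter> L)"
      using M(1) S(1) S_eq dim_meet L(2)
      by (simp add: opposite_hyperplane.extensions_def[OF hyperplane])
    then show "M \<in> ?ext" using meet by blast
  next
    fix M assume "M \<in> ?ext"
    then obtain M' where M': "M' \<in> subs_between R L k"
      "M \<in> opposite_hyperplane.extensions perp sing n F L M'" by blast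
    then have M: "vec.subspace M" "M \<inter> L = M'" "vec.dim M = vec.dim M' + 1"
      "vec.span (L \<union> M) \<in> opposite R F"
      using opposite_hyperplane.extensions_def[OF hyperplane[OF M'(1)]] L(2) by auto
    have "\<not> M \<subseteq> L"
    proof
      assume "M \<subseteq> L"
      then have "M = M'" using M(2) by blast
      then show False using M(3) by simp
    qed
    then have "M \<in> {M \<in> subs_between R (vec.span (L \<union> M)) (Suc k). \<not> M \<subseteq> L}"
      using M(1-3) M'(1) vec.span_superset[of "L \<union> M"] by (auto simp: subs_between_def)
    moreover have "L \<subseteq> vec.span (L \<union> M)" using vec.span_superset[of "L \<union> M"] by blast
    ultimately show "M \<in> ?new" using M(4) by blast
  qed
qed

lemma sum_card_new_subs_eq_card_UN:
  assumes L: "L \<in> ts_subspaces" "vec.dim L + 1 = n"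
  shows "(\<Sum>S | S \<in> opposite R F \<and> L \<subseteq> S. card {M \<in> subs_between R S k. h M \<and> \<not> M \<subseteq> L})
    = card (\<Union>S\<in>{S \<in> opposite R F. L \<subseteq> S}. {M \<in> subs_between R S k. h M \<and> \<not> M \<subseteq> L})"
    (is "(\<Sum>S\<in>?G. card (?new S)) = _")
proof (rule card_UN_disjoint[symmetric]; (intro ballI impI equals0I)?)
  have span_eq: "S = vec.span (L \<union> M)" if "S \<in> ?G" "M \<in> ?new S" for S M
    by (rule subspace_eq_span_Un_hyperplane(1)[OF ts_subspace[OF L(1)]])
      (use that L in \<open>auto simp: opposite_def subs_between_def gens_subspace gens_dim\<close>)
  fix S S' M assume "S \<in> ?G" "S' \<in> ?G" "S \<noteq> S'" "M \<in> ?new S \<inter> ?new S'"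
  then show False using span_eq[of S M] span_eq[of S' M] by blast
qed auto

lemma sum_card_new_subs:
  assumes steiner: "steiner R t Y" and t: "t + 1 = n" and F: "F \<in> gens"
    and L: "L \<in> ts_subspaces" "L \<inter> F = R" "vec.dim L + 1 = n"
  defines "h \<equiv> \<lambda>M. proj M F \<in> Y"
  shows "(\<Sum>S | S \<in> opposite R F \<and> L \<subseteq> S. card {M \<in> subs_between R S (Suc k). h M \<and> \<not> M \<subseteq> L})
    = CARD('a) ^ (n - vec.dim R - Suc k) * (card (subs_between R L k) - subcount R h k L)"
proof -
  let ?G = "{S \<in> opposite R F. L \<subseteq> S}"
    and ?new = "\<lambda>S. {M \<in> subs_between R S (Suc k). h M \<and> \<not> M \<subseteq> L}"
  let ?ext = "opposite_hyperplane.extensions perp sing n F L"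
  note hyperplane = opposite_hyperplane_subs_between[OF F L]
  have "(\<Sum>S\<in>?G. card (?new S)) = card (\<Union>S\<in>?G. ?new S)"
    by (rule sum_card_new_subs_eq_card_UN[OF L(1,3)])
  also have "(\<Union>S\<in>?G. ?new S) = {M \<in> \<Union>S\<in>?G. {M \<in> subs_between R S (Suc k). \<not> M \<subseteq> L}. h M}" by blast
  also have "\<dots> = (\<Union>M'\<in>subs_between R L k. {M \<in> ?ext M'. h M})"
    unfolding new_subs_eq_extensions[OF F L] by blast
  also have "card \<dots> = (\<Sum>M'\<in>subs_between R L k. card {M \<in> ?ext M'. h M})"
  proof (rule card_UN_disjoint; (intro ballI impI)?)
    fix A B assume "A \<in> subs_between R L k" "B \<in> subs_between R L k" "A \<noteq> B"
    then show "{M \<in> ?ext A. h M} \<inter> {M \<in> ?ext B. h M} = {}"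
      by (auto simp: opposite_hyperplane.extensions_def[OF hyperplane])
  qed auto
  also have "\<dots> = (\<Sum>M'\<in>subs_between R L k. if h M' then 0 else CARD('a) ^ (n - vec.dim R - Suc k))"
  proof (rule sum.cong[OF refl])
    fix M' assume M': "M' \<in> subs_between R L k"
    then interpret opposite_hyperplane perp sing n E F L M' by (rule hyperplane)
    have "vec.dim M' = vec.dim R + k" using M' by (simp add: subs_between_def)
    then show "card {M \<in> ?ext M'. h M} = (if h M' then 0 else CARD('a) ^ (n - vec.dim R - Suc k))"
      using card_extensions[of t Y] steiner t unfolding L(2) h_def by simp
  qed
  also have "\<dots> = CARD('a) ^ (n - vec.dim R - Suc k) * card {M' \<in> subs_between R L k. \<not> h M'}"
    by (simp add: sum.If_cases Int_def Compl_eq)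
  also have "{M' \<in> subs_between R L k. \<not> h M'}
      = subs_between R L k - {M' \<in> subs_between R L k. h M'}" by blast
  also have "card \<dots> = card (subs_between R L k) - subcount R h k L"
    unfolding subcount_def by (rule card_Diff_subset) auto
  finally show ?thesis .
qed

lemma sum_subcount_above:
  assumes steiner: "steiner R t Y" and t: "t + 1 = n" and F: "F \<in> gens"
    and L: "L \<in> ts_subspaces" "L \<inter> F = R" "vec.dim L + 1 = n"
  defines "h \<equiv> \<lambda>M. proj M F \<in> Y"
  shows "(\<Sum>S | S \<in> opposite R F \<and> L \<subseteq> S. real (subcount R h (Suc k) S))
    = E * real (subcount R h (Suc k) L)
    + CARD('a) ^ (n - vec.dim R - Suc k) * (q_binomial CARD('a) (n - 1 - vec.dim R) k - real (subcount R h k L))"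
proof -
  let ?G = "{S. S \<in> opposite R F \<and> L \<subseteq> S}"
  let ?new = "\<lambda>S. {M \<in> subs_between R S (Suc k). h M \<and> \<not> M \<subseteq> L}"
  have "subcount R h (Suc k) S = subcount R h (Suc k) L + card (?new S)" if "S \<in> ?G" for S
  proof -
    have "{M \<in> subs_between R S (Suc k). h M} = {M \<in> subs_between R L (Suc k). h M} \<union> ?new S"
      using that by (auto simp: subs_between_def)
    moreover have "{M \<in> subs_between R L (Suc k). h M} \<inter> ?new S = {}"
      by (auto simp: subs_between_def)
    ultimately show ?thesis by (simp add: subcount_def card_Un_disjoint)
  qed
  then have "(\<Sum>S\<in>?G. real (subcount R h (Suc k) S))
      = card ?G * real (subcount R h (Suc k) L) + real (\<Sum>S\<in>?G. card (?new S))"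
    by (simp add: sum.distrib)
  also have "card ?G = E" by (rule card_opposite_above[OF F L])
  also have "(\<Sum>S\<in>?G. card (?new S))
      = CARD('a) ^ (n - vec.dim R - Suc k) * (card (subs_between R L k) - subcount R h k L)"
    unfolding h_def by (rule sum_card_new_subs[OF steiner t F L])
  also have "real \<dots> = CARD('a) ^ (n - vec.dim R - Suc k)
      * (real (card (subs_between R L k)) - real (subcount R h k L))"
  proof -
    have "subcount R h k L \<le> card (subs_between R L k)"
      unfolding subcount_def by (rule card_mono) auto
    then show ?thesis by (simp add: of_nat_diff)
  qed
  also have "real (card (subs_between R L k)) = q_binomial CARD('a) (n - 1 - vec.dim R) k"
  proof -
    have "vec.dim L = n - 1" "R \<subseteq> L" using L(2,3) by auto
    then show ?thesis
      using card_subs_between[OF ts_subspace[OF steiner_base_ts[OF steiner]] ts_subspace[OF L(1)], of k]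
      by simp
  qed
  finally show ?thesis .
qed

lemma subcount_hyperplanes:
  assumes S: "S \<in> gens"
  shows "(\<Sum>L\<in>covers_below R S. subcount R p k L)
      = q_number CARD('a) (n - (vec.dim R + k)) * subcount R p k S"
proof -
  let ?M = "{M \<in> subs_between R S k. p M}"
  have above: "card {L \<in> covers_below R S. M \<subseteq> L} = q_number CARD('a) (n - (vec.dim R + k))"
    if "M \<in> ?M" for M
  proof -
    have M: "vec.subspace M" "R \<subseteq> M" "M \<subseteq> S" "vec.dim M = vec.dim R + k"
      using that by (auto simp: subs_between_def)
    have "{L \<in> covers_below R S. M \<subseteq> L} = covers_below M S"
      using M(2) by (auto simp: covers_below_def)
    then show ?thesis
      using card_covers_below[OF M(1) gens_subspace[OF S] M(3)] M(4) gens_dim[OF S] by simp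
  qed
  have "subcount R p k L = card {M \<in> ?M. M \<subseteq> L}" if "L \<in> covers_below R S" for L
    unfolding subcount_def
    using that by (intro arg_cong[where f = card]) (auto simp: subs_between_def covers_below_def)
  then have "(\<Sum>L\<in>covers_below R S. subcount R p k L) = (\<Sum>L\<in>covers_below R S. card {M \<in> ?M. M \<subseteq> L})"
    by simp
  also have "\<dots> = q_number CARD('a) (n - (vec.dim R + k)) * card ?M"
    by (rule sum_multicount) (use above in auto)
  finally show ?thesis by (simp add: subcount_def)
qed

lemma subcount_orthogonal:
  fixes g :: "('a ^ 'm) set \<Rightarrow> real"
  assumes R: "R \<in> ts_subspaces" and k: "vec.dim R + k < n"
    and g: "\<And>L. L \<in> ts_subspaces \<Longrightarrow> L \<inter> F = R \<Longrightarrow> vec.dim L + 1 = n \<Longrightarrow>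
        (\<Sum>S | S \<in> opposite R F \<and> L \<subseteq> S. g S) = 0"
  shows "(\<Sum>S\<in>opposite R F. g S * real (subcount R p k S)) = 0"
proof -
  let ?G = "opposite R F" and ?hyp = "{L \<in> ts_subspaces. L \<inter> F = R \<and> vec.dim L + 1 = n}"
  let ?c = "real (q_number CARD('a) (n - (vec.dim R + k)))"
  have hyperplanes: "{L \<in> ?hyp. L \<subseteq> S} = covers_below R S" if "S \<in> ?G" for S
  proof -
    have S: "S \<in> gens" "S \<inter> F = R" using that by (auto simp: opposite_def)
    have "L \<inter> F = R" if "R \<subseteq> L" "L \<subseteq> S" for L using that S(2) by blast
    then show ?thesis
      using S(2) gens_dim[OF S(1)] ts_subset[OF gens_ts[OF S(1)]] ts_subspace
      unfolding covers_below_def by auto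
  qed
  have "?c * real (subcount R p k S) = (\<Sum>L | L \<in> ?hyp \<and> L \<subseteq> S. real (subcount R p k L))" if "S \<in> ?G"
    for S
  proof -
    have "S \<in> gens" using that by (auto simp: opposite_def)
    then show ?thesis
      using subcount_hyperplanes[of S R p k] hyperplanes[OF that] by (simp flip: of_nat_sum)
  qed
  then have "?c * (\<Sum>S\<in>?G. g S * real (subcount R p k S))
      = (\<Sum>S\<in>?G. \<Sum>L | L \<in> ?hyp \<and> L \<subseteq> S. g S * real (subcount R p k L))"
    by (simp add: sum_distrib_left[symmetric] mult.left_commute[of ?c])
      (simp add: sum_distrib_left mult.left_commute[of ?c])
  also have "\<dots> = (\<Sum>L\<in>?hyp. \<Sum>S | S \<in> ?G \<and> L \<subseteq> S. g S * real (subcount R p k L))"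
    by (rule sum.swap_restrict) auto
  also have "\<dots> = (\<Sum>L\<in>?hyp. (\<Sum>S | S \<in> ?G \<and> L \<subseteq> S. g S) * real (subcount R p k L))"
    by (simp only: sum_distrib_right)
  also have "\<dots> = 0" using g by simp
  finally show ?thesis using q_number_pos[of "n - (vec.dim R + k)" "CARD('a)"] k by simp
qed

text \<open>
  The following function has sum zero over the opposite generators through any \<open>L\<close>, so it is
  orthogonal to everything in its definition except the indicator function of \<open>Y\<close>; hence the sum of
  its squares is its sum over \<open>Y\<close>.
\<close>

definition projected_indicator ::
  "('a ^ 'm) set \<Rightarrow> ('a ^ 'm) set set \<Rightarrow> ('a ^ 'm) set \<Rightarrow> nat \<Rightarrow> (nat \<Rightarrow> real) \<Rightarrow> real \<Rightarrow> ('a ^ 'm) set \<Rightarrow> real" where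
  "projected_indicator R Y F m \<gamma> c S = (\<Sum>k\<le>m. \<gamma> k * real (subcount R (\<lambda>M. proj M F \<in> Y) k S)) - c"

context
  fixes R t Y F m and \<gamma> :: "nat \<Rightarrow> real" and c :: real
  assumes steiner: "steiner R t Y" and t: "t + 1 = n" and F: "F \<in> gens"
    and m: "vec.dim R + m = n" "m > 0"
    and \<gamma>: "\<gamma> m = 1" "\<And>k. k < m \<Longrightarrow> \<gamma> k * E = \<gamma> (Suc k) * CARD('a) ^ (m - Suc k)"
    and c_eq: "c * E = (\<Sum>k<m. \<gamma> (Suc k) * CARD('a) ^ (m - Suc k) * q_binomial CARD('a) (m - 1) k)"
begin

lemma sum_projected_indicator_above:
  assumes L: "L \<in> ts_subspaces" "L \<inter> F = R" "vec.dim L + 1 = n"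
  shows "(\<Sum>S | S \<in> opposite R F \<and> L \<subseteq> S. projected_indicator R Y F m \<gamma> c S) = 0"
proof -
  let ?G = "{S. S \<in> opposite R F \<and> L \<subseteq> S}" and ?N = "subcount R (\<lambda>M. proj M F \<in> Y)"
  let ?f = "\<lambda>k. \<gamma> k * E * real (?N k L)"
  have R: "R \<in> ts_subspaces" "R \<subseteq> L" using steiner_base_ts[OF steiner] L(2) by auto
  have card_G: "real (card ?G) = E" using card_opposite_above[OF F L] by simp
  have "M \<notin> subs_between R L m" for M
    using m(1) L(3) vec.dim_subset[of M L] by (auto simp: subs_between_def)
  then have "subs_between R L m = {}" by blast
  then have f_top: "?f m = 0" by (simp add: subcount_def)
  have term_0: "\<gamma> 0 * (\<Sum>S\<in>?G. real (?N 0 S)) = ?f 0"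
  proof -
    have "?N 0 S = ?N 0 L" if "S \<in> ?G" for S
      using subcount_0[OF R(1), of S] subcount_0[OF R] that R(2) by auto
    then show ?thesis using card_G by simp
  qed
  have term_Suc: "\<gamma> (Suc k) * (\<Sum>S\<in>?G. real (?N (Suc k) S))
      = (?f (Suc k) - ?f k) + \<gamma> (Suc k) * CARD('a) ^ (m - Suc k) * q_binomial CARD('a) (m - 1) k" if "k < m" for k
  proof -
    have "n - vec.dim R = m" "n - 1 - vec.dim R = m - 1" using m by auto
    then have sum_Suc: "(\<Sum>S\<in>?G. real (?N (Suc k) S)) = E * real (?N (Suc k) L)
        + CARD('a) ^ (m - Suc k) * (q_binomial CARD('a) (m - 1) k - real (?N k L))"
      using sum_subcount_above[OF steiner t F L, of k] by simp
    show ?thesis unfolding \<gamma>(2)[OF that] sum_Suc by (simp add: algebra_simps)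
  qed
  have "(\<Sum>S\<in>?G. \<Sum>k\<le>m. \<gamma> k * real (?N k S)) = (\<Sum>k\<le>m. \<gamma> k * (\<Sum>S\<in>?G. real (?N k S)))"
    unfolding sum_distrib_left by (rule sum.swap)
  also have "\<dots> = ?f 0 + (\<Sum>k<m. \<gamma> (Suc k) * (\<Sum>S\<in>?G. real (?N (Suc k) S)))"
    unfolding sum.atMost_shift term_0 ..
  also have "\<dots> = ?f 0 + (\<Sum>k<m. ?f (Suc k) - ?f k) + c * E"
    using term_Suc by (simp add: sum.distrib c_eq)
  also have "\<dots> = c * E" using sum_lessThan_telescope[of ?f m] f_top by simp
  finally show ?thesis
    unfolding projected_indicator_def using card_G by (simp add: sum_subtractf mult.commute)
qed

lemma sum_projected_indicator: "(\<Sum>S\<in>opposite R F. projected_indicator R Y F m \<gamma> c S) = 0"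
proof -
  have "vec.dim R + 0 < n" using m by simp
  from subcount_orthogonal[OF steiner_base_ts[OF steiner] this sum_projected_indicator_above, of "\<lambda>_. True"]
  have "(\<Sum>S\<in>opposite R F. projected_indicator R Y F m \<gamma> c S * real (subcount R (\<lambda>_. True) 0 S)) = 0"
    by simp
  moreover have "subcount R (\<lambda>_. True) 0 S = 1" if "S \<in> opposite R F" for S
    using subcount_0[OF steiner_base_ts[OF steiner], of S] that by (auto simp: opposite_def)
  ultimately show ?thesis by simp
qed

theorem opposite_inequality: "0 \<le> (\<Sum>S\<in>opposite R F \<inter> Y. projected_indicator R Y F m \<gamma> c S)"
proof -
  let ?G = "opposite R F" and ?N = "subcount R (\<lambda>M. proj M F \<in> Y)"
  let ?g = "projected_indicator R Y F m \<gamma> c"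
  have "x * ((\<Sum>k\<le>m. \<gamma> k * real (?N k S)) - c) = (\<Sum>k\<le>m. \<gamma> k * (x * real (?N k S))) - c * x" for x S
    by (simp add: right_diff_distrib sum_distrib_left mult_ac)
  then have "?g S * ?g S = (\<Sum>k\<le>m. \<gamma> k * (?g S * real (?N k S))) - c * ?g S" for S
    by (simp only: projected_indicator_def)
  then have "(\<Sum>S\<in>?G. ?g S * ?g S) = (\<Sum>S\<in>?G. \<Sum>k\<le>m. \<gamma> k * (?g S * real (?N k S))) - c * (\<Sum>S\<in>?G. ?g S)"
    by (simp only: sum_subtractf sum_distrib_left)
  also have "(\<Sum>S\<in>?G. \<Sum>k\<le>m. \<gamma> k * (?g S * real (?N k S))) = (\<Sum>k\<le>m. \<gamma> k * (\<Sum>S\<in>?G. ?g S * real (?N k S)))"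
    unfolding sum_distrib_left by (rule sum.swap)
  also have "\<dots> = (\<Sum>k<m. \<gamma> k * (\<Sum>S\<in>?G. ?g S * real (?N k S))) + (\<Sum>S\<in>?G. ?g S * real (?N m S))"
    using \<gamma>(1) by (simp flip: lessThan_Suc_atMost)
  also have "(\<Sum>k<m. \<gamma> k * (\<Sum>S\<in>?G. ?g S * real (?N k S))) = 0"
  proof (rule sum.neutral, intro ballI)
    fix k assume "k \<in> {..<m}"
    then have "vec.dim R + k < n" using m by simp
    from subcount_orthogonal[OF steiner_base_ts[OF steiner] this sum_projected_indicator_above]
    show "\<gamma> k * (\<Sum>S\<in>?G. ?g S * real (?N k S)) = 0" by simp
  qed
  also have "(\<Sum>S\<in>?G. ?g S * real (?N m S)) = (\<Sum>S\<in>?G. if S \<in> Y then ?g S else 0)"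
    using subcount_top[OF _ F m(1)] by (intro sum.cong refl) simp
  also have "\<dots> = (\<Sum>S\<in>?G \<inter> Y. ?g S)" by (simp add: sum.inter_restrict)
  finally have "(\<Sum>S\<in>?G \<inter> Y. ?g S) = (\<Sum>S\<in>?G. ?g S * ?g S)" using sum_projected_indicator by simp
  then show ?thesis by (simp add: sum_nonneg)
qed

end

lemma dim_proj_opposite:
  assumes M: "M \<in> subs_between R S k" and S: "S \<in> opposite R F" and F: "F \<in> gens"
  shows "M \<in> ts_subspaces" "M \<inter> F = R" "vec.dim (proj M F \<inter> F) + k = n"
proof -
  have S': "S \<in> gens" "S \<inter> F = R" using S by (auto simp: opposite_def)
  have M': "vec.subspace M" "R \<subseteq> M" "M \<subseteq> S" "vec.dim M = vec.dim R + k"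
    using M by (auto simp: subs_between_def)
  show M_ts: "M \<in> ts_subspaces" using ts_subset[OF gens_ts[OF S'(1)] M'(1,3)] .
  show meet: "M \<inter> F = R" using M' S'(2) by blast
  show "vec.dim (proj M F \<inter> F) + k = n" using dim_proj_Int[OF M_ts F] meet M'(4) by simp
qed

lemma subcount_hyperplane_zero:
  assumes steiner: "steiner R t Y" and k: "vec.dim R + k = t" "t + 1 = n" "k > 0"
    and S: "S \<in> opposite R F" "S \<in> Y" and F: "F \<in> gens"
  shows "subcount R (\<lambda>M. proj M F \<in> Y) k S = 0"
proof -
  have "proj M F \<notin> Y" if M: "M \<in> subs_between R S k" for M
  proof
    assume block: "proj M F \<in> Y"
    note d = dim_proj_opposite[OF M S(1) F]
    have "R \<subseteq> M" "M \<subseteq> S" "vec.dim M = t" using M k by (auto simp: subs_between_def)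
    then have "proj M F = S" using steiner_eq[OF steiner d(1) _ _ block S(2) subset_proj] by auto
    then show False using d(3) S(1) k by (auto simp: opposite_def)
  qed
  then have "{M \<in> subs_between R S k. proj M F \<in> Y} = {}" by blast
  then show ?thesis by (simp add: subcount_def)
qed

lemma subcount_point_zero:
  assumes steiner: "steiner R t Y" and t: "t + 1 = n" and S: "S \<in> opposite R F" and F: "F \<in> Y"
  shows "subcount R (\<lambda>M. proj M F \<in> Y) 1 S = 0"
proof -
  have F_gens: "F \<in> gens" using steiner_gens[OF steiner F] .
  have "proj M F \<notin> Y" if M: "M \<in> subs_between R S 1" for M
  proof
    assume block: "proj M F \<in> Y"
    note d = dim_proj_opposite[OF M S F_gens]
    have "proj M F = F" using steiner_dim_Int[OF steiner block F] d(3) t by auto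
    then have "M = R" using subset_proj[of M F] d(2) by blast
    then show False using M by (auto simp: subs_between_def)
  qed
  then have "{M \<in> subs_between R S 1. proj M F \<in> Y} = {}" by blast
  then show ?thesis by (simp add: subcount_def)
qed

lemma card_rank3_disjoint:
  assumes steiner: "steiner R (vec.dim R + 2) Y" and n: "n = vec.dim R + 3" and U: "U \<in> Y"
  shows "real (card {W \<in> Y. U \<inter> W = R}) = real CARD('a) ^ 3 * real E * (real E - 1)"
proof -
  let ?q = "real CARD('a)" and ?e = "real E"
  have "real (card {W \<in> Y. U \<inter> W = R})
      = (?e * ?q ^ 2 + 1) * (?e * ?q + 1) - 1 - q_number CARD('a) 3 * (?e * ?q)"
    using card_steiner2_disjoint[OF steiner U] blocks_through_2[of "vec.dim R" 1] n
    by (simp add: numeral_2_eq_2 numeral_3_eq_3)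
  also have "real (q_number CARD('a) 3) = 1 + ?q + ?q ^ 2"
    by (simp add: numeral_3_eq_3 q_number_Suc numeral_2_eq_2)
  also have "(?e * ?q ^ 2 + 1) * (?e * ?q + 1) - 1 - (1 + ?q + ?q ^ 2) * (?e * ?q)
      = ?q ^ 3 * ?e * (?e - 1)"
    by (simp add: algebra_simps power2_eq_square power3_eq_cube)
  finally show ?thesis .
qed

lemma rank3_value_neg:
  fixes q e :: real
  assumes "1 < e" "e \<le> q"
  shows "1 + q ^ 3 / e ^ 3 - (q ^ 3 / e\<^sup>2 + q * (q + 1) / e + 1) / e < 0"
proof -
  have "1 + q ^ 3 / e ^ 3 - (q ^ 3 / e\<^sup>2 + q * (q + 1) / e + 1) / e = (e\<^sup>2 - q * (q + 1) - e) / e\<^sup>2"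
    using assms by (simp add: field_simps power2_eq_square power3_eq_cube)
  also have "e\<^sup>2 \<le> q * q" using assms unfolding power2_eq_square by (intro mult_mono) auto
  then have "(e\<^sup>2 - q * (q + 1) - e) / e\<^sup>2 < 0"
    using assms by (intro divide_neg_pos) (auto simp: algebra_simps)
  finally show ?thesis .
qed

lemma card_opposite_steiner_pos:
  assumes "steiner R (vec.dim R + 2) Y" "n = vec.dim R + 3" "1 < E" "F \<in> Y"
  shows "card (opposite R F \<inter> Y) > 0"
proof -
  have "{W \<in> Y. F \<inter> W = R} = opposite R F \<inter> Y"
    using steiner_gens[OF assms(1)] by (auto simp: opposite_def)
  moreover have "real (card {W \<in> Y. F \<inter> W = R}) > 0"
    unfolding card_rank3_disjoint[OF assms(1,2,4)] using assms(3) CARD_ge_2 by simp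
  ultimately show ?thesis by simp
qed

lemma opposite_inequality_rank3:
  assumes steiner: "steiner R (vec.dim R + 2) Y" and n: "n = vec.dim R + 3" and E: "E > 0"
    and F: "F \<in> Y"
  defines "c \<equiv> (real CARD('a) ^ 3 / (real E)\<^sup>2 + real CARD('a) * (real CARD('a) + 1) / real E + 1) / real E"
  shows "0 \<le> real (card (opposite R F \<inter> Y)) * (1 + real CARD('a) ^ 3 / real E ^ 3 - c)"
proof -
  let ?q = "real CARD('a)" and ?e = "real E"
  have F_gens: "F \<in> gens" and R_F: "R \<subseteq> F"
    using steiner_gens[OF steiner F] steiner_base_subset[OF steiner F] by auto
  define \<gamma> where "\<gamma> k = (if k = 3 then 1 else if k = 2 then 1 / ?e else if k = 1 then ?q / ?e ^ 2 else ?q ^ 3 / ?e ^ 3)"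
    for k :: nat
  let ?g = "projected_indicator R Y F 3 \<gamma> c"
  have "0 \<le> (\<Sum>S\<in>opposite R F \<inter> Y. ?g S)"
  proof (rule opposite_inequality[OF steiner _ F_gens, of 3])
    fix k :: nat assume "k < 3"
    then consider "k = 0" | "k = 1" | "k = 2" by linarith
    then show "\<gamma> k * ?e = \<gamma> (Suc k) * CARD('a) ^ (3 - Suc k)"
      using E by cases (simp_all add: \<gamma>_def field_simps power2_eq_square power3_eq_cube)
  next
    show "c * ?e = (\<Sum>k<3. \<gamma> (Suc k) * CARD('a) ^ (3 - Suc k) * q_binomial CARD('a) (3 - 1) k)"
      using E by (simp add: c_def \<gamma>_def numeral_3_eq_3 q_number_Suc field_simps power2_eq_square)
  qed (use n in \<open>auto simp: \<gamma>_def\<close>)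
  also have "\<dots> = (\<Sum>S\<in>opposite R F \<inter> Y. 1 + ?q ^ 3 / ?e ^ 3 - c)"
  proof (rule sum.cong[OF refl])
    fix S assume "S \<in> opposite R F \<inter> Y"
    then have S: "S \<in> opposite R F" "S \<in> Y" by auto
    have dims: "vec.dim R + 3 = n" "vec.dim R + 2 + 1 = n" using n by auto
    have "subcount R (\<lambda>M. proj M F \<in> Y) 3 S = 1"
      using subcount_top[OF S(1) F_gens dims(1), of Y] S(2) by simp
    moreover have "subcount R (\<lambda>M. proj M F \<in> Y) 2 S = 0"
      by (rule subcount_hyperplane_zero[OF steiner refl dims(2) _ S F_gens]) simp
    moreover have "subcount R (\<lambda>M. proj M F \<in> Y) 1 S = 0"
      by (rule subcount_point_zero[OF steiner dims(2) S(1) F])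
    moreover have "subcount R (\<lambda>M. proj M F \<in> Y) 0 S = 1"
      using subcount_base[OF steiner_base_ts[OF steiner] F_gens R_F S(1)] F by simp
    moreover have "{..3} = {0, 1, 2, 3 :: nat}" by auto
    ultimately show "?g S = 1 + ?q ^ 3 / ?e ^ 3 - c" by (simp add: projected_indicator_def \<gamma>_def)
  qed
  finally show ?thesis by simp
qed

theorem no_steiner_rank3:
  assumes steiner: "steiner R (vec.dim R + 2) Y" and n: "n = vec.dim R + 3"
    and E: "1 < E" "E \<le> CARD('a)"
  shows False
proof -
  obtain F where F: "F \<in> Y" using steiner_nonempty[OF steiner] by blast
  have "1 < real E" "real E \<le> real CARD('a)" using E by auto
  note neg = rank3_value_neg[OF this]
  have "card (opposite R F \<inter> Y) > 0" by (rule card_opposite_steiner_pos[OF steiner n E(1) F])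
  from mult_pos_neg[OF _ neg, of "real (card (opposite R F \<inter> Y))"] this
  show False using opposite_inequality_rank3[OF steiner n _ F] E(1) by (simp add: not_le)
qed

lemma ex_gens_notin_steiner:
  assumes steiner: "steiner R t Y" and t: "t < n" and E: "E > 0"
  obtains F where "F \<in> gens" "R \<subseteq> F" "F \<notin> Y"
proof -
  obtain U where U: "U \<in> Y" using steiner_nonempty[OF steiner] by blast
  have U_gens: "U \<in> gens" and R_U: "R \<subseteq> U"
    using steiner_gens[OF steiner U] steiner_base_subset[OF steiner U] by auto
  have r: "vec.dim R + (n - 1 - vec.dim R) = n - 1" using steiner t by (auto simp: steiner_def)
  obtain H where H: "vec.subspace H" "R \<subseteq> H" "H \<subseteq> U" "vec.dim H = n - 1"
    using subs_between_nonempty[OF ts_subspace[OF steiner_base_ts[OF steiner]] gens_subspace[OF U_gens] R_U, of "n - 1 - vec.dim R"]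
      gens_dim[OF U_gens] r by auto
  have H_ts: "H \<in> ts_subspaces" by (rule ts_subset[OF gens_ts[OF U_gens] H(1,3)])
  have "card ({G \<in> gens. H \<subseteq> G} - {U}) = E"
    using card_gens_above[OF H_ts] H(3,4) U_gens t by (simp add: card_Diff_singleton)
  then have "{G \<in> gens. H \<subseteq> G} - {U} \<noteq> {}" using E by (metis card.empty less_irrefl)
  then obtain G where G: "G \<in> gens" "H \<subseteq> G" "G \<noteq> U" by blast
  have "t \<le> vec.dim H" using H(4) t by linarith
  then have "G \<notin> Y" using steiner_eq[OF steiner H_ts H(2) _ _ U G(2) H(3)] G(3) by blast
  then show ?thesis using that G H(2) by blast
qed

definition projecting_into :: "('a ^ 'm) set set \<Rightarrow> ('a ^ 'm) set \<Rightarrow> ('a ^ 'm) set \<Rightarrow> nat \<Rightarrow> ('a ^ 'm) set set" where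
  "projecting_into Y R F k = {M \<in> level R (vec.dim R + k). M \<inter> F = R \<and> proj M F \<in> Y}"

lemma projecting_intoD:
  assumes "M \<in> projecting_into Y R F k" and F: "F \<in> gens"
  shows "M \<in> ts_subspaces" "R \<subseteq> M" "vec.dim M = vec.dim R + k" "M \<inter> F = R" "proj M F \<in> Y" "M \<subseteq> proj M F"
    "vec.dim (F \<inter> proj M F) + k = n"
proof -
  show M: "M \<in> ts_subspaces" "R \<subseteq> M" "vec.dim M = vec.dim R + k" "M \<inter> F = R" "proj M F \<in> Y"
    using assms(1) by (auto simp: projecting_into_def level_def)
  show "M \<subseteq> proj M F" by (rule subset_proj)
  show "vec.dim (F \<inter> proj M F) + k = n"
    using dim_proj_Int[OF M(1) F] M(3,4) by (simp add: Int_commute)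
qed

lemma sum_subcount_le:
  assumes F: "F \<in> gens"
    and B: "\<And>M. M \<in> projecting_into Y R F k \<Longrightarrow> card {S \<in> opposite R F \<inter> Y. M \<subseteq> S} \<le> B"
  shows "(\<Sum>S\<in>opposite R F \<inter> Y. subcount R (\<lambda>M. proj M F \<in> Y) k S) \<le> card (projecting_into Y R F k) * B"
proof -
  let ?P = "projecting_into Y R F k"
  have "subcount R (\<lambda>M. proj M F \<in> Y) k S = card {M \<in> ?P. M \<subseteq> S}" if "S \<in> opposite R F \<inter> Y" for S
  proof -
    have "{M \<in> subs_between R S k. proj M F \<in> Y} = {M \<in> ?P. M \<subseteq> S}"
      using dim_proj_opposite(1,2)[of _ R S k F] that F ts_subspace
      by (auto simp: subs_between_def projecting_into_def level_def)
    then show ?thesis by (simp add: subcount_def)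
  qed
  then have "(\<Sum>S\<in>opposite R F \<inter> Y. subcount R (\<lambda>M. proj M F \<in> Y) k S)
      = (\<Sum>S\<in>opposite R F \<inter> Y. card {M \<in> ?P. M \<subseteq> S})"
    by simp
  also have "\<dots> = (\<Sum>M\<in>?P. card {S \<in> opposite R F \<inter> Y. M \<subseteq> S})"
    by (rule sum_multicount_gen) auto
  also have "\<dots> \<le> (\<Sum>M\<in>?P. B)" using B by (intro sum_mono)
  finally show ?thesis by simp
qed

lemma card_projecting_into_le:
  assumes steiner: "steiner R t Y" and F: "F \<in> gens" "R \<subseteq> F"
  shows "real (card (projecting_into Y R F k))
    \<le> card {W \<in> Y. vec.dim (F \<inter> W) + k = n} * (real CARD('a) ^ ((n - k - vec.dim R) * k) * q_binomial CARD('a) k k)"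
proof -
  let ?W = "{W \<in> Y. vec.dim (F \<inter> W) + k = n}"
    and ?M = "\<lambda>W. {M \<in> subs_between R W k. M \<inter> (F \<inter> W) = R}"
  have "M \<in> (\<Union>W\<in>?W. ?M W)" if "M \<in> projecting_into Y R F k" for M
  proof -
    note m = projecting_intoD[OF that F(1)]
    have "M \<inter> (F \<inter> proj M F) = R" using m(4,6) by blast
    then have "M \<in> ?M (proj M F)"
      using m(2,3,6) ts_subspace[OF m(1)] by (simp add: subs_between_def)
    then show ?thesis using m(5,7) by blast
  qed
  then have "card (projecting_into Y R F k) \<le> card (\<Union>W\<in>?W. ?M W)" by (intro card_mono) auto
  also have "\<dots> \<le> (\<Sum>W\<in>?W. card (?M W))" by (intro card_UN_le) auto
  finally have "real (card (projecting_into Y R F k)) \<le> (\<Sum>W\<in>?W. real (card (?M W)))"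
    by (simp flip: of_nat_sum)
  also have "\<dots> = (\<Sum>W\<in>?W. real CARD('a) ^ ((n - k - vec.dim R) * k) * q_binomial CARD('a) k k)"
  proof (rule sum.cong[OF refl])
    fix W assume W: "W \<in> ?W"
    then have W_gens: "W \<in> gens" "R \<subseteq> W"
      using steiner_gens[OF steiner] steiner_base_subset[OF steiner] by auto
    have "vec.dim (F \<inter> W) = n - k" "vec.dim W - vec.dim (F \<inter> W) = k"
      using W gens_dim[OF W_gens(1)] by auto
    then show "real (card (?M W)) = real CARD('a) ^ ((n - k - vec.dim R) * k) * q_binomial CARD('a) k k"
      using card_subs_between_disjoint[OF ts_subspace[OF steiner_base_ts[OF steiner]]
          vec.subspace_inter[OF gens_subspace[OF F(1)] gens_subspace[OF W_gens(1)]] gens_subspace[OF W_gens(1)]] F(2) W_gens(2)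
      by simp
  qed
  finally show ?thesis by simp
qed

lemma card_opposite_through_le:
  assumes steiner: "steiner R t Y" and F: "F \<in> gens" and M: "M \<in> projecting_into Y R F k"
    and k: "vec.dim R + k \<le> t" "t < n"
  shows "card {S \<in> opposite R F \<inter> Y. M \<subseteq> S} \<le> blocks_through t (vec.dim R + k) - 1"
proof -
  note m = projecting_intoD[OF M F]
  have "vec.dim (F \<inter> proj M F) \<noteq> vec.dim R" using m(7) k by linarith
  then have "proj M F \<notin> opposite R F" by (auto simp: opposite_def Int_commute)
  then have "{S \<in> opposite R F \<inter> Y. M \<subseteq> S} \<subseteq> {W \<in> Y. M \<subseteq> W} - {proj M F}" by blast
  then have "card {S \<in> opposite R F \<inter> Y. M \<subseteq> S} \<le> card ({W \<in> Y. M \<subseteq> W} - {proj M F})"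
    by (intro card_mono) auto
  also have "\<dots> = blocks_through t (vec.dim R + k) - 1"
    using card_steiner_above[OF steiner m(1,2)] m(3,5,6) k(1) by (simp add: card_Diff_singleton)
  finally show ?thesis .
qed

lemma card_opposite_through_point_le:
  assumes steiner: "steiner R (vec.dim R + 3) Y" and n: "n = vec.dim R + 4"
    and F: "F \<in> gens" and M: "M \<in> projecting_into Y R F 1"
  shows "real (card {S \<in> opposite R F \<inter> Y. M \<subseteq> S}) \<le> real CARD('a) ^ 3 * real E * (real E - 1)"
proof -
  note m = projecting_intoD[OF M F]
  let ?Y = "{W \<in> Y. M \<subseteq> W}"
  have steiner_M: "steiner M (vec.dim M + 2) ?Y"
    using steiner_residue[OF steiner m(1,2)] m(3) by (simp add: numeral_3_eq_3)
  have "proj M F \<inter> S = M" if "S \<in> opposite R F" "M \<subseteq> S" for S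
    by (rule proj_Int_eq[OF m(1) gens_subspace[OF F] _ that(2)])
      (use that(1) m(2) in \<open>auto simp: opposite_def gens_subspace\<close>)
  then have "{S \<in> opposite R F \<inter> Y. M \<subseteq> S} \<subseteq> {W \<in> ?Y. proj M F \<inter> W = M}" by blast
  then have "card {S \<in> opposite R F \<inter> Y. M \<subseteq> S} \<le> card {W \<in> ?Y. proj M F \<inter> W = M}"
    by (intro card_mono) auto
  also have "real (card {W \<in> ?Y. proj M F \<inter> W = M}) = real CARD('a) ^ 3 * real E * (real E - 1)"
    using card_rank3_disjoint[OF steiner_M, of "proj M F"] m(3,5,6) n by simp
  finally show ?thesis by simp
qed

lemma dim_Int_nonmember:
  assumes steiner: "steiner R t Y" and F: "F \<in> gens" "R \<subseteq> F" "F \<notin> Y" and W: "W \<in> Y"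
  shows "vec.dim R \<le> vec.dim (F \<inter> W)" "vec.dim (F \<inter> W) < n"
proof -
  have W_gens: "W \<in> gens" "R \<subseteq> W"
    using steiner_gens[OF steiner W] steiner_base_subset[OF steiner W] by auto
  show "vec.dim R \<le> vec.dim (F \<inter> W)" using F(2) W_gens(2) by (intro vec.dim_subset) auto
  have "\<not> F \<subseteq> W" using gens_eqI[OF F(1) W_gens(1)] F(3) W by blast
  then show "vec.dim (F \<inter> W) < n"
    using vec.subspace_dim_equal[OF vec.subspace_inter gens_subspace[OF F(1)], of F W] W_gens(1)
      F(1)
    by (auto simp: gens_subspace gens_dim not_less[symmetric])
qed

lemma opposite_Int_steiner:
  assumes steiner: "steiner R t Y" and F: "F \<in> gens" "R \<subseteq> F"
  shows "opposite R F \<inter> Y = {W \<in> Y. vec.dim (F \<inter> W) = vec.dim R}"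
proof -
  have "W \<inter> F = R \<longleftrightarrow> vec.dim (F \<inter> W) = vec.dim R" if "W \<in> Y" for W
    using vec.subspace_dim_equal[OF ts_subspace[OF steiner_base_ts[OF steiner]] vec.subspace_inter[OF gens_subspace[OF F(1)]
          gens_subspace[OF steiner_gens[OF steiner that]]]] F(2) steiner_base_subset[OF steiner that]
    by (auto simp: Int_commute)
  then show ?thesis using steiner_gens[OF steiner] by (auto simp: opposite_def)
qed

context
  fixes R Y F
  assumes steiner: "steiner R (vec.dim R + 3) Y" and n: "n = vec.dim R + 4" and E: "E = 8"
    and q: "CARD('a) = 4"
    and F: "F \<in> gens" "R \<subseteq> F" "F \<notin> Y"
begin

lemma card_steiner_dim_Int:
  fixes c0 c1 c2 c3 :: real
  assumes "of_bool (i = 0) = c0" "of_bool (i = 1) = c0 + c1" "of_bool (i = 2) = c0 + 5 * c1 + c2"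
    "of_bool (i = 3) = c0 + 21 * c1 + 21 * c2 + c3"
  shows "real (card {W \<in> Y. vec.dim (F \<inter> W) = vec.dim R + i})
      = c0 * 2183841 + c1 * (85 * 4257) + c2 * (357 * 33) + c3 * 85"
proof -
  let ?r = "vec.dim R"
  define c where "c j = (if j = 0 then c0 else if j = 1 then c1 else if j = 2 then c2 else c3)"
    for j :: nat
  have "vec.dim (F \<inter> W) = ?r + i \<longleftrightarrow> vec.dim (F \<inter> W) - ?r = i" if "W \<in> Y" for W
    using dim_Int_nonmember(1)[OF steiner F that] by auto
  then have "{W \<in> Y. vec.dim (F \<inter> W) = ?r + i} = Y \<inter> {W. i = vec.dim (F \<inter> W) - ?r}" by blast
  then have "real (card {W \<in> Y. vec.dim (F \<inter> W) = ?r + i})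
      = (\<Sum>W\<in>Y - {F}. of_bool (i = vec.dim (F \<inter> W) - ?r))"
    using F(3) by (simp add: sum.If_cases of_bool_def)
  also have "\<dots> = (\<Sum>j\<le>3. c j * (q_binomial CARD('a) (n - ?r) j * (real (blocks_through (?r + 3) (?r + j)) - of_bool (F \<in> Y))))"
  proof (rule steiner_sum[OF steiner F(1,2)])
    fix W assume "W \<in> Y - {F}"
    then have "vec.dim (F \<inter> W) - ?r \<in> {0, 1, 2, 3}"
      using dim_Int_nonmember[OF steiner F, of W] n by auto
    then show "of_bool (i = vec.dim (F \<inter> W) - ?r)
        = (\<Sum>j\<le>3. c j * q_binomial CARD('a) (vec.dim (F \<inter> W) - ?r) j)"
      unfolding q
      using assms
      by (elim insertE emptyE) (simp_all only:, simp_all add: c_def eval_nat_numeral q_number_def)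
  qed simp
  also have "\<dots> = c0 * 2183841 + c1 * (85 * 4257) + c2 * (357 * 33) + c3 * 85"
  proof -
    have "{..3} = {0, 1, 2, 3 :: nat}" by auto
    moreover have "q_binomial 4 4 1 = 85" "q_binomial 4 4 2 = 357" "q_binomial 4 4 3 = 85"
      by (simp_all add: eval_nat_numeral q_number_def)
    moreover have "real (blocks_through (?r + 3) ?r) = 2183841"
      "real (blocks_through (?r + 3) (?r + 1)) = 4257"
      "real (blocks_through (?r + 3) (?r + 2)) = 33"
      using blocks_through_3[of ?r 1] n E q by simp_all
    moreover have "real (blocks_through (?r + 3) (?r + 3)) = 1" by simp
    moreover have "n - ?r = 4" using n by simp
    ultimately show ?thesis using F(3) q by (simp add: c_def)
  qed
  finally show ?thesis .
qed

lemma card_opposite_steiner: "real (card (opposite R F \<inter> Y)) = 1863680"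
  unfolding opposite_Int_steiner[OF steiner F(1,2)]
  using card_steiner_dim_Int[of 0 1 "- 1" 4 "- 64"] by simp

lemma sum_subcount_line_le: "real (\<Sum>S\<in>opposite R F \<inter> Y. subcount R (\<lambda>M. proj M F \<in> Y) 2 S)
    \<le> (9996 * 256) * 32"
proof -
  have "vec.dim (F \<inter> W) + 2 = n \<longleftrightarrow> vec.dim (F \<inter> W) = vec.dim R + 2" for W using n by auto
  then have "real (card {W \<in> Y. vec.dim (F \<inter> W) + 2 = n}) = 9996"
    using card_steiner_dim_Int[of 2 0 0 1 "- 21"] by simp
  moreover have "q_binomial 4 2 2 = 1" by (simp add: eval_nat_numeral q_number_def)
  moreover have "(n - 2 - vec.dim R) * 2 = 4" using n by simp
  ultimately have "real (card (projecting_into Y R F 2)) \<le> 9996 * 256"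
    using card_projecting_into_le[OF steiner F(1,2), of 2] q by simp
  moreover have "real (blocks_through (vec.dim R + 3) (vec.dim R + 2)) = 33"
    using blocks_through_3(3)[of "vec.dim R" 1] n E q by simp
  then have "card {S \<in> opposite R F \<inter> Y. M \<subseteq> S} \<le> 32" if "M \<in> projecting_into Y R F 2" for M
    using card_opposite_through_le[OF steiner F(1) that] n by simp
  then have "(\<Sum>S\<in>opposite R F \<inter> Y. subcount R (\<lambda>M. proj M F \<in> Y) 2 S)
      \<le> card (projecting_into Y R F 2) * 32"
    by (rule sum_subcount_le[OF F(1)])
  ultimately show ?thesis by linarith
qed

lemma sum_subcount_point_le: "real (\<Sum>S\<in>opposite R F \<inter> Y. subcount R (\<lambda>M. proj M F \<in> Y) 1 S)
    \<le> (85 * 64) * 3584"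
proof -
  have "vec.dim (F \<inter> W) + 1 = n \<longleftrightarrow> vec.dim (F \<inter> W) = vec.dim R + 3" for W using n by auto
  then have "real (card {W \<in> Y. vec.dim (F \<inter> W) + 1 = n}) = 85"
    using card_steiner_dim_Int[of 3 0 0 0 1] by simp
  moreover have "(n - 1 - vec.dim R) * 1 = 3" using n by simp
  ultimately have "real (card (projecting_into Y R F 1)) \<le> 85 * 64"
    using card_projecting_into_le[OF steiner F(1,2), of 1] q by simp
  moreover have "card {S \<in> opposite R F \<inter> Y. M \<subseteq> S} \<le> 3584" if "M \<in> projecting_into Y R F 1" for M
    using card_opposite_through_point_le[OF steiner n F(1) that] E q by simp
  then have "(\<Sum>S\<in>opposite R F \<inter> Y. subcount R (\<lambda>M. proj M F \<in> Y) 1 S)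
      \<le> card (projecting_into Y R F 1) * 3584"
    by (rule sum_subcount_le[OF F(1)])
  ultimately show ?thesis by linarith
qed

lemma opposite_inequality_rank4:
  defines "N \<equiv> subcount R (\<lambda>M. proj M F \<in> Y)"
  shows "0 \<le> real (\<Sum>S\<in>opposite R F \<inter> Y. N 2 S) / 16 + real (\<Sum>S\<in>opposite R F \<inter> Y. N 1 S) / 8
    - real (card (opposite R F \<inter> Y)) * (65 / 16)"
proof -
  define \<gamma> where "\<gamma> k = (if k = 4 then 1 else if k = 3 then 1 / 8 else if k = 2 then 1 / 16 else if k = 1 then 1 / 8 else 1 :: real)"
    for k :: nat
  let ?g = "projected_indicator R Y F 4 \<gamma> (81 / 16)"
  have "0 \<le> (\<Sum>S\<in>opposite R F \<inter> Y. ?g S)"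
  proof (rule opposite_inequality[OF steiner _ F(1), of 4])
    fix k :: nat assume "k < 4"
    then consider "k = 0" | "k = 1" | "k = 2" | "k = 3" by linarith
    then show "\<gamma> k * real E = \<gamma> (Suc k) * CARD('a) ^ (4 - Suc k)"
      unfolding q E by cases (simp_all add: \<gamma>_def)
  next
    have "{..<4} = {0, 1, 2, 3 :: nat}" by auto
    then show "81 / 16 * real E
        = (\<Sum>k<4. \<gamma> (Suc k) * CARD('a) ^ (4 - Suc k) * q_binomial CARD('a) (4 - 1) k)"
      unfolding q E by (simp add: \<gamma>_def eval_nat_numeral q_number_def)
  qed (use n in \<open>auto simp: \<gamma>_def\<close>)
  also have "\<dots> = (\<Sum>S\<in>opposite R F \<inter> Y. real (N 2 S) / 16 + real (N 1 S) / 8 - 65 / 16)"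
  proof (rule sum.cong[OF refl])
    fix S assume S: "S \<in> opposite R F \<inter> Y"
    have dims: "vec.dim R + 4 = n" "vec.dim R + 3 + 1 = n" using n by auto
    have "N 4 S = 1" using subcount_top[OF _ F(1) dims(1), of S Y] S by (simp add: N_def)
    moreover have "N 3 S = 0"
      using subcount_hyperplane_zero[OF steiner refl dims(2) _ _ _ F(1)] S by (simp add: N_def)
    moreover have "N 0 S = 0"
      using subcount_base[OF steiner_base_ts[OF steiner] F(1,2)] S F(3) by (simp add: N_def)
    moreover have "{..4} = {0, 1, 2, 3, 4 :: nat}" by auto
    ultimately show "?g S = real (N 2 S) / 16 + real (N 1 S) / 8 - 65 / 16"
      by (simp add: projected_indicator_def \<gamma>_def N_def)
  qed
  finally show ?thesis by (simp add: sum.distrib sum_subtractf sum_divide_distrib)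
qed

end

theorem no_steiner_rank4_hermitian:
  assumes steiner: "steiner R (vec.dim R + 3) Y" and n: "n = vec.dim R + 4" and E: "E = 8"
    and q: "CARD('a) = 4"
  shows False
proof -
  obtain F where F: "F \<in> gens" "R \<subseteq> F" "F \<notin> Y"
    by (rule ex_gens_notin_steiner[OF steiner]) (use n E in auto)
  note F_assms = steiner n E q F
  show False
    using opposite_inequality_rank4[OF F_assms] card_opposite_steiner[OF F_assms]
      sum_subcount_line_le[OF F_assms] sum_subcount_point_le[OF F_assms]
    by linarith
qed

end

section \<open>The elliptic quadric over the field with two elements\<close>

text \<open>
  The eight bits of a character are the coordinates of a vector with respect to
  \<open>x\<^sub>1, y\<^sub>1, x\<^sub>2, y\<^sub>2, x\<^sub>3, y\<^sub>3, z\<^sub>1, z\<^sub>2\<close>, and \<open>byte_form\<close> is the elliptic quadratic form with hyperbolic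
  pairs \<open>x\<^sub>i, y\<^sub>i\<close> and anisotropic part spanned by \<open>z\<^sub>1, z\<^sub>2\<close>.
\<close>

fun byte_add :: "char \<Rightarrow> char \<Rightarrow> char" (infixl \<open>\<oplus>\<close> 65) where
  "Char a b c d e f g h \<oplus> Char a' b' c' d' e' f' g' h' =
     Char (a \<noteq> a') (b \<noteq> b') (c \<noteq> c') (d \<noteq> d') (e \<noteq> e') (f \<noteq> f') (g \<noteq> g') (h \<noteq> h')"

fun byte_form :: "char \<Rightarrow> bool" where
  "byte_form (Char a b c d e f g h) \<longleftrightarrow> ((a \<and> b) \<noteq> (c \<and> d)) \<noteq> ((e \<and> f) \<noteq> (g \<or> h))"

fun byte_polar :: "char \<Rightarrow> char \<Rightarrow> bool" where
  "byte_polar (Char a b c d e f g h) (Char a' b' c' d' e' f' g' h') \<longleftrightarrow>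
     (((a \<and> b') \<noteq> (b \<and> a')) \<noteq> ((c \<and> d') \<noteq> (d \<and> c'))) \<noteq>
     (((e \<and> f') \<noteq> (f \<and> e')) \<noteq> ((g \<and> h') \<noteq> (h \<and> g')))"

definition byte_plane :: "char \<Rightarrow> char \<Rightarrow> char \<Rightarrow> char list" where
  "byte_plane u v w = [u, v, u \<oplus> v, w, u \<oplus> w, v \<oplus> w, (u \<oplus> v) \<oplus> w]"

text \<open>
  A goal is a list of labelled planes assumed to belong to the Steiner system.  A certificate node
  names a singular line \<open>u, v\<close> and the five planes through it; each of the five planes either shares a
  second line with an assumed plane, whose label is given, or yields a new goal, in which it is added
  under that label.  A node is a string of five labels followed by \<open>u\<close>, \<open>v\<close> and four vectors spanning the
  planes; the fifth plane is spanned by their sum.  Vectors are written as two hexadecimal digits,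
  lower digit first, with the letters from \<open>@\<close> to \<open>O\<close> as digits.
\<close>

type_synonym goal = "(char \<times> char list) list"

fun hex_bytes :: "string \<Rightarrow> char list" where
  "hex_bytes (Char a b c d _ _ _ _ # Char e f g h _ _ _ _ # s) = Char a b c d e f g h # hex_bytes s"
| "hex_bytes _ = []"

fun lookup_plane :: "goal \<Rightarrow> char \<Rightarrow> char list" where
  "lookup_plane [] i = []"
| "lookup_plane ((j, p) # g) i = (if i = j then p else lookup_plane g i)"

definition conflict :: "char list \<Rightarrow> char list \<Rightarrow> bool" where
  "conflict p r \<longleftrightarrow> (case filter (\<lambda>c. c \<in> set r) p of
      a # b # _ \<Rightarrow> a \<noteq> b \<and> a \<noteq> CHR 0x00 \<and> b \<noteq> CHR 0x00 \<and> list_ex (\<lambda>c. list_ex (byte_polar c) r) p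
    | _ \<Rightarrow> False)"

definition valid_pencil :: "char \<Rightarrow> char \<Rightarrow> char list \<Rightarrow> bool" where
  "valid_pencil u v ws \<longleftrightarrow> u \<noteq> CHR 0x00 \<and> v \<noteq> CHR 0x00 \<and> u \<noteq> v \<and>
     \<not> byte_form u \<and> \<not> byte_form v \<and> \<not> byte_polar u v \<and>
     list_all (\<lambda>w. \<not> byte_form w \<and> \<not> byte_polar u w \<and> \<not> byte_polar v w) ws"

fun pairwise_polar :: "char list \<Rightarrow> bool" where
  "pairwise_polar [] \<longleftrightarrow> True"
| "pairwise_polar (w # ws) \<longleftrightarrow> list_all (byte_polar w) ws \<and> pairwise_polar ws"

fun subgoals :: "goal \<Rightarrow> char \<Rightarrow> char \<Rightarrow> char list \<Rightarrow> string \<Rightarrow> goal list" where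
  "subgoals g u v (w # ws) (i # is) =
     (if conflict (byte_plane u v w) (lookup_plane g i) then subgoals g u v ws is
      else ((i, byte_plane u v w) # g) # subgoals g u v ws is)"
| "subgoals _ _ _ _ _ = []"

definition expand :: "goal \<Rightarrow> string \<Rightarrow> char list \<Rightarrow> goal list option" where
  "expand g is bs = (case bs of
      [u, v, a, b, c, d] \<Rightarrow>
        (if valid_pencil u v [a, b, c, d, (a \<oplus> b) \<oplus> (c \<oplus> d)] \<and>
            pairwise_polar [a, b, c, d, (a \<oplus> b) \<oplus> (c \<oplus> d)] \<and> length is = 5
         then Some (subgoals g u v [a, b, c, d, (a \<oplus> b) \<oplus> (c \<oplus> d)] is) else None)
    | _ \<Rightarrow> None)"

definition expand_node :: "goal \<Rightarrow> string \<Rightarrow> goal list option" where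
  "expand_node g s = (case s of i # j # k # l # m # s' \<Rightarrow> expand g [i, j, k, l, m] (hex_bytes s') | _ \<Rightarrow> None)"

fun refutes :: "string list \<Rightarrow> goal list \<Rightarrow> bool" where
  "refutes [] gs \<longleftrightarrow> gs = []"
| "refutes (s # ss) gs \<longleftrightarrow> (case gs of [] \<Rightarrow> False | g # gs' \<Rightarrow>
     (case expand_node g s of None \<Rightarrow> False | Some hs \<Rightarrow> refutes ss (hs @ gs')))"

text \<open>
  The members \<open>F = \<langle>x\<^sub>1, x\<^sub>2, x\<^sub>3\<rangle>\<close> and \<open>S = \<langle>y\<^sub>1, y\<^sub>2, y\<^sub>3\<rangle>\<close> form the base goal. A line \<open>\<langle>x, y\<rangle>\<close> joining
  perpendicular points \<open>x\<close> of \<open>F\<close> and \<open>y\<close> of \<open>S\<close> lies in three planes that are not excluded by \<open>F\<close>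
  or \<open>S\<close>; they correspond to the colours \<open>z\<^sub>1\<close>, \<open>z\<^sub>2\<close> and \<open>z\<^sub>1 + z\<^sub>2\<close>. The other goals prescribe
  colours: of the line from \<open>x\<^sub>1\<close> to \<open>y\<^sub>2\<close>, then of the one to \<open>y\<^sub>3\<close>, then of the one to \<open>y\<^sub>2 + y\<^sub>3\<close> when
  the first two colours agree (\<open>pair_goal\<close>) or differ (\<open>distinct_goal\<close>), and, when all three differ,
  of the line from \<open>x\<^sub>3\<close> to \<open>y\<^sub>2\<close> (\<open>rainbow_goal\<close>).
\<close>

definition base_goal :: goal where
  "base_goal =
     [(CHR ''A'', byte_plane (CHR 0x01) (CHR 0x04) (CHR 0x10)),
      (CHR ''B'', byte_plane (CHR 0x02) (CHR 0x08) (CHR 0x20))]"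

definition y2_goal :: "char \<Rightarrow> goal" where
  "y2_goal w = (CHR ''C'', byte_plane (CHR 0x01) (CHR 0x08) w) # base_goal"

definition y3_goal :: "char \<Rightarrow> goal" where
  "y3_goal w = (CHR ''D'', byte_plane (CHR 0x01) (CHR 0x20) w) # y2_goal (CHR 0x70)"

definition pair_goal :: "char \<Rightarrow> goal" where
  "pair_goal w = (CHR ''E'', byte_plane (CHR 0x01) (CHR 0x28) w) # y3_goal (CHR 0x4C)"

definition distinct_goal :: "char \<Rightarrow> goal" where
  "distinct_goal w = (CHR ''E'', byte_plane (CHR 0x01) (CHR 0x28) w) # y3_goal (CHR 0x8C)"

definition rainbow_goal :: "char \<Rightarrow> goal" where
  "rainbow_goal w = (CHR ''F'', byte_plane (CHR 0x10) (CHR 0x08) w) # distinct_goal (CHR 0xDC)"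

lemma refutes_pair_goal_mono: "refutes [
    ''ADFECA@LH@A@BLCDG'', ''ADFECA@LL@A@BLCDG''] [pair_goal (CHR 0x5C)]"
  by code_simp

lemma refutes_pair_goal_mixed: "refutes [
    ''AEDFCA@LJDAHA@BLE'', ''CAEDGA@HKH@DADBLD'', ''AHEDCA@LM@ADBHBLF'', ''AIEDCA@DOD@HAHBLD'', ''ACJFDA@@KD@H@LCLE'',
    ''KBKKFBBCMD@H@OAND'', ''KBLLGBBGED@J@IALH'', ''LBMJKOABBF@J@LDLH'', ''BNJLKBBLHB@AAOAGE'', ''HBNLMBBMMF@J@AAND'',
    ''BLIMMBBNLB@EAIACE'', ''NBMJKOABBF@J@LDLH'', ''BOMLKBBLDB@AAOAGI'', ''KBJPMBBCID@H@OAND'', ''MBQKGBBKIF@H@EALD'',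
    ''KBNLRBBGID@J@IALD'', ''DSSLSLDEKA@O@BABB'', ''JTQSTGCMHJ@AAFACD'', ''BUTSGB@HKH@DADBLD'', ''MCUTSAGJKE@H@FAFB'',
    ''SAUTME@JKJ@AAABKD'', ''TSFKVKDJKE@H@FAFB'', ''BWUSCH@BKB@AAABCD'', ''XOVHXEBKDE@FAHAGI'', ''AYXULE@@GA@J@KCKI'',
    ''ASZRXE@@KA@J@KCKE'', ''YAUPZE@JOJ@AAABKD'', ''AXYPTE@KD@A@BKCAK'', ''CWBXZH@AKA@BABBCD'', ''YODZSNCLDB@AAOAGH'',
    ''NTSJTBAOBF@J@LDLH'', ''ATUSKD@BAB@ABCFCJ'', ''STUPFBANDB@EBIBCJ'', ''ABSUTB@@AD@H@LDLH'', ''SITPUBAMNF@J@ABND'',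
    ''TNTSGF@BGB@IAIBKH'', ''TSIMUBGNIB@EAIAAB'', ''TQSVFBGLJB@EAIAAB'', ''GUQWSBGIKF@H@EAEB'', ''BXUVSJ@BGB@EAEBGH'',
    ''KVIYSBGGHD@J@IAIB'', ''ZBUDZ@BCLD@H@O@MD'', ''AZTaKD@CD@A@BCCAK'', ''bIZVPHAGNI@J@DBKD'', ''BHbaYJBLMB@O@AAGD'',
    ''AKZaTD@CNAABA@BCE'', ''ABZbWE@@BA@J@KDKH'', ''bNEaXOAKJE@F@HBLD'', ''AUTSQEAGFD@J@IBKH'', ''KUITSBGGHD@J@IAIB'',
    ''ABMLNAABBD@H@LDLH'', ''BMOLKBBLDB@AAOAGI'', ''BPLMKBBNDB@EAIACI'', ''QBLKMBBMIF@J@AAND'', ''KBRLNBBGID@J@IALD'',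
    ''SNSHSKFFKF@AAJAEB'', ''TTIKSKFNIE@BAIAFB'', ''UCBTSH@CFAABA@BCI'', ''SCPTVBAKFF@H@EBLH'', ''TPUHWEBNDE@BAIACI'',
    ''MIWVSKFGHDAIAJA@B'', ''AOUTSE@KFAAJA@BKI'', ''VRSTFKFLJDAIAJA@B'', ''SWUIRIAKFF@H@EBGH'', ''XVXDKLFOKO@DAHAAB'',
    ''SBJYXB@@KD@H@LCLE'', ''AXRYSE@@KA@J@KCKE'', ''AUYXME@KL@A@BKCAG'', ''XBYCWH@CL@A@BCCAG'', ''TTSJKJAFBB@O@MDMH'',
    ''ATPSUO@EAE@FBCFCJ'', ''TVDRUJAABE@H@MDMH'', ''TOVUGJANFB@E@IBMH'', ''ITUMSJALNB@O@ABGD'', ''SVELUJANJB@E@IBMD'',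
    ''WCTWNCCCDD@H@O@MI'', ''WTDXNBAABD@H@LDLH'', ''BTWXIIAJBH@O@GDGH'', ''XSBFWB@LJDAHA@BLE'', ''XLVDWMFNJDAHAOA@B'',
    ''TTRFSJALJB@O@ABGD'', ''TQJUSF@@KB@I@KCKE'', ''TSUDOLDFKB@O@AAAB'', ''STLDUMFFKF@EAHAAB'', ''VCTMSHGFKB@I@EAEB'',
    ''QWSUCI@FKF@AAABGD'', ''VSWDOLDFKB@O@AAAB'', ''KBLLIIABBF@H@NDNH'', ''BALMKD@BBB@AACECI'', ''HBKLNBBMMF@J@AAND'',
    ''HBOMLBBKMF@H@EALD'', ''BPKMPBBLDB@AAOAGI'', ''BKPQHF@BBB@IAKEKI'', ''PBLRKBBKEF@H@EALH'', ''AQSSS@AMHA@F@J@CD'',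
    ''TIBTSJ@EOE@BABBGD'', ''TUBSGJ@EGE@BABBGH'', ''BVSTGJ@BKB@EAEBGD'', ''SBHUVJ@GM@ABBEBGF'', ''BTUFSJ@@OB@E@GCGE'',
    ''BUVSHJ@EBE@BAGEGI'', ''FPWVWMEKJF@AAJAEB'', ''CXWSRJACFH@O@DBMH'', ''SHYNWJAGLJ@DBIBKF'', ''WXQYGJACJH@O@DBMD'',
    ''SXPWFJAGDJ@DBIBKJ'', ''UWKJYMCKLF@EAHAGD'', ''HKXYUIADBA@F@GDGH'', ''BTTSD@BNLB@E@I@CD'', ''STOCUI@GL@A@BGCAG'',
    ''VTOSFNCNLB@E@I@CE'', ''SDOUVMDCH@A@BGCKC'', ''SMUTFMECI@ABBEBIB'', ''GTOSVFGHKB@I@EAEB'', ''SBWGUB@LL@A@BLCDG'',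
    ''XDXVNMDNH@A@BGCKC'', ''XDVYQF@KD@A@BKCBK'', ''XPZFUF@KE@ABBIBKJ'', ''ABZYWB@D@@A@B@G@K'', ''WIBYXB@DOD@HAHBLD'',
    ''KIXYUOAKNE@F@HBLD'', ''STBTCH@CM@AABBBCF'', ''THKSUEBCMD@O@HAND'', ''KTIVSFBCMD@O@HAMD'', ''WIKSUNCCMDAHAOAND'',
    ''EBXUXHBMEA@J@FACH'', ''YXPUFJAGDJ@DBIBKJ'', ''ZTXMJKDAKE@H@FAFB'', ''DZYVOMDDKA@F@JAJB'', ''WIYXQF@KNBAIA@BKE'',
    ''AVXOZEAKHE@FBHBGF'', ''aUPFXOBMEF@J@AACH'', ''QYJaZF@KH@A@BKCBG'', ''UTKDSABCMD@H@OAMD'', ''KVITSFBCMD@O@HAMD'',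
    ''SFUVTMENH@ABBEBIB'', ''BKQPHF@BBB@IAKEKI'', ''ABPRKAABBD@H@LDLH'', ''SSQHSDBGDD@IAJAKI'', ''CTSTKOAGFI@J@DBLH'',
    ''SLTUEIBNDI@BAEACI'', ''PGTSUGFIKI@BAEADB'', ''SLUTEIBNDI@BAEACI'', ''PGUSTGFIKI@BAEADB'', ''TSETRNEMI@ADBHBOB'',
    ''TSBFUB@LE@ADBHBLJ'', ''TUMGSNECI@AABFBJB'', ''USBFTB@LE@ADBHBLJ'', ''UTMGSNECI@AABFBJB'', ''LSTITIAGDI@DBJBKJ'',
    ''ASTMUD@CD@A@BCCAK'', ''LVCSUI@GD@A@BGCAK'', ''SVRJUGDLH@A@BCCMC'', ''STRJUGDLH@A@BCCMC'', ''BUTVSJBGDJ@DAIAKI'',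
    ''PWWVFLEKI@ADBIBJB'', ''BXWSHB@DBD@HALELI'', ''AXQWSE@ABA@JAKEKI'', ''XAMUWD@BKB@AAABCD'', ''XSWDNMDBKF@J@AAAB'',
    ''BAMLKD@BBB@AACECI'', ''HBKNLBBMMF@J@AAND'', ''HBOLMBBKMF@H@EALD'', ''PBNPKBBKEF@H@EALH'', ''ABPQKAABBD@H@LDLH'',
    ''BPKLRBBLDB@AAOAGI'', ''SSSHRNFBKB@AAOAEB'', ''STETPF@BKB@IAIBKD'', ''ATQUSAACJD@H@OBMD'', ''BTVUGJ@BKB@EAEBGD'',
    ''MCSVUAGBKD@H@OAOB'', ''MCSUTAGBKD@H@OAOB'', ''BVUTGJ@BKB@EAEBGD'', ''PGSUWOGBKF@J@AAAB'', ''XXBFSB@LE@ADBHBLJ'',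
    ''XDKVYOALDO@ABBBGJ'', ''CXWYRLCLDA@B@O@GI'', ''SBYGXB@LL@A@BLCDG'', ''XAZNU@ANDB@E@I@CH'', ''WZMJYLCGEDAIAJALH'',
    ''JTTKSMCNIBAEAIAMD'', ''TLUFSO@CJEAFA@BCE'', ''SLTIVIACJH@O@DBND'', ''AWUMVD@CJAABA@BCE'', ''MXFSVCECJD@H@O@MC'',
    ''VGYYQDGOKE@F@HAHB'', ''YBXCZH@CL@A@BCCAG'', ''KHaYSO@CM@AEBFBCF'', ''NZWaJKDAKE@H@FAFB'', ''AWZMYD@CNAABA@BCE'',
    ''SRYZJNFMHAAFAJA@B'', ''TBUDS@BCHD@H@O@MD'', ''COSTUHGCJH@EAFADB'', ''TSETKOAKJE@F@HBLD'', ''TUDSKOAABE@I@LDLH'',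
    ''IVKTSOAMNF@J@ABCD'', ''PGSWWOGBKF@J@AAAB'', ''IOWTXJALNB@O@ABGD'', ''DULYWABMHA@FAJACE'', ''XBJYVJ@GH@A@BGCBG'',
    ''ATLXWE@KH@A@BKCAG'', ''XWVHLFGNHB@I@EAEB'', ''ABUSTJ@EAE@BBGFGJ'', ''KISTUOAKNE@F@HBLD'', ''BKPQHF@BBB@IAKEKI'',
    ''ABRPKAABBD@H@LDLH'', ''SAQSSE@JKJ@AAABKD'', ''STITMGEJKJ@DAIAAB'', ''STFUKKDJKE@H@FAFB'', ''GSVTKFGJKB@O@AAAB'',
    ''BTUWGB@HKH@DADBLD'', ''SCVMWAGJKE@H@FAFB'', ''USTHOCDJKH@O@DADB'', ''AUVRTAAKJE@H@FBLD'', ''SPWDUMFJKJ@DAIAAB'',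
    ''CSPXVIGJKH@O@DADB'', ''YWDQYF@KFBAIA@BKI'', ''QVJZYF@KH@A@BKCBG'', ''BaYSIJ@BAB@EBGFGJ'', ''ZaRFXOBMEF@J@AACH'',
    ''YAZUMD@BKB@AAABCD'', ''YRFZXMEFKF@AAJAEB'', ''CTRTSCCKDH@EAFAGH'', ''BTUSEHBKDH@EAFAGI'', ''VHTSLKDGI@AEBFBHB'',
    ''PWSJUKDLH@A@BCCMC'', ''NXUTJKDAKE@H@FAFB'', ''OUIVYKDGJEAFAHA@B'', ''ZWJZPO@CH@A@BCCEG'', ''ABaZVB@@AD@H@LDLH'',
    ''AQZVa@AKHE@F@H@GD'', ''CaBSZH@AOA@BABBCD'', ''bDRZXO@CD@A@BCCEK'', ''RabDYLDGJAABAOA@B'', ''SDBTU@BKDE@F@H@GH'',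
    ''TSOHUKDBKF@H@EAEB'', ''TTKJSMCKLF@EAHAGD'', ''STBUD@BKLE@F@H@GD'', ''STUEROGDKE@F@HAHB'', ''UTHSRCCKLH@EAFAGD'',
    ''TNSDULFGJEAFAHA@B'', ''BLIKLBBNLB@EAIACE'', ''MBKLGBBGED@J@IALH'', ''MBJKLBBCID@H@OAND'', ''BAMLKD@BBB@AACECI'',
    ''BNLKHF@BBB@IAKEKI'', ''ABLKOAABBD@H@LDLH'', ''ABKPLEABBD@J@NDNH'', ''BKJMQBBLHB@AAOAGE'', ''HBLRMBBKMF@H@EALD'',
    ''SSMGSNCKDE@FAHAGH'', ''OTHSTNCMMAAFAJAND'', ''SUDTRNCLDB@AAOAGH'', ''JSPTUNCNHB@E@I@CE'', ''BUSETFAHBB@I@KDKH'',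
    ''STIQVNCKLE@FAHAGD'', ''JWUQSNCLHB@AAOAGD'', ''UXHSRNCGLI@DAJAKD'', ''VYUSFNCCIDAHAOAND'', ''MIZZWGECJD@IAJAHB'',
    ''OUaZCI@GNAAFA@BGE'', ''ZYFaOCDMJDAHAOA@B'', ''SAaZLE@JGJ@AAABKH'', ''LGXaZOGHKI@J@DADB'', ''KTTHSCFOKO@AABADB'',
    ''USNJTMCNEBAEAIAMH'', ''UPITSCFNHBAEAIA@B'', ''AUSPTEACFD@O@HBNH'', ''OSUTJCFMHAAFAJA@B'', ''TOFTSLEBKB@AAOAEB'',
    ''TNESUF@BKB@IAIBKD'', ''TUSDKLFBKB@EAIAAB'', ''UNESTF@BKB@IAIBKD'', ''UTSDKLFBKB@EAIAAB''] [pair_goal (CHR 0x9C)]"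
  by code_simp

lemma refutes_rainbow_goal: "refutes [
    ''ADCGEA@LD@A@BLCDK'', ''ACEDHA@LE@ADBHBLJ'', ''CIBIFH@AOA@BABBCD'', ''BICFJH@CCAABACDCH'', ''FBCKIH@CD@A@BCCAK'',
    ''CBFILH@@KA@B@CCCE'', ''BMFICH@BKB@AAABCD'', ''FNBJIH@CE@AABBBCJ'', ''AOEDOA@DGD@HAHBLH'', ''AOCPEA@DBD@HALELI'',
    ''AOCDQA@LCDAHALDLH'', ''RRIRQGDFKD@I@JAJB'', ''ABRSSD@@BA@B@CDCH'', ''ATRSJD@CCAABACDCH'', ''ATRLSD@CM@AABBBCF'',
    ''TANRSD@BGB@AAABCH'', ''ARUSLD@@KA@B@CCCE'', ''UVMQVMCGHJ@DAIAKD'', ''SEWNVIBNLI@BAEACE'', ''QVSKXMCGLJ@DAIAKD'',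
    ''LWOXRMFFKF@EAHAAB'', ''DBWVS@BLDA@B@O@GH'', ''TWNVGNCLDB@AAOAGH'', ''SRDSNABNIE@I@BAMD'', ''SRTHLO@@KE@F@CCCE'',
    ''PBTRUBBMIF@J@AAND'', ''RKUETKDOKE@F@HAHB'', ''SPFRTDBKIE@F@HAGD'', ''RBUETHBGII@J@DAKD'', ''RKVETKDOKE@F@HAHB'',
    ''UWDJTCCLHO@AABAGD'', ''DVFXXHAMJA@J@FBCD'', ''AXWMYAANNE@I@BBMD'', ''IRQXYOANNE@I@BBCD'', ''ATJYXD@CL@A@BCCAG'',
    ''BUEYXHBCLH@DAOAME'', ''ANRSSDAGDD@IBJBKJ'', ''FSERTGDKI@ADBIBJB'', ''AUTKRD@CD@A@BCCAK'', ''VUOMTIAGDI@DBJBKJ'',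
    ''UNWERIBGDI@DAJAKI'', ''TNUQXMCGDJ@DAIAKH'', ''YBWYHBBMEF@J@AANH'', ''AVYFZF@@AB@I@KDKH'', ''SMDYZF@KJBAIA@BKE'',
    ''ZANYXE@JGJ@AAABKH'', ''AFaYV@ACLD@H@O@MD'', ''aUZGKO@CD@A@BCCEK'', ''SMHTRGDKJDAIAJA@B'', ''KGSRTGDEKD@J@IAIB'',
    ''APODEA@HAH@DBLFLJ'', ''AODQEA@LFDAHA@BLI'', ''RRMQROBMIF@J@AACD'', ''ARSSIF@BAB@IBKFKJ'', ''BPSRTF@BBB@IAKEKI'',
    ''USRKOF@IKI@BABBKD'', ''FDUTSF@KH@A@BKCBG'', ''RSTHLF@@KB@I@KCKE'', ''CSUTRF@IGI@BABBKH'', ''UBVGVBBKMF@H@EALD'',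
    ''WJVHROBCLO@DAHAME'', ''SMHWVGDKJDAIAJA@B'', ''ABUVWAABBD@H@LDLH'', ''BUVWQBBNDB@EAIACI'', ''SMSRENFBKB@AAOAEB'',
    ''SMRGTF@BKB@IAIBKD'', ''RFDSTABCID@H@OAMD'', ''HMSRTLEBKB@AAOAEB'', ''FRUUOKCCHH@DAOAMD'', ''AUSVIE@JAJ@ABKFKJ'',
    ''WITUEBAIBF@H@NDNH'', ''VRWKHOBNIE@I@BACD'', ''FUVQSOACHO@DBHBMF'', ''UTWHJKCLEAABAOAKH'', ''AWSVIE@JAJ@ABKFKJ'',
    ''NSSDRABNEE@I@BAMH'', ''TASFR@ANDB@E@I@CH'', ''STKRONEIKI@BAEADB'', ''SATFR@ANDB@E@I@CH'', ''TSKRONEIKI@BAEADB'',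
    ''BJCJIH@BAB@ABCFCJ'', ''IJBKCH@CJAABA@BCE'', ''CJBILH@AKA@BABBCD'', ''FJBMCH@CM@AABBBCF'', ''BNJICH@BOB@AAABCD'',
    ''AOCOEA@DBD@HALELI'', ''AODPEA@LFDAHA@BLI'', ''AOEDQA@DGD@HAHBLH'', ''RHKRRKE@KE@F@H@GC'', ''SSORFHANNB@I@EBCD'',
    ''RTSQLGEIKI@DAJABB'', ''TFPURMFCHDAHAOA@B'', ''SRCTU@GNIB@E@I@CC'', ''RSTIPOANNE@I@BBCD'', ''BRSDU@BNLB@E@I@CD'',
    ''VSPLRBGLIB@AAOAEB'', ''SREUWJANNB@E@IBMD'', ''XXWGINFGII@DAJABB'', ''XOYVNIAGHI@DBJBKF'', ''VXYMQFBNIB@I@EAMD'',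
    ''ABXYVB@DAD@HBLFLJ'', ''AJXYTDAIBA@F@GDGH'', ''SRSIGGCNLI@BAEACD'', ''AJTRSD@CCAABACDCH'', ''OBTRSJ@GCBAEAGDGH'',
    ''JTRDSFAABD@I@MDMH'', ''TORFSHAOBI@J@CDCH'', ''SSBPRJ@GFBAEA@BGI'', ''ASRTLEAGFD@J@IBKH'', ''SCUTRI@GFAAFA@BGI'',
    ''SCRTVFAGFD@I@JBKH'', ''ASUWMD@CFAABA@BCI'', ''MSXUGGFDKD@HAOAIB'', ''DVYNYIALJA@O@BBGD'', ''AZYRME@@KA@J@KCKE'',
    ''UYOaNIANDI@BBEBCJ'', ''QZVaIFGJKB@O@AAAB'', ''ZOYXNF@IAI@BBKFKJ'', ''ZYOWNIANHI@BBEBCF'', ''TSJRQBAGFD@J@IBLH'',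
    ''URSIGGFNII@BAEADB'', ''TOSVIDBCDD@HAOAMI'', ''UJREVIBNDI@BAEACI'', ''PPBPD@BKDE@F@H@GH'', ''QOFPQEBCID@O@HAND'',
    ''ORPQNIAEBA@O@NDNH'', ''QRPKOEBCED@O@HANH'', ''JRPOQBAEBD@J@NDNH'', ''POSKQEBNHE@BAIACE'', ''ERTPKEBMMA@J@FAND'',
    ''SUDUINCLHB@AAOAGD'', ''ABVUTAABBD@H@LDLH'', ''WERMUOBKME@F@HALD'', ''DIQVWMELJA@FAJABB'', ''VBRUGJ@GD@A@BGCBK'',
    ''ARWUNAAOBE@I@LDLH'', ''VPWHIFAKDF@EBHBGJ'', ''PQJQGKCMDF@AAJACH'', ''FPGQRMDCH@A@BGCKC'', ''EPSQLMDIKA@F@JAJB'',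
    ''TPLGRMDNH@A@BGCKC'', ''HKSUUNDCJBAEAIA@B'', ''AQVNUAANFE@I@BBMH'', ''PVWKHF@KE@ABBIBKJ'', ''HVITWMEJKJ@AAFADB'',
    ''VNPHUF@KNBAIA@BKE'', ''VFRUHNFCHDAHAOA@B'', ''APQRNAAMDA@FBJBCJ'', ''NQGPSMDNJAAFAJA@B'', ''EPRSLMDIKA@F@JAJB'',
    ''PKEQQKEGH@ADBIBJB'', ''RQJPGCCGHD@IAJAKD'', ''RQOPLNCGHI@DAJAKD'', ''QRJPGCCGHD@IAJAKD'', ''QROPLNCGHI@DAJAKD'',
    ''BJCFKH@CCAABACDCH'', ''ALEDLA@DGD@HAHBLH'', ''ALCMEA@DBD@HALELI'', ''ALCDNA@LCDAHALDLH'', ''BOOICH@BOB@AAABCD'',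
    ''BJPFOH@ABA@BACECI'', ''OCBFQH@CFAABA@BCI'', ''RBRRHBBCID@H@OAND'', ''SONSRFBMLF@AAJACE'', ''STPREO@FBF@EACECI'',
    ''MRTQSFBNIB@I@EAMD'', ''SOTDTGDLJDAIAJA@B'', ''TOESUOAKNE@F@HBLD'', ''RBNVTBBCMD@H@OAND'', ''WVDKUCCLHO@AABAGD'',
    ''QXUVGGFDKD@HAOAIB'', ''AWYSKEAFBD@O@KDKH'', ''REXQYFBCMD@O@HAMD'', ''AUTRID@CD@A@BCCAK'', ''VIRETKDGI@AEBFBHB'',
    ''DSBUW@BMLA@F@J@CD'', ''TWJVEOGCJO@AABADB'', ''SOESROAKNE@F@HBLD'', ''SRTMKOADBE@F@CDCH'', ''SLTRQOAKFE@F@HBLH'',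
    ''RMTTKCCMIAAFAJACD'', ''SINUTJAKNE@H@FBGD'', ''VQLRTEGNJE@FAHABB'', ''WPLVSFBCED@O@HAMH'', ''VBNUXJBKME@H@FAGD'',
    ''FYVUHMECH@ADBHBOB'', ''AYTWXD@CH@A@BCCAG'', ''AFSTU@ACDD@H@O@MH'', ''KTEVSCCGLD@IAJAKD'', ''TQLRWEGNJE@FAHABB'',
    ''TLXIUGCCDD@HAOAMH'', ''FVWHXLEKI@ADBIBJB'', ''SJRHSJGAKE@H@FAFB'', ''STJRHOBNIE@I@BACD'', ''DUJSRLCMHA@FAJACD'',
    ''VIHRSCDAKD@H@OAOB'', ''WPWEVIBGDI@DAJAKI'', ''AWXRIE@KD@A@BKCAK'', ''BSWDY@BNLB@E@I@CD'', ''FTMYXKCCHH@DAOAMD'',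
    ''ABWXRAABBD@H@LDLH'', ''AWPUYEAIBA@O@NDNH'', ''RBYGXBBKMF@H@EALD'', ''AJRSTD@AKA@BABBCD'', ''RIHUSKDAKE@H@FAFB'',
    ''JVRHTOANJE@I@BBCD'', ''WVPDWOAABE@I@LDLH'', ''BWXMUB@DBD@HALELI'', ''TOWMXDBGLD@IAJAKE'', ''AXWFU@ALLA@B@O@GD'',
    ''VWKGYOAGNI@J@DBLD'', ''TLBYXB@DGD@HAHBLH'', ''ABPIOH@AAA@BBCFCJ'', ''FOBJQH@CE@AABBBCJ'', ''ARRFR@ALLA@B@O@GD'',
    ''RSESQKEGH@ADBIBJB'', ''TPRSECFOKO@AABADB'', ''RSUIENFBKB@AAOAEB'', ''SFMVVDBCHD@HAOAME'', ''FDTWVO@CH@A@BCCEG'',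
    ''AUXIVEAGJD@J@IBKD'', ''AXTJWO@EAE@FBCFCJ'', ''BWVMRB@DBD@HALELI'', ''OVWMSDBKME@F@HAGD'', ''RKETSOACLO@DBHBMF'',
    ''ESRITEBLMA@O@BAKD'', ''RSSQNKEGI@AABBBOB'', ''RSNJTBALLB@ABOBGF'', ''UUBGSB@DKD@HAHBLD'', ''UJMVRO@FKF@EAEBCD'',
    ''UWFSLHANJB@I@EBCD'', ''UWDVKKCMHF@AAJACD'', ''UASIVD@BKB@AAABCD'', ''UTFWLHAGJI@J@DBKD'', ''RKWHVOBCLO@DAHAME'',
    ''PSRTNKFGJAABAOA@B'', ''LRJSTEGIKA@O@BABB'', ''SSDRKKCGIDAIAJAKD'', ''RSTPLIANHI@BBEBCF'', ''ROGSTLDGI@AABBBOB'',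
    ''STJRHFBGID@I@JAKD'', ''UTDORABGID@I@JALD'', ''ROGTVLDGI@AABBBOB'', ''RUHWKLEGI@AEBFBHB'', ''VXPRHJGGIJ@DAIAAB'',
    ''RKEYYOACLO@DBHBMF'', ''AJSZYD@AKA@BABBCD'', ''AaKYXDACLD@HBOBMF'', ''BaWZEHBCDH@DAOAMI'', ''XLBZYB@LFDAHA@BLI'',
    ''JYDaVF@KJBAIA@BKE'', ''UFZNaCFCID@H@O@MC'', ''AMLDEA@HAH@DBLFLJ'', ''ALDNEA@LFDAHA@BLI'', ''BJOFOH@ABA@BACECI'',
    ''ABOIPH@AAA@BBCFCJ'', ''FMQQQHACLH@DBOBMF'', ''RRODQFAABD@I@MDMH'', ''RQSILGCCDD@HAOAMH'', ''TRQIGGCNLI@BAEACD'',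
    ''AQSUPAAFBD@I@MDMH'', ''VSOGQGCMDJ@AAFACH'', ''DQWOWABMLA@FAJACE'', ''BAVXWJ@@AB@E@GDGH'', ''IWTGXJACNH@O@DBMD'',
    ''FXUNWO@CI@AEBFBCF'', ''FWSXGKFCIH@DAOAEB'', ''SQRILGCCDD@HAOAMH'', ''TJRQNGCLIAABAOAGD'', ''STOGQGCMDJ@AAFACH'',
    ''AQRPRAANJE@I@BBMD'', ''QJRGSJANJB@E@IBMD'', ''IQHSRCDNJDAHAOA@B'', ''QJSGRJANJB@E@IBMD'', ''IQHRSCDNJDAHAOA@B'',
    ''QRJREFGKJF@AAJAEB'', ''BSRQHJBLEB@O@AAGH'', ''QSTNJJALFB@O@ABGH'', ''UPNSQFGMIF@AAJAEB'', ''VSFETFGCHD@O@HAHB'',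
    ''DUBWW@BMLA@F@J@CD'', ''ABWVXD@@BA@B@CDCH'', ''WDBRX@BKHE@F@H@GD'', ''AQXPWAANFE@I@BBMH'', ''WOXEQIBGDI@DAJAKI'',
    ''SQBRLB@DGD@HAHBLH'', ''SRNQIFGGHD@I@JAJB'', ''ABPIOH@AAA@BBCFCJ'', ''FOBJQH@CE@AABBBCJ'', ''RRFRHGFKHEAFAHA@B'',
    ''ASRSQEANDE@BBIBCJ'', ''ATSJRO@EAE@FBCFCJ'', ''AKURSEAKLE@FBHBGF'', ''AVTISEAGJD@J@IBKD'', ''FWVWLKCCHH@DAOAMD'',
    ''WVXQLFANJB@I@EBMD'', ''BWYUEHBCHH@DAOAME'', ''XYSDOFAABD@I@MDMH'', ''FDTXWO@CH@A@BCCEG'', ''YSWNJJALFB@O@ABGH'',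
    ''RXYGINFGII@DAJABB'', ''ABRTSJ@EAE@BBGFGJ'', ''AROTSEANLE@BBIBCF'', ''SSDIRFALJB@O@ABKD'', ''TMPSRO@FAF@EBCFCJ'',
    ''BTUREFAHBB@I@KDKH'', ''RTKGUFANNB@I@EBMD'', ''ABTSRB@DAD@HBLFLJ'', ''UMTRKFAEBD@O@KDKH'', ''UREQTFACND@O@HBMD'',
    ''SMJSRLCGIDAIAJALD'', ''JTSGROAKJE@F@HBLD'', ''STJRNLFKJDAIAJA@B'', ''AJRTSE@KJAAJA@BKE'', ''AIUSRAAKJE@H@FBLD'',
    ''AJSRVDAKJE@F@HBGD'', ''JWDTSF@KJBAIA@BKE'', ''XVLOXDGGJD@HAOAIB'', ''ABXWYB@D@@A@B@G@K'', ''ARXYID@CD@A@BCCAK'',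
    ''BMXWYIAJBH@O@GDGH'', ''OXMZVEBCMD@O@HAND'', ''ZIYEUNDJKB@E@IAIB''] [rainbow_goal (CHR 0x83)]"
  by code_simp

lemma byte_form_add: "byte_form (c \<oplus> d) \<longleftrightarrow> ((byte_form c \<noteq> byte_form d) \<noteq> byte_polar c d)"
proof (cases c; cases d)
  fix a b c1 d1 e f g h a' b' c' d' e' f' g' h'
  assume bits: "c = Char a b c1 d1 e f g h" "d = Char a' b' c' d' e' f' g' h'"
  have hyperbolic: "((p \<noteq> p') \<and> (r \<noteq> r')) = (((p \<and> r) \<noteq> (p' \<and> r')) \<noteq> ((p \<and> r') \<noteq> (r \<and> p')))"
    and anisotropic: "((p \<noteq> p') \<or> (r \<noteq> r')) = (((p \<or> r) \<noteq> (p' \<or> r')) \<noteq> ((p \<and> r') \<noteq> (r \<and> p')))"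
    for p p' r r' by (cases p; cases r; cases p'; cases r'; simp)+
  have xor_interchange: "((p \<noteq> r) \<noteq> (p' \<noteq> r')) = ((p \<noteq> p') \<noteq> (r \<noteq> r'))" for p p' r r' :: bool
    by (cases p; cases r; cases p'; cases r') simp_all
  have regroup: "((((A \<noteq> A') \<noteq> A'') \<noteq> ((B \<noteq> B') \<noteq> B'')) \<noteq> (((C \<noteq> C') \<noteq> C'') \<noteq> ((D \<noteq> D') \<noteq> D''))) =
      ((((A \<noteq> B) \<noteq> (C \<noteq> D)) \<noteq> ((A' \<noteq> B') \<noteq> (C' \<noteq> D'))) \<noteq> ((A'' \<noteq> B'') \<noteq> (C'' \<noteq> D'')))"
    for A A' A'' B B' B'' C C' C'' D D' D'' :: bool
    unfolding xor_interchange[of "A \<noteq> A'" A'' "B \<noteq> B'" B'']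
      xor_interchange[of "C \<noteq> C'" C'' "D \<noteq> D'" D'']
      xor_interchange[of "(A \<noteq> A') \<noteq> (B \<noteq> B')" "A'' \<noteq> B''" "(C \<noteq> C') \<noteq> (D \<noteq> D')" "C'' \<noteq> D''"]
    unfolding xor_interchange[of A A' B B'] xor_interchange[of C C' D D']
      xor_interchange[of "A \<noteq> B" "A' \<noteq> B'" "C \<noteq> D" "C' \<noteq> D'"] ..
  show ?thesis
    unfolding bits byte_add.simps byte_form.simps byte_polar.simps hyperbolic anisotropic
    by (rule regroup)
qed

lemma byte_polar_nondegenerate:
  assumes "c \<noteq> CHR 0x00"
  obtains d where "byte_polar c d"
proof -
  have "\<exists>d\<in>{CHR 0x01, CHR 0x02, CHR 0x04, CHR 0x08, CHR 0x10, CHR 0x20, CHR 0x40, CHR 0x80}. byte_polar c d"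
    using assms by (cases c) auto
  then show ?thesis using that by blast
qed

lemma byte_add_eq_0: "c \<oplus> d = CHR 0x00 \<Longrightarrow> c = d"
  by (cases c; cases d) simp

lemma byte_polar_self: "\<not> byte_polar c c"
  by (cases c) auto

lemma pairwise_polar_distinct: "pairwise_polar ws \<Longrightarrow> distinct ws"
  by (induction ws) (auto simp: list_all_iff byte_polar_self)

lemma pairwise_polarD:
  "pairwise_polar ws \<Longrightarrow> w \<in> set ws \<Longrightarrow> w' \<in> set ws \<Longrightarrow> w \<noteq> w' \<Longrightarrow> byte_polar w w' \<or> byte_polar w' w"
  by (induction ws) (auto simp: list_all_iff)

definition byte_isometry :: "(char \<Rightarrow> char) \<Rightarrow> bool" where
  "byte_isometry f \<longleftrightarrow> (\<forall>c d. f (c \<oplus> d) = f c \<oplus> f d) \<and> (\<forall>c. byte_form (f c) \<longleftrightarrow> byte_form c)"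

lemma byte_isometryI:
  assumes "\<And>a b c d e f g h a' b' c' d' e' f' g' h'. \<phi> (Char a b c d e f g h \<oplus> Char a' b' c' d' e' f' g' h') =
      \<phi> (Char a b c d e f g h) \<oplus> \<phi> (Char a' b' c' d' e' f' g' h')"
    and "\<And>a b c d e f g h. byte_form (\<phi> (Char a b c d e f g h)) \<longleftrightarrow> byte_form (Char a b c d e f g h)"
  shows "byte_isometry \<phi>"
  unfolding byte_isometry_def using assms by (metis char.exhaust)

lemma byte_isometry_comp: "byte_isometry f \<Longrightarrow> byte_isometry g \<Longrightarrow> byte_isometry (f \<circ> g)"
  by (simp add: byte_isometry_def)

fun swap_z :: "char \<Rightarrow> char" where
  "swap_z (Char a b c d e f g h) = Char a b c d e f h g"

fun shear_z1 :: "char \<Rightarrow> char" where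
  "shear_z1 (Char a b c d e f g h) = Char a b c d e f g (g \<noteq> h)"

fun shear_z2 :: "char \<Rightarrow> char" where
  "shear_z2 (Char a b c d e f g h) = Char a b c d e f (g \<noteq> h) h"

fun shear_xy :: "char \<Rightarrow> char" where
  "shear_xy (Char a b c d e f g h) = Char a b c (d \<noteq> f) (c \<noteq> e) f g h"

fun rotate_xy :: "char \<Rightarrow> char" where
  "rotate_xy (Char a b c d e f g h) = Char a b (c \<noteq> e) f c (d \<noteq> f) h g"

fun dual_xy :: "char \<Rightarrow> char" where
  "dual_xy (Char a b c d e f g h) = Char d c b a f e g h"

lemma byte_isometry_swap_z: "byte_isometry swap_z"
  and byte_isometry_shear_z1: "byte_isometry shear_z1"
  and byte_isometry_shear_z2: "byte_isometry shear_z2"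
  and byte_isometry_shear_xy: "byte_isometry shear_xy"
  and byte_isometry_rotate_xy: "byte_isometry rotate_xy"
  and byte_isometry_dual_xy: "byte_isometry dual_xy"
  by (rule byte_isometryI; auto)+

definition carried :: "(char \<Rightarrow> char) \<Rightarrow> goal \<Rightarrow> goal \<Rightarrow> bool" where
  "carried f g g' \<longleftrightarrow> list_all (\<lambda>(i, p). list_ex (\<lambda>(j, r). list_all (\<lambda>c. f c \<in> set r) p) g) g'"

lemma binary_field_cases:
  fixes k :: "'a::{field,finite}"
  assumes "CARD('a) = 2"
  shows "k = 0 \<or> k = 1"
proof (rule ccontr)
  assume "\<not> (k = 0 \<or> k = 1)"
  then have "card {0, 1, k} = 3" by auto
  moreover have "card {0, 1, k} \<le> CARD('a)" by (intro card_mono) auto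
  ultimately show False using assms by simp
qed

lemma binary_field_one_add_one:
  assumes "CARD('a::{field,finite}) = 2"
  shows "(1 :: 'a) + 1 = 0"
proof -
  have "(1 :: 'a) + 1 \<noteq> 1" by (metis add_cancel_right_right zero_neq_one)
  then show ?thesis using binary_field_cases[OF assms, of "1 + 1"] by blast
qed

locale binary_elliptic = polar_space perp sing n 4
  for perp :: "'a::{field,finite} ^ 'm \<Rightarrow> 'a ^ 'm \<Rightarrow> bool" and sing n +
  fixes R :: "('a ^ 'm) set" and Y :: "('a ^ 'm) set set"
  assumes card2: "CARD('a) = 2"
    and perp_add: "perp x (y + z) \<longleftrightarrow> (perp x y \<longleftrightarrow> perp x z)"
    and sing_add_iff: "sing (x + y) \<longleftrightarrow> ((sing x \<longleftrightarrow> sing y) \<longleftrightarrow> perp x y)"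
    and rank3: "n = vec.dim R + 3"
    and steiner: "steiner R (vec.dim R + 2) Y"
begin

lemma scalar_cases: "k = 0 \<or> k = 1" for k :: 'a
  by (rule binary_field_cases[OF card2])

lemma add_self: "x + x = (0 :: 'a ^ 'm)"
proof -
  have "(1 + 1) *s x = 0" by (simp only: binary_field_one_add_one[OF card2] vec.scale_zero_left)
  then show ?thesis by (simp only: vec.scale_left_distrib vec.scale_one)
qed

lemma add_self_left: "x + (x + y) = (y :: 'a ^ 'm)"
  using add_self by (simp flip: add.assoc)

lemma perp_commute: "perp x y \<longleftrightarrow> perp y x"
  using perp_sym by blast

lemma perp_add_left: "perp (y + z) x \<longleftrightarrow> (perp y x \<longleftrightarrow> perp z x)"
  unfolding perp_commute[of _ x] by (rule perp_add)

lemma perp_self: "perp x x"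
  using sing_add_iff[of x x] by (simp add: add_self sing_0)

lemma perp_zero: "perp x 0"
  using vec.subspace_0[OF perp_subspace[of x]] by simp

lemma base_ts: "R \<in> ts_subspaces" by (rule steiner_base_ts[OF steiner])

definition frame :: "(char \<Rightarrow> 'a ^ 'm) \<Rightarrow> bool" where
  "frame e \<longleftrightarrow> (\<forall>c d. e (c \<oplus> d) = e c + e d) \<and> (\<forall>c. e c \<in> orth R) \<and> (\<forall>c. sing (e c) \<longleftrightarrow> \<not> byte_form c)"

lemma frame_add: "frame e \<Longrightarrow> e (c \<oplus> d) = e c + e d"
  and frame_orth: "frame e \<Longrightarrow> e c \<in> orth R"
  and frame_sing: "frame e \<Longrightarrow> sing (e c) \<longleftrightarrow> \<not> byte_form c"
  by (auto simp: frame_def)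

lemma frame_perp: assumes "frame e" shows "perp (e c) (e d) \<longleftrightarrow> \<not> byte_polar c d"
  using sing_add_iff[of "e c" "e d"] frame_sing[OF assms, of "c \<oplus> d"] frame_sing[OF assms, of c]
    frame_sing[OF assms, of d]
  unfolding byte_form_add frame_add[OF assms]
  by (cases "byte_form c"; cases "byte_form d"; cases "byte_polar c d") simp_all

lemma frame_notin_base: assumes "frame e" "c \<noteq> CHR 0x00" shows "e c \<notin> R"
proof
  assume "e c \<in> R"
  obtain d where "byte_polar c d" using byte_polar_nondegenerate[OF assms(2)] .
  then have "\<not> perp (e c) (e d)" using frame_perp[OF assms(1)] by simp
  then show False using orthD[OF frame_orth[OF assms(1)] \<open>e c \<in> R\<close>] by simp
qed

definition line :: "(char \<Rightarrow> 'a ^ 'm) \<Rightarrow> char \<Rightarrow> char \<Rightarrow> ('a ^ 'm) set" where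
  "line e u v = vec.span (insert (e v) (vec.span (insert (e u) R)))"

lemma line_superset: "R \<subseteq> line e u v" "e u \<in> line e u v" "e v \<in> line e u v"
  using vec.span_superset[of "insert (e v) (vec.span (insert (e u) R))"]
    vec.span_superset[of "insert (e u) R"]
  by (auto simp: line_def)

lemma line_minimal: "vec.subspace W \<Longrightarrow> R \<subseteq> W \<Longrightarrow> e u \<in> W \<Longrightarrow> e v \<in> W \<Longrightarrow> line e u v \<subseteq> W"
  unfolding line_def by (intro vec.span_minimal insert_subsetI) auto

lemma dim_line:
  assumes e: "frame e" and uv: "u \<noteq> CHR 0x00" "v \<noteq> CHR 0x00" "u \<noteq> v"
  shows "vec.dim (line e u v) = vec.dim R + 2"
proof -
  have R: "vec.subspace R" by (rule ts_subspace[OF base_ts])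
  have point: "vec.dim (vec.span (insert (e u) R)) = vec.dim R + 1"
    by (rule dim_span_insert[OF R frame_notin_base[OF e uv(1)]])
  have "e v \<notin> vec.span (insert (e u) R)"
  proof
    assume "e v \<in> vec.span (insert (e u) R)"
    then obtain k r where kr: "e v = k *s e u + r" "r \<in> R" unfolding span_insert_eq[OF R] by blast
    have "k \<noteq> 0" using kr frame_notin_base[OF e uv(2)] by auto
    then have "e v = e u + r" using kr(1) scalar_cases[of k] by simp
    then have "e (u \<oplus> v) \<in> R" using kr(2) by (simp add: frame_add[OF e] add_self_left)
    then have "u \<oplus> v = CHR 0x00" using frame_notin_base[OF e] by blast
    then show False using byte_add_eq_0 uv(3) by blast
  qed
  from dim_span_insert[OF vec.subspace_span this] show ?thesis unfolding line_def point by linarith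
qed

lemma orth_insert_iff: "w \<in> orth (insert a A) \<longleftrightarrow> perp a w \<and> w \<in> orth A"
  by (auto simp: orth_def)

lemma orth_line_iff: "w \<in> orth (line e u v) \<longleftrightarrow> perp (e v) w \<and> perp (e u) w \<and> w \<in> orth R"
  unfolding line_def orth_span orth_insert_iff ..

lemma line_ts:
  assumes e: "frame e" and uv: "\<not> byte_form u" "\<not> byte_form v" "\<not> byte_polar u v"
  shows "line e u v \<in> ts_subspaces"
proof -
  have point: "vec.span (insert (e u) R) \<in> ts_subspaces"
    by (rule ts_span_insert[OF base_ts]) (use e uv frame_sing frame_orth in auto)
  have "e v \<in> orth (vec.span (insert (e u) R))"
    using frame_perp[OF e] frame_orth[OF e] uv by (simp add: orth_span orth_insert_iff)
  then show ?thesis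
    unfolding line_def by (intro ts_span_insert[OF point]) (use e uv frame_sing in auto)
qed

lemma steiner_unique:
  assumes e: "frame e" and ab: "a \<noteq> CHR 0x00" "b \<noteq> CHR 0x00" "a \<noteq> b"
    and W: "W \<in> Y" "e a \<in> W" "e b \<in> W" and W': "W' \<in> Y" "e a \<in> W'" "e b \<in> W'"
  shows "W = W'"
proof -
  have line_subset: "line e a b \<subseteq> U" if "U \<in> Y" "e a \<in> U" "e b \<in> U" for U
    using that gens_subspace steiner_gens[OF steiner] steiner_base_subset[OF steiner]
    by (intro line_minimal) auto
  have "line e a b \<in> ts_subspaces"
    by (rule ts_subset[OF gens_ts[OF steiner_gens[OF steiner W(1)]] _ line_subset[OF W]])
      (simp add: line_def)
  then show ?thesis
    using steiner_eq[OF steiner _ line_superset(1) _ W(1) W'(1) line_subset[OF W] line_subset[OF W']]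
      dim_line[OF e ab]
    by simp
qed

lemma gens_through_line_eq_image:
  assumes e: "frame e" and pencil: "valid_pencil u v ws" and ws: "pairwise_polar ws" "length ws = 5"
    and G: "\<And>w. w \<in> set ws \<Longrightarrow> G w \<in> gens \<and> line e u v \<subseteq> G w \<and> e w \<in> G w"
  shows "{W \<in> gens. line e u v \<subseteq> W} = G ` set ws"
proof -
  have "inj_on G (set ws)"
  proof (rule inj_onI, rule ccontr)
    fix w w' assume w: "w \<in> set ws" "w' \<in> set ws" "G w = G w'" "w \<noteq> w'"
    then have "perp (e w) (e w')" "perp (e w') (e w)"
      using ts_perp[OF gens_ts, of "G w"] G[OF w(1)] G[OF w(2)] by auto
    then show False using frame_perp[OF e] pairwise_polarD[OF ws(1) w(1,2,4)] by blast
  qed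
  then have "card (G ` set ws) = 5"
    using card_image distinct_card[OF pairwise_polar_distinct[OF ws(1)]] ws(2) by metis
  moreover have "card {W \<in> gens. line e u v \<subseteq> W} = 5"
    using card_gens_above[OF line_ts[OF e]] dim_line[OF e] pencil rank3
    by (simp add: valid_pencil_def)
  ultimately show ?thesis
    using card_subset_eq[of "{W \<in> gens. line e u v \<subseteq> W}" "G ` set ws"] G by fastforce
qed

lemma steiner_covers_pencil:
  assumes e: "frame e" and pencil: "valid_pencil u v ws" and ws: "pairwise_polar ws" "length ws = 5"
  shows "\<exists>W\<in>Y. e u \<in> W \<and> e v \<in> W \<and> (\<exists>w\<in>set ws. e w \<in> W)"
proof -
  let ?L = "line e u v"
  have L: "?L \<in> ts_subspaces" "vec.dim ?L = vec.dim R + 2"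
    using line_ts[OF e] dim_line[OF e] pencil by (auto simp: valid_pencil_def)
  have "\<exists>G. G \<in> gens \<and> ?L \<subseteq> G \<and> e w \<in> G" if "w \<in> set ws" for w
  proof -
    have "sing (e w)" "e w \<in> orth ?L"
      using that pencil frame_sing[OF e] frame_perp[OF e] frame_orth[OF e]
      by (auto simp: orth_line_iff valid_pencil_def list_all_iff)
    then obtain G where "G \<in> gens" "vec.span (insert (e w) ?L) \<subseteq> G"
      using obtain_gens[OF ts_span_insert[OF L(1)]] by blast
    then show ?thesis using vec.span_superset[of "insert (e w) ?L"] by blast
  qed
  then obtain G where G: "\<And>w. w \<in> set ws \<Longrightarrow> G w \<in> gens \<and> ?L \<subseteq> G w \<and> e w \<in> G w" by metis
  obtain W where W: "W \<in> Y" "?L \<subseteq> W"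
    using steiner_ex1[OF steiner, of ?L] L line_superset(1) unfolding level_def by blast
  then have "W \<in> G ` set ws"
    using gens_through_line_eq_image[OF e pencil ws G] steiner_gens[OF steiner] by blast
  then obtain w where "w \<in> set ws" "e w \<in> W" using G by blast
  moreover have "e u \<in> W" "e v \<in> W" using subsetD[OF W(2)] line_superset(2,3) by simp_all
  ultimately show ?thesis using W(1) by blast
qed

definition holds :: "(char \<Rightarrow> 'a ^ 'm) \<Rightarrow> goal \<Rightarrow> bool" where
  "holds e g \<longleftrightarrow> (\<forall>(i, p)\<in>set g. \<exists>W\<in>Y. \<forall>c\<in>set p. e c \<in> W)"

lemma byte_plane_mem:
  assumes "frame e" "vec.subspace W" "e u \<in> W" "e v \<in> W" "e w \<in> W"
  shows "\<forall>c\<in>set (byte_plane u v w). e c \<in> W"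
  using assms(3-5) vec.subspace_add[OF assms(2)]
  by (simp add: byte_plane_def frame_add[OF assms(1)])

lemma conflict_sound:
  assumes e: "frame e" and conflict: "conflict p r"
    and W: "W \<in> Y" "\<forall>c\<in>set p. e c \<in> W" and W': "W' \<in> Y" "\<forall>c\<in>set r. e c \<in> W'"
  shows False
proof -
  obtain a b xs where common: "filter (\<lambda>c. c \<in> set r) p = a # b # xs"
    and ab: "a \<noteq> CHR 0x00" "b \<noteq> CHR 0x00" "a \<noteq> b"
      and polar: "list_ex (\<lambda>c. list_ex (byte_polar c) r) p"
    using conflict unfolding conflict_def by (auto split: list.splits)
  have "a \<in> set (filter (\<lambda>c. c \<in> set r) p)" "b \<in> set (filter (\<lambda>c. c \<in> set r) p)"
    unfolding common by auto
  then have "a \<in> set p" "a \<in> set r" "b \<in> set p" "b \<in> set r" by auto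
  then have "W = W'" using steiner_unique[OF e ab W(1) _ _ W'(1)] W(2) W'(2) by blast
  moreover obtain c d where "c \<in> set p" "d \<in> set r" "byte_polar c d"
    using polar by (auto simp: list_ex_iff)
  ultimately show False
    using ts_perp[OF gens_ts[OF steiner_gens[OF steiner W(1)]]] W(2) W'(2) frame_perp[OF e] by blast
qed

lemma lookup_plane_cases: "lookup_plane g i = [] \<or> (i, lookup_plane g i) \<in> set g"
  by (induction g i rule: lookup_plane.induct) auto

lemma subgoals_sound:
  assumes e: "frame e" and g: "holds e g" and W: "W \<in> Y" "e u \<in> W" "e v \<in> W"
  shows "w \<in> set ws \<Longrightarrow> e w \<in> W \<Longrightarrow> length is = length ws \<Longrightarrow> \<exists>h\<in>set (subgoals g u v ws is). holds e h"
proof (induction ws arbitrary: "is")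
  case (Cons w' ws)
  then obtain i is' where is': "is = i # is'" "length is' = length ws" by (cases "is") auto
  show ?case
  proof (cases "w = w'")
    case True
    have plane: "\<forall>c\<in>set (byte_plane u v w). e c \<in> W"
      by (rule byte_plane_mem[OF e gens_subspace[OF steiner_gens[OF steiner W(1)]] W(2,3) Cons.prems(2)])
    have "\<not> conflict (byte_plane u v w) (lookup_plane g i)"
    proof
      assume conflict: "conflict (byte_plane u v w) (lookup_plane g i)"
      then have "lookup_plane g i \<noteq> []" by (auto simp: conflict_def)
      then obtain W' where "W' \<in> Y" "\<forall>c\<in>set (lookup_plane g i). e c \<in> W'"
        using lookup_plane_cases[of g i] g unfolding holds_def by blast
      then show False using conflict_sound[OF e conflict W(1) plane] by blast
    qed
    moreover have "holds e ((i, byte_plane u v w) # g)" using g W(1) plane by (auto simp: holds_def)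
    ultimately show ?thesis using True is'(1) by auto
  next
    case False
    then have "\<exists>h\<in>set (subgoals g u v ws is'). holds e h" using Cons is' by simp
    then show ?thesis using is'(1) by auto
  qed
qed simp

definition inconsistent :: "goal \<Rightarrow> bool" where
  "inconsistent g \<longleftrightarrow> (\<forall>e. frame e \<longrightarrow> \<not> holds e g)"

lemma expand_node_sound:
  assumes node: "expand_node g s = Some hs" and hs: "\<forall>h\<in>set hs. inconsistent h"
  shows "inconsistent g"
  unfolding inconsistent_def
proof (intro allI impI notI)
  fix e assume e: "frame e" "holds e g"
  obtain i j k l m s' where "expand g [i, j, k, l, m] (hex_bytes s') = Some hs"
    using node unfolding expand_node_def by (auto split: list.splits)
  then obtain "is" bs where labels: "length is = 5" and expand: "expand g is bs = Some hs" by force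
  obtain u v a b c d where bs: "bs = [u, v, a, b, c, d]"
    using expand unfolding expand_def by (auto split: list.splits)
  define ws where "ws = [a, b, c, d, (a \<oplus> b) \<oplus> (c \<oplus> d)]"
  have ws: "length ws = 5" by (simp add: ws_def)
  have pencil: "valid_pencil u v ws" "pairwise_polar ws" and subgoals: "hs = subgoals g u v ws is"
    using expand unfolding bs expand_def ws_def by (simp_all split: if_splits)
  obtain W w where "W \<in> Y" "e u \<in> W" "e v \<in> W" "w \<in> set ws" "e w \<in> W"
    using steiner_covers_pencil[OF e(1) pencil ws] by blast
  then have "\<exists>h\<in>set hs. holds e h" using subgoals_sound[OF e] labels ws subgoals by metis
  then show False using hs e(1) by (auto simp: inconsistent_def)
qed

lemma refutes_sound: "refutes ss gs \<Longrightarrow> g \<in> set gs \<Longrightarrow> inconsistent g"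
proof (induction ss arbitrary: gs g)
  case (Cons s ss)
  obtain g0 gs' where gs: "gs = g0 # gs'" using Cons.prems by (cases gs) auto
  obtain hs where hs: "expand_node g0 s = Some hs" "refutes ss (hs @ gs')"
    using Cons.prems(1) gs by (auto split: option.splits)
  have rest: "inconsistent h" if "h \<in> set (hs @ gs')" for h using Cons.IH[OF hs(2) that] .
  then have "inconsistent g0" by (intro expand_node_sound[OF hs(1)]) auto
  then show ?case using Cons.prems(2) gs rest by auto
qed simp

lemma inconsistent_carried:
  assumes f: "byte_isometry f" and carried: "carried f g g'" and g': "inconsistent g'"
  shows "inconsistent g"
  unfolding inconsistent_def
proof (intro allI impI notI)
  fix e assume e: "frame e" "holds e g"
  have "frame (e \<circ> f)" using e(1) f by (simp add: frame_def byte_isometry_def)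
  moreover have "holds (e \<circ> f) g'"
    unfolding holds_def
  proof clarify
    fix i p assume "(i, p) \<in> set g'"
    then obtain j r where jr: "(j, r) \<in> set g" "\<forall>c\<in>set p. f c \<in> set r"
      using carried by (fastforce simp: carried_def list_all_iff list_ex_iff)
    then obtain W where "W \<in> Y" "\<forall>c\<in>set r. e c \<in> W" using e(2) by (auto simp: holds_def)
    then show "\<exists>W\<in>Y. \<forall>c\<in>set p. (e \<circ> f) c \<in> W" using jr(2) by auto
  qed
  ultimately show False using g' by (simp add: inconsistent_def)
qed

lemma inconsistent_pair: "inconsistent (y3_goal (CHR 0x4C))"
proof (rule expand_node_sound)
  show "expand_node (y3_goal (CHR 0x4C)) ''BAEEEA@HBH@DALELI'' =
      Some [pair_goal (CHR 0x5C), pair_goal (CHR 0x9C), pair_goal (CHR 0xDC)]"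
    by code_simp
  have mono: "inconsistent (pair_goal (CHR 0x5C))"
    using refutes_sound[OF refutes_pair_goal_mono] by simp
  have mixed: "inconsistent (pair_goal (CHR 0x9C))"
    using refutes_sound[OF refutes_pair_goal_mixed] by simp
  have "carried shear_z2 (pair_goal (CHR 0xDC)) (pair_goal (CHR 0x9C))" by code_simp
  from inconsistent_carried[OF byte_isometry_shear_z2 this mixed] mono mixed
  show "\<forall>h\<in>set [pair_goal (CHR 0x5C), pair_goal (CHR 0x9C), pair_goal (CHR 0xDC)]. inconsistent h"
    by simp
qed

lemma inconsistent_all_distinct: "inconsistent (distinct_goal (CHR 0xDC))"
proof (rule expand_node_sound)
  show "expand_node (distinct_goal (CHR 0xDC)) ''ABFFF@AH@A@B@CDCH'' =
      Some [rainbow_goal (CHR 0x43), rainbow_goal (CHR 0x83), rainbow_goal (CHR 0xC3)]"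
    by code_simp
  have rainbow: "inconsistent (rainbow_goal (CHR 0x83))"
    using refutes_sound[OF refutes_rainbow_goal] by simp
  have "carried dual_xy (rainbow_goal (CHR 0x43)) (y3_goal (CHR 0x4C))" by code_simp
  note dual = inconsistent_carried[OF byte_isometry_dual_xy this inconsistent_pair]
  have "carried (shear_xy \<circ> shear_z2) (rainbow_goal (CHR 0xC3)) (rainbow_goal (CHR 0x83))"
    by code_simp
  from inconsistent_carried[OF byte_isometry_comp[OF byte_isometry_shear_xy byte_isometry_shear_z2] this rainbow] dual rainbow
  show "\<forall>h\<in>set [rainbow_goal (CHR 0x43), rainbow_goal (CHR 0x83), rainbow_goal (CHR 0xC3)]. inconsistent h" by simp
qed

lemma inconsistent_distinct: "inconsistent (y3_goal (CHR 0x8C))"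
proof (rule expand_node_sound)
  show "expand_node (y3_goal (CHR 0x8C)) ''BAEEEA@HBH@DALELI'' =
      Some [distinct_goal (CHR 0x5C), distinct_goal (CHR 0x9C), distinct_goal (CHR 0xDC)]"
    by code_simp
  have "carried shear_xy (distinct_goal (CHR 0x5C)) (y3_goal (CHR 0x4C))" by code_simp
  note sheared = inconsistent_carried[OF byte_isometry_shear_xy this inconsistent_pair]
  have "carried rotate_xy (distinct_goal (CHR 0x9C)) (y3_goal (CHR 0x4C))" by code_simp
  from inconsistent_carried[OF byte_isometry_rotate_xy this inconsistent_pair] sheared inconsistent_all_distinct
  show "\<forall>h\<in>set [distinct_goal (CHR 0x5C), distinct_goal (CHR 0x9C), distinct_goal (CHR 0xDC)]. inconsistent h" by simp
qed

lemma inconsistent_y2: "inconsistent (y2_goal (CHR 0x70))"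
proof (rule expand_node_sound)
  show "expand_node (y2_goal (CHR 0x70)) ''ABDDDA@@BD@H@LDLH'' =
      Some [y3_goal (CHR 0x4C), y3_goal (CHR 0x8C), y3_goal (CHR 0xCC)]"
    by code_simp
  have "carried shear_z2 (y3_goal (CHR 0xCC)) (y3_goal (CHR 0x8C))" by code_simp
  from inconsistent_carried[OF byte_isometry_shear_z2 this inconsistent_distinct] inconsistent_pair inconsistent_distinct
  show "\<forall>h\<in>set [y3_goal (CHR 0x4C), y3_goal (CHR 0x8C), y3_goal (CHR 0xCC)]. inconsistent h" by simp
qed

lemma inconsistent_base: "inconsistent base_goal"
proof (rule expand_node_sound)
  show "expand_node base_goal ''ABCCCA@H@@A@B@G@K''
      = Some [y2_goal (CHR 0x70), y2_goal (CHR 0xB0), y2_goal (CHR 0xF0)]"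
    by code_simp
  have "carried swap_z (y2_goal (CHR 0xB0)) (y2_goal (CHR 0x70))" by code_simp
  note swapped = inconsistent_carried[OF byte_isometry_swap_z this inconsistent_y2]
  have "carried shear_z1 (y2_goal (CHR 0xF0)) (y2_goal (CHR 0x70))" by code_simp
  from inconsistent_carried[OF byte_isometry_shear_z1 this inconsistent_y2] swapped inconsistent_y2
  show "\<forall>h\<in>set [y2_goal (CHR 0x70), y2_goal (CHR 0xB0), y2_goal (CHR 0xF0)]. inconsistent h" by simp
qed

definition dual_bases :: "nat \<Rightarrow> (nat \<Rightarrow> 'a ^ 'm) \<Rightarrow> (nat \<Rightarrow> 'a ^ 'm) \<Rightarrow> bool" where
  "dual_bases k x y \<longleftrightarrow> (\<forall>i<k. \<forall>j<k. perp (x i) (y j) \<longleftrightarrow> i \<noteq> j)"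

lemma ex_not_perp_complement:
  assumes F: "F \<in> ts_subspaces" and S: "S \<in> gens" and FS: "F \<inter> S = R" and x: "x \<in> F" "x \<notin> R"
  shows "\<exists>y\<in>S. \<not> perp x y"
proof (rule ccontr)
  assume "\<not> (\<exists>y\<in>S. \<not> perp x y)"
  then have "x \<in> orth S" using perp_commute by (auto intro: orthI)
  then have "x \<in> S" by (rule gens_maximal[OF S ts_sing[OF F x(1)]])
  then show False using x FS by blast
qed

lemma ex_perp_translate:
  assumes dual: "dual_bases k x y"
  shows "\<exists>u\<in>vec.span (y ` {..<k}). \<forall>i<k. perp (x i) (w + u)"
proof -
  have "\<exists>u\<in>vec.span (y ` {..<k}). \<forall>i<m. perp (x i) (w + u)" if "m \<le> k" for m
    using that
  proof (induction m)
    case 0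
    then show ?case using vec.span_zero by blast
  next
    case (Suc m)
    then obtain u where u: "u \<in> vec.span (y ` {..<k})" "\<forall>i<m. perp (x i) (w + u)" by auto
    define u' where "u' = (if perp (x m) (w + u) then u else u + y m)"
    have "y m \<in> vec.span (y ` {..<k})" using Suc.prems by (intro vec.span_base) simp
    then have "u' \<in> vec.span (y ` {..<k})" using u(1) by (auto simp: u'_def intro: vec.span_add)
    moreover have "perp (x i) (y m) \<longleftrightarrow> i \<noteq> m" if "i \<le> m" for i
      using dual Suc.prems that by (simp add: dual_bases_def)
    then have "\<forall>i<Suc m. perp (x i) (w + u')"
      using u(2) by (auto simp: u'_def less_Suc_eq perp_add simp flip: add.assoc)
    ultimately show ?case by blast
  qed
  then show ?thesis by blast
qed

lemma ex_dual_bases: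
  assumes F: "F \<in> gens" and S: "S \<in> gens" and FS: "F \<inter> S = R" and k: "vec.dim R + k \<le> n"
  shows "\<exists>x y. (\<forall>i<k. x i \<in> F \<and> y i \<in> S) \<and> dual_bases k x y"
  using k
proof (induction k)
  case 0
  then show ?case by (simp add: dual_bases_def)
next
  case (Suc k)
  then obtain x y where xy: "\<forall>i<k. x i \<in> F \<and> y i \<in> S" and dual: "dual_bases k x y" by auto
  have "vec.dim F \<le> vec.dim (F \<inter> orth (y ` {..<k})) + card (y ` {..<k})"
    by (rule dim_le_orth_card[OF gens_subspace[OF F]]) simp
  moreover have "card (y ` {..<k}) \<le> k" using card_image_le[of "{..<k}" y] by simp
  ultimately have "vec.dim R < vec.dim (F \<inter> orth (y ` {..<k}))"
    using gens_dim[OF F] Suc.prems by linarith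
  then have "\<not> F \<inter> orth (y ` {..<k}) \<subseteq> R"
    using vec.dim_subset[of "F \<inter> orth (y ` {..<k})" R] by linarith
  then obtain x' where x': "x' \<in> F" "x' \<notin> R" and "x' \<in> orth (y ` {..<k})" by blast
  then have x'_y: "perp x' (y i)" if "i < k" for i using that orthD perp_commute by blast
  obtain y' where y': "y' \<in> S" "\<not> perp x' y'"
    using ex_not_perp_complement[OF gens_ts[OF F] S FS x'(1,2)] by blast
  obtain u where u: "u \<in> vec.span (y ` {..<k})" "\<forall>i<k. perp (x i) (y' + u)"
    using ex_perp_translate[OF dual] by blast
  have "u \<in> S" using u(1) vec.span_minimal[OF _ gens_subspace[OF S], of "y ` {..<k}"] xy by blast
  moreover have "perp x' u"
    using u(1) vec.span_minimal[OF _ perp_subspace, of "y ` {..<k}" x'] x'_y by blast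
  ultimately obtain z where z: "z \<in> S" "\<forall>i<k. perp (x i) z" "\<not> perp x' z"
    using that[of "y' + u"] y' u(2) vec.subspace_add[OF gens_subspace[OF S]] by (simp add: perp_add)
  then have "(\<forall>i<Suc k. (x(k := x')) i \<in> F \<and> (y(k := z)) i \<in> S)
      \<and> dual_bases (Suc k) (x(k := x')) (y(k := z))"
    using xy x' x'_y z dual by (auto simp: dual_bases_def less_Suc_eq)
  then show ?case by blast
qed

lemma not_perp_outside_hyperplane:
  assumes G: "G \<in> gens" and L: "L \<in> ts_subspaces" "vec.dim L + 1 = n" "L \<subseteq> G"
    and w: "w \<in> G" "w \<notin> L" and v: "sing v" "v \<in> orth L" "v \<notin> G"
  shows "\<not> perp w v"
proof
  assume "perp w v"
  then have "v \<in> orth (vec.span (insert w L))" using v(2) by (simp add: orth_span orth_insert_iff)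
  moreover have "G = vec.span (insert w L)"
    using subspace_eq_span_insert[OF ts_subspace[OF L(1)] gens_subspace[OF G] L(3) _ w] L(2)
      gens_dim[OF G] by simp
  ultimately show False using gens_maximal[OF G v(1)] v(3) by blast
qed

lemma obtain_two_gens_avoiding:
  assumes L: "L \<in> ts_subspaces" "vec.dim L + 1 = n" and v: "v \<notin> L" "v' \<notin> L"
  obtains G G' where "G \<in> gens" "G' \<in> gens" "G \<inter> G' = L" "v \<notin> G" "v' \<notin> G" "v \<notin> G'" "v' \<notin> G'"
proof -
  let ?P = "{G \<in> gens. L \<subseteq> G}"
  have Int: "G \<inter> G' = L" if "G \<in> ?P" "G' \<in> ?P" "G \<noteq> G'" for G G'
    using gens_Int_eq[of G' G L] that L ts_subspace by auto
  have "card {G \<in> ?P. u \<in> G} \<le> Suc 0" if "u \<notin> L" for u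
    using card_le_Suc0_iff_eq[of "{G \<in> ?P. u \<in> G}"] Int that by auto
  from add_mono[OF this[OF v(1)] this[OF v(2)]] have "card ({G \<in> ?P. v \<in> G} \<union> {G \<in> ?P. v' \<in> G}) \<le> 2"
    using card_Un_le[of "{G \<in> ?P. v \<in> G}" "{G \<in> ?P. v' \<in> G}"] by linarith
  moreover have "card ?P = 5" using card_gens_above[OF L] by simp
  moreover have "card ?P - card ({G \<in> ?P. v \<in> G} \<union> {G \<in> ?P. v' \<in> G})
      \<le> card (?P - ({G \<in> ?P. v \<in> G} \<union> {G \<in> ?P. v' \<in> G}))"
    by (rule diff_card_le_card_Diff) simp
  ultimately have "\<not> card (?P - ({G \<in> ?P. v \<in> G} \<union> {G \<in> ?P. v' \<in> G})) \<le> Suc 0" by linarith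
  then obtain G G' where "G \<in> ?P" "G' \<in> ?P" "G \<noteq> G'" "v \<notin> G" "v' \<notin> G" "v \<notin> G'" "v' \<notin> G'"
    by (auto simp: card_le_Suc0_iff_eq)
  then show ?thesis using that Int[of G G'] by blast
qed

definition hyperbolic_basis :: "(nat \<Rightarrow> 'a ^ 'm) \<Rightarrow> (nat \<Rightarrow> 'a ^ 'm) \<Rightarrow> bool" where
  "hyperbolic_basis x y \<longleftrightarrow> dual_bases 3 x y
     \<and> (\<forall>i<3. x i \<in> orth R \<and> sing (x i) \<and> y i \<in> orth R \<and> sing (y i))
     \<and> (\<forall>i<3. \<forall>j<3. perp (x i) (x j) \<and> perp (y i) (y j))"

lemma hyperbolic_basis_vectors:
  assumes "hyperbolic_basis x y" "i < 3"
  shows "x i \<in> orth R" "y i \<in> orth R" "sing (x i)" "sing (y i)"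
  using assms by (auto simp: hyperbolic_basis_def)

lemma hyperbolic_basis_perp:
  assumes "hyperbolic_basis x y" "i < 3" "j < 3"
  shows "perp (x i) (x j)" "perp (y i) (y j)" "perp (x i) (y j) \<longleftrightarrow> i \<noteq> j" "perp (y i) (x j) \<longleftrightarrow> i \<noteq> j"
  using assms perp_commute[of "y i"] by (auto simp: hyperbolic_basis_def dual_bases_def)

lemma hyperbolic_basisI:
  assumes F: "F \<in> ts_subspaces" "R \<subseteq> F" and S: "S \<in> ts_subspaces" "R \<subseteq> S"
    and xy: "\<forall>i<3. x i \<in> F \<and> y i \<in> S" and dual: "dual_bases 3 x y"
  shows "hyperbolic_basis x y"
proof -
  have "F \<subseteq> orth R" "S \<subseteq> orth R" using ts_subset_orth_of F S by blast+
  then show ?thesis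
    using xy dual ts_sing[OF F(1)] ts_sing[OF S(1)] ts_perp[OF F(1)] ts_perp[OF S(1)]
    by (auto simp: hyperbolic_basis_def)
qed

definition elliptic_basis :: "(nat \<Rightarrow> 'a ^ 'm) \<Rightarrow> (nat \<Rightarrow> 'a ^ 'm) \<Rightarrow> 'a ^ 'm \<Rightarrow> 'a ^ 'm \<Rightarrow> bool" where
  "elliptic_basis x y z z' \<longleftrightarrow> hyperbolic_basis x y \<and> \<not> perp z z'
     \<and> (\<forall>v\<in>{z, z'}. v \<in> orth R \<and> \<not> sing v \<and> (\<forall>i<3. perp (x i) v \<and> perp (y i) v))"

text \<open>
  The vectors \<open>w\<close> and \<open>w'\<close> will come from two generators that meet \<open>F\<close> in the hyperplane \<open>x 0\<close> and \<open>x 1\<close>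
  span modulo \<open>R\<close>; adding \<open>x 2 + y 2\<close> moves them into the orthogonal complement of all \<open>x i\<close> and \<open>y i\<close>.
\<close>

lemma elliptic_basis_translate:
  assumes hyp: "hyperbolic_basis x y" and w: "\<forall>v\<in>{w, w'}. sing v \<and> v \<in> orth R \<and>
      (\<forall>i<3. (perp (x i) v \<longleftrightarrow> i \<noteq> 2) \<and> (perp (y i) v \<longleftrightarrow> i \<noteq> 2))" and ww': "\<not> perp w w'"
  shows "elliptic_basis x y (w + (x 2 + y 2)) (w' + (x 2 + y 2))"
proof -
  let ?s = "x 2 + y 2"
  note vectors = hyperbolic_basis_vectors[OF hyp, of 2]
    and pairing = hyperbolic_basis_perp[OF hyp, of _ 2]
  have s: "\<not> sing ?s" using vectors pairing(3)[of 2] by (simp add: sing_add_iff)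
  have s_perp: "perp (x i) ?s \<longleftrightarrow> i \<noteq> 2" "perp (y i) ?s \<longleftrightarrow> i \<noteq> 2" if "i < 3" for i
    using that pairing[of i] by (auto simp: perp_add)
  have w_s: "perp ?s v" "perp v ?s" if "v \<in> {w, w'}" for v
    using w that by (auto simp: perp_add_left perp_commute[of v])
  have "?s \<in> orth R" using vectors(1,2) vec.subspace_add[OF subspace_orth] by simp
  then have "v + ?s \<in> orth R \<and> \<not> sing (v + ?s) \<and> (\<forall>i<3. perp (x i) (v + ?s) \<and> perp (y i) (v + ?s))"
    if "v \<in> {w, w'}" for v
    using w that w_s[OF that] s s_perp vec.subspace_add[OF subspace_orth]
    by (auto simp: sing_add_iff perp_add)
  moreover have "\<not> perp (w + ?s) (w' + ?s)"
    using ww' w_s(1)[of w'] w_s(2)[of w] perp_self[of ?s] by (auto simp: perp_add perp_add_left)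
  ultimately show ?thesis using hyp by (auto simp: elliptic_basis_def)
qed

lemma ex_vector_outside_hyperplane:
  assumes G: "G \<in> gens" and L: "L \<in> ts_subspaces" "vec.dim L + 1 = n" "L \<subseteq> G"
    and dual: "dual_bases k y x" and x: "x ` {..<k} \<subseteq> L"
  shows "\<exists>w\<in>G. w \<notin> L \<and> (\<forall>i<k. perp (x i) w \<and> perp (y i) w)"
proof -
  have "L \<noteq> G" using gens_dim[OF G] L(2) by auto
  then obtain w where w: "w \<in> G" "w \<notin> L" using L(3) by blast
  obtain u where u: "u \<in> vec.span (x ` {..<k})" "\<forall>i<k. perp (y i) (w + u)"
    using ex_perp_translate[OF dual] by blast
  have u_L: "u \<in> L" using u(1) vec.span_minimal[OF x ts_subspace[OF L(1)]] by blast
  then have "w + u \<in> G" using w(1) L(3) vec.subspace_add[OF gens_subspace[OF G]] by blast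
  moreover have "w + u \<notin> L"
    using vec.subspace_add[OF ts_subspace[OF L(1)] _ u_L, of "w + u"] w(2)
    by (auto simp: add.assoc add_self)
  moreover have "perp (x i) (w + u)" if "i < k" for i
    using ts_perp[OF gens_ts[OF G] _ calculation(1)] x L(3) that by blast
  ultimately show ?thesis using u(2) by blast
qed

lemma ex_elliptic_completion:
  assumes hyp: "hyperbolic_basis x y"
    and G: "G \<in> gens" and L: "L \<in> ts_subspaces" "vec.dim L + 1 = n" "L \<subseteq> G" "R \<subseteq> L"
    and x: "x ` {..<2} \<subseteq> L" and orth_L: "x 2 \<in> orth L" "y 2 \<in> orth L" and notin: "x 2 \<notin> G" "y 2 \<notin> G"
  shows "\<exists>w\<in>G. w \<notin> L \<and> w \<in> orth L \<and> sing w \<and> w \<in> orth R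
    \<and> (\<forall>i<3. (perp (x i) w \<longleftrightarrow> i \<noteq> 2) \<and> (perp (y i) w \<longleftrightarrow> i \<noteq> 2))"
proof -
  have "dual_bases 2 y x" using hyperbolic_basis_perp(4)[OF hyp] by (simp add: dual_bases_def)
  then obtain w where w: "w \<in> G" "w \<notin> L" "\<forall>i<2. perp (x i) w \<and> perp (y i) w"
    using ex_vector_outside_hyperplane[OF G L(1-3) _ x] by blast
  have "\<not> perp w (x 2)" "\<not> perp w (y 2)"
    using not_perp_outside_hyperplane[OF G L(1-3) w(1,2)] orth_L notin
      hyperbolic_basis_vectors(3,4)[OF hyp, of 2]
    by simp_all
  then have "\<not> perp (x 2) w" "\<not> perp (y 2) w" using perp_commute by blast+
  moreover have "i < 2 \<or> i = 2" if "i < 3" for i :: nat using that by linarith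
  ultimately have "\<forall>i<3. (perp (x i) w \<longleftrightarrow> i \<noteq> 2) \<and> (perp (y i) w \<longleftrightarrow> i \<noteq> 2)" using w(3) by blast
  moreover have "w \<in> orth L" using ts_subset_orth_of[OF gens_ts[OF G] L(3)] w(1) by blast
  ultimately show ?thesis
    using w(1,2) ts_sing[OF gens_ts[OF G] w(1)] orth_antimono[OF L(4)] by blast
qed

lemma ex_elliptic_basis:
  assumes F: "F \<in> gens" "R \<subseteq> F" and S: "S \<in> gens" "R \<subseteq> S"
    and xy: "\<forall>i<3. x i \<in> F \<and> y i \<in> S" and dual: "dual_bases 3 x y"
  shows "\<exists>z z'. elliptic_basis x y z z'"
proof -
  have hyp: "hyperbolic_basis x y"
    by (rule hyperbolic_basisI[OF gens_ts F(2) gens_ts S(2) xy dual]) (use F S in auto)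
  note vectors = hyperbolic_basis_vectors[OF hyp, of 2]
    and pairing = hyperbolic_basis_perp[OF hyp, of 2]
  define L where "L = F \<inter> orth {y 2}"
  have L: "L \<in> ts_subspaces" "L \<subseteq> F" unfolding L_def
    using ts_Int[OF gens_ts[OF F(1)] subspace_orth] by auto
  have x_L: "x ` {..<2} \<subseteq> L" and x2_L: "x 2 \<notin> L"
    using xy pairing(4) by (auto simp: L_def orth_def)
  have orth_L: "x 2 \<in> orth L" "y 2 \<in> orth L"
    using xy ts_perp[OF gens_ts[OF F(1)]] L(2) perp_commute by (auto simp: L_def orth_def)
  have y2_L: "y 2 \<notin> L" using orthD[OF orth_L(1)] pairing(4)[of 2] by auto
  have "vec.dim L \<noteq> n"
    using vec.subspace_dim_equal[OF ts_subspace[OF L(1)] gens_subspace[OF F(1)] L(2)]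
      gens_dim[OF F(1)] xy x2_L by auto
  then have dim_L: "vec.dim L + 1 = n"
    using dim_le_orth_card[OF gens_subspace[OF F(1)], of "{y 2}"] vec.dim_subset[OF L(2)]
      gens_dim[OF F(1)] by (simp add: L_def)
  have R_L: "R \<subseteq> L" using F(2) vectors(2) perp_commute by (auto simp: L_def orth_def)
  obtain G G' where G: "G \<in> gens" "G' \<in> gens" "G \<inter> G' = L" "x 2 \<notin> G" "y 2 \<notin> G" "x 2 \<notin> G'" "y 2 \<notin> G'"
    using obtain_two_gens_avoiding[OF L(1) dim_L x2_L y2_L] .
  then have L_G: "L \<subseteq> G" "L \<subseteq> G'" by auto
  obtain w where w: "w \<in> G" "w \<notin> L" "sing w" "w \<in> orth R"
    "\<forall>i<3. (perp (x i) w \<longleftrightarrow> i \<noteq> 2) \<and> (perp (y i) w \<longleftrightarrow> i \<noteq> 2)"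
    using ex_elliptic_completion[OF hyp G(1) L(1) dim_L L_G(1) R_L x_L orth_L G(4,5)] by blast
  obtain w' where w': "w' \<in> G'" "w' \<notin> L" "sing w'" "w' \<in> orth R" "w' \<in> orth L"
    "\<forall>i<3. (perp (x i) w' \<longleftrightarrow> i \<noteq> 2) \<and> (perp (y i) w' \<longleftrightarrow> i \<noteq> 2)"
    using ex_elliptic_completion[OF hyp G(2) L(1) dim_L L_G(2) R_L x_L orth_L G(6,7)] by blast
  have "\<not> perp w w'"
    by (rule not_perp_outside_hyperplane[OF G(1) L(1) dim_L L_G(1) w(1,2) w'(3,5)])
      (use w' G(3) in blast)
  then show ?thesis using elliptic_basis_translate[OF hyp, of w w'] w w' by blast
qed

definition bit_scale :: "bool \<Rightarrow> 'a ^ 'm \<Rightarrow> 'a ^ 'm" where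
  "bit_scale a v = (if a then v else 0)"

definition byte_combination :: "(nat \<Rightarrow> 'a ^ 'm) \<Rightarrow> (nat \<Rightarrow> 'a ^ 'm) \<Rightarrow> 'a ^ 'm \<Rightarrow> 'a ^ 'm \<Rightarrow> char \<Rightarrow> 'a ^ 'm" where
  "byte_combination x y z z' s = (case s of Char a b c d e f g h \<Rightarrow>
     (bit_scale a (x 0) + bit_scale b (y 0)) + ((bit_scale c (x 1) + bit_scale d (y 1)) +
     ((bit_scale e (x 2) + bit_scale f (y 2)) + (bit_scale g z + bit_scale h z'))))"

lemma bit_scale_add: "bit_scale (a \<noteq> b) v = bit_scale a v + bit_scale b v"
  by (cases a; cases b) (simp_all add: bit_scale_def add_self)

lemma perp_bit_scale: "perp (bit_scale a u) (bit_scale b v) \<longleftrightarrow> (a \<and> b \<longrightarrow> perp u v)"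
  using perp_zero perp_commute[of 0] by (auto simp: bit_scale_def)

lemma sing_bit_scale: "sing (bit_scale a u) \<longleftrightarrow> (a \<longrightarrow> sing u)"
  by (auto simp: bit_scale_def sing_0)

lemma bit_scale_orth: "u \<in> orth R \<Longrightarrow> bit_scale a u \<in> orth R"
  using vec.subspace_0[OF subspace_orth] by (simp add: bit_scale_def)

lemma frame_byte_combination:
  assumes basis: "elliptic_basis x y z z'"
  shows "frame (byte_combination x y z z')"
  unfolding frame_def
proof (intro conjI allI)
  let ?e = "byte_combination x y z z'"
  show "?e (c \<oplus> d) = ?e c + ?e d" for c d
    by (cases c; cases d)
      (simp only: byte_combination_def byte_add.simps char.case bit_scale_add ac_simps)
  fix s :: char
  obtain a b c d e f g h where s: "s = Char a b c d e f g h" by (cases s)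
  show "?e s \<in> orth R"
    unfolding s byte_combination_def char.case
    using basis by (intro vec.subspace_add[OF subspace_orth] bit_scale_orth)
      (auto simp: elliptic_basis_def hyperbolic_basis_def)
  have hyp: "hyperbolic_basis x y" using basis by (simp add: elliptic_basis_def)
  have xyz: "perp (x i) v" "perp (y i) v" "perp v (x i)" "perp v (y i)" if "i < 3" "v \<in> {z, z'}"
    for i v
    using basis that perp_commute[of v "x i"] perp_commute[of v "y i"]
    by (auto simp: elliptic_basis_def)
  have z: "\<not> sing z" "\<not> sing z'" "\<not> perp z z'" using basis by (auto simp: elliptic_basis_def)
  show "sing (?e s) \<longleftrightarrow> \<not> byte_form s"
    unfolding s byte_combination_def char.case byte_form.simps sing_add_iff perp_add perp_add_left
      perp_bit_scale sing_bit_scale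
    by (simp add: hyperbolic_basis_vectors[OF hyp] hyperbolic_basis_perp[OF hyp] xyz z,
        cases a; cases c; cases e; cases g; simp; cases b; cases d; cases f; simp)
qed

theorem no_steiner_rank3_elliptic_binary: False
proof -
  obtain F where F: "F \<in> Y" using steiner_nonempty[OF steiner] by blast
  have "real (card {W \<in> Y. F \<inter> W = R}) = 96"
    using card_rank3_disjoint[OF steiner rank3 F] card2 by simp
  then have "{W \<in> Y. F \<inter> W = R} \<noteq> {}" by (metis card.empty of_nat_0 zero_neq_numeral)
  then obtain S where S: "S \<in> Y" "F \<inter> S = R" by blast
  have gens: "F \<in> gens" "S \<in> gens" using F S steiner_gens[OF steiner] by auto
  obtain x y where xy: "\<forall>i<3. x i \<in> F \<and> y i \<in> S" and dual: "dual_bases 3 x y"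
    using ex_dual_bases[OF gens S(2), of 3] rank3 by auto
  obtain z z' where basis: "elliptic_basis x y z z'"
    using ex_elliptic_basis[OF gens(1) _ gens(2) _ xy dual] S(2) by blast
  define e where "e = byte_combination x y z z'"
  have e: "frame e" unfolding e_def by (rule frame_byte_combination[OF basis])
  have "\<forall>c\<in>set (byte_plane (CHR 0x01) (CHR 0x04) (CHR 0x10)). e c \<in> F"
    by (rule byte_plane_mem[OF e gens_subspace[OF gens(1)]])
      (use xy in \<open>simp_all add: e_def byte_combination_def bit_scale_def\<close>)
  moreover have "\<forall>c\<in>set (byte_plane (CHR 0x02) (CHR 0x08) (CHR 0x20)). e c \<in> S"
    by (rule byte_plane_mem[OF e gens_subspace[OF gens(2)]])
      (use xy in \<open>simp_all add: e_def byte_combination_def bit_scale_def\<close>)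
  ultimately have "holds e base_goal" using F S(1) unfolding holds_def base_goal_def by auto
  then show False using inconsistent_base e by (auto simp: inconsistent_def)
qed

end

section \<open>Classical polar spaces\<close>

locale formed_space = singular_space perp sing
  for perp :: "'a::{field,finite} ^ 'm \<Rightarrow> 'a ^ 'm \<Rightarrow> bool" and sing +
  fixes \<nu> :: nat
  assumes card_sing_line: "sing x \<Longrightarrow> \<not> perp x y \<Longrightarrow> card {c. sing (y + c *s x)} = \<nu>"
    and sing_radical: "sing x \<Longrightarrow> (\<And>y. perp x y) \<Longrightarrow> x = 0"
begin

definition maximal :: "('a ^ 'm) set \<Rightarrow> bool" where
  "maximal U \<longleftrightarrow> U \<in> ts_subspaces \<and> (\<forall>W\<in>ts_subspaces. U \<subseteq> W \<longrightarrow> W = U)"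

lemma maximal_mem:
  assumes U: "maximal U" and x: "sing x" "x \<in> orth U"
  shows "x \<in> U"
proof -
  have "vec.span (insert x U) \<in> ts_subspaces"
    using U x by (intro ts_span_insert) (auto simp: maximal_def)
  moreover have "insert x U \<subseteq> vec.span (insert x U)" by (rule vec.span_superset)
  ultimately have "vec.span (insert x U) = U" using U by (auto simp: maximal_def)
  then show ?thesis using vec.span_superset[of "insert x U"] by auto
qed

lemma maximal_ts: "maximal U \<Longrightarrow> U \<in> ts_subspaces"
  by (simp add: maximal_def)

lemma obtain_maximal:
  assumes "U \<in> ts_subspaces"
  obtains M where "maximal M" "U \<subseteq> M"
proof -
  have "U \<in> {W \<in> ts_subspaces. U \<subseteq> W}" using assms by simp
  then obtain M where "M \<in> {W \<in> ts_subspaces. U \<subseteq> W}" "\<forall>W\<in>{W \<in> ts_subspaces. U \<subseteq> W}. M \<subseteq> W \<longrightarrow> M = W"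
    using finite_has_maximal2[of "{W \<in> ts_subspaces. U \<subseteq> W}" U] finite by blast
  then show ?thesis by (intro that[of M]) (auto simp: maximal_def)
qed

lemma dim_le_maximal:
  assumes U: "maximal U" and W: "W \<in> ts_subspaces"
  shows "vec.dim W \<le> vec.dim U"
proof -
  have "W \<inter> orth U \<subseteq> U \<inter> orth W"
    using maximal_mem[OF U] ts_sing[OF W] ts_subset_orth[OF W] by blast
  then have "vec.dim (W \<inter> orth U) \<le> vec.dim (U \<inter> orth W)" by (rule vec.dim_subset)
  then show ?thesis
    using dim_pairing[OF ts_subspace[OF maximal_ts[OF U]] ts_subspace[OF W]] by linarith
qed

lemma maximal_dim_eq: "maximal U \<Longrightarrow> maximal W \<Longrightarrow> vec.dim U = vec.dim W"
  using dim_le_maximal maximal_ts by (simp add: order_antisym)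

lemma dim_orth: assumes "A \<in> ts_subspaces" shows "vec.dim (orth A) + vec.dim A = CARD('m)"
proof -
  have "x = 0" if "x \<in> A \<inter> orth UNIV" for x
  proof (rule sing_radical)
    show "sing x" using that ts_sing[OF assms] by blast
    show "perp x y" for y using that by (intro perp_sym[OF orthD[of x UNIV]]) auto
  qed
  moreover have "0 \<in> A \<inter> orth UNIV"
    using vec.subspace_0[OF ts_subspace[OF assms]] vec.subspace_0[OF subspace_orth] by simp
  ultimately have "A \<inter> orth UNIV = {0}" by blast
  then have "vec.dim (A \<inter> orth UNIV) = 0" by simp
  then show ?thesis
    using dim_pairing[OF ts_subspace[OF assms] vec.subspace_UNIV]
    by (simp only: vec_dim_card Int_UNIV_left)
qed

lemma dim_maximal_le: assumes "maximal U" shows "2 * vec.dim U \<le> CARD('m)"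
  using dim_orth[OF maximal_ts[OF assms]] vec.dim_subset[OF ts_subset_orth[OF maximal_ts[OF assms]]]
  by linarith

lemma ex_nonsingular_orth:
  assumes U: "maximal U" "U \<subseteq> W" and X: "finite X" "vec.dim W + card X < vec.dim (orth U)"
  obtains e where "e \<in> orth U" "e \<notin> W" "\<not> sing e" "\<And>x. x \<in> X \<Longrightarrow> perp x e"
proof -
  have "vec.dim W < vec.dim (orth U \<inter> orth X)"
    using dim_le_orth_card[OF subspace_orth X(1), of U] X(2) by linarith
  then have "\<not> orth U \<inter> orth X \<subseteq> W" using vec.dim_subset[of "orth U \<inter> orth X" W] by linarith
  then obtain e where e: "e \<in> orth U" "e \<in> orth X" "e \<notin> W" by blast
  moreover have "\<not> sing e" using maximal_mem[OF U(1)] e U(2) by blast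
  ultimately show ?thesis using that orthD by blast
qed

lemma orth_hyperplane_iff:
  assumes "vec.subspace S" "vec.subspace U" "S \<subseteq> U" "vec.dim U = vec.dim S + 1" "u \<in> U" "u \<notin> S"
  shows "y \<in> orth U \<longleftrightarrow> perp u y \<and> y \<in> orth S"
  unfolding subspace_eq_span_insert[OF assms] orth_span by (auto simp: orth_def)

text \<open>
  Relative to a fixed generator \<open>U \<supseteq> S\<close>, the singular vectors of \<open>orth S\<close> outside \<open>orth U\<close> are counted
  once along the cosets of a vector of \<open>U\<close>, and once along the generators through \<open>S\<close> other than \<open>U\<close>.
\<close>

lemma card_sing_orth_diff:
  assumes S: "vec.subspace S" and U: "U \<in> ts_subspaces" and SU: "S \<subseteq> U" "vec.dim S + 1 = vec.dim U"
  shows "CARD('a) * card {y \<in> orth S - orth U. sing y} = \<nu> * card (orth S - orth U)"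
proof -
  let ?Z = "orth S - orth U"
  obtain u where u: "u \<in> U" "u \<notin> S"
    using SU by (metis add_cancel_right_right one_neq_zero subset_antisym subsetI)
  note orth_U = orth_hyperplane_iff[OF S ts_subspace[OF U] SU(1) SU(2)[symmetric] u]
  have sing_u: "sing u" and u_orth: "u \<in> orth S"
    using ts_sing[OF U u(1)] ts_subset_orth[OF U] orth_antimono[OF SU(1)] u(1) by auto
  have shift: "y + c *s u \<in> ?Z" if "y \<in> ?Z" for y c
  proof -
    have "perp u (c *s u)" using sing_perp[OF sing_u] vec.subspace_scale[OF perp_subspace] by blast
    then have "perp u (y + c *s u) \<Longrightarrow> perp u y"
      using vec.subspace_diff[OF perp_subspace[of u], of "y + c *s u" "c *s u"] by simp
    moreover have "y + c *s u \<in> orth S"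
      using that u_orth vec.subspace_add[OF subspace_orth] vec.subspace_scale[OF subspace_orth]
      by blast
    ultimately show ?thesis using that orth_U by blast
  qed
  have "card {y \<in> ?Z. sing (y + c *s u)} = card {y \<in> ?Z. sing y}" for c
  proof (rule bij_betw_same_card, rule bij_betwI[where g = "\<lambda>y. y + (- c) *s u"])
    show "(\<lambda>y. y + c *s u) \<in> {y \<in> ?Z. sing (y + c *s u)} \<rightarrow> {y \<in> ?Z. sing y}" using shift by blast
    show "(\<lambda>y. y + (- c) *s u) \<in> {y \<in> ?Z. sing y} \<rightarrow> {y \<in> ?Z. sing (y + c *s u)}"
      using shift[of _ "- c"] by auto
  qed auto
  moreover have "card {c \<in> UNIV. sing (y + c *s u)} = \<nu>" if "y \<in> ?Z" for y
    using card_sing_line[OF sing_u, of y] that orth_U by auto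
  ultimately have "card ?Z * \<nu> = CARD('a) * card {y \<in> ?Z. sing y}"
    by (intro card_biregular[where R = "\<lambda>y c. sing (y + c *s u)"]) auto
  then show ?thesis by (simp add: mult.commute)
qed

lemma hyperplane_eq_span_insert:
  assumes "S \<in> ts_subspaces" "G \<in> ts_subspaces" "S \<subseteq> G" "vec.dim S + 1 = vec.dim G" "g \<in> G" "g \<notin> S"
  shows "G = vec.span (insert g S)"
  using subspace_eq_span_insert[OF ts_subspace ts_subspace] assms by simp

lemma sing_outside_eq:
  assumes S: "S \<in> ts_subspaces" and U: "maximal U" and SU: "S \<subseteq> U" "vec.dim S + 1 = vec.dim U"
    and G: "G \<in> ts_subspaces" "vec.dim G = vec.dim U" "S \<subseteq> G" "G \<noteq> U"
  shows "{y \<in> orth S - orth U. sing y \<and> y \<in> G} = G - S"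
proof -
  have "g \<notin> orth U" if g: "g \<in> G" "g \<notin> S" for g
  proof
    assume "g \<in> orth U"
    then have "g \<in> U" using maximal_mem[OF U ts_sing[OF G(1) g(1)]] by simp
    then have "U = vec.span (insert g S)"
      using hyperplane_eq_span_insert[OF S maximal_ts[OF U] SU] g(2) by blast
    then show False using hyperplane_eq_span_insert[OF S G(1,3) _ g] SU(2) G(2,4) by simp
  qed
  moreover have "G \<subseteq> orth S" using ts_subset_orth[OF G(1)] orth_antimono[OF G(3)] by blast
  ultimately show ?thesis using SU(1) ts_subset_orth[OF maximal_ts[OF U]] ts_sing[OF G(1)] by auto
qed

lemma generators_through_outside:
  assumes S: "S \<in> ts_subspaces" and U: "maximal U" and SU: "S \<subseteq> U" "vec.dim S + 1 = vec.dim U"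
    and y: "y \<in> orth S - orth U" "sing y"
  shows "{G \<in> {G \<in> ts_subspaces. vec.dim G = vec.dim U \<and> S \<subseteq> G} - {U}. y \<in> G} = {vec.span (insert y S)}"
    (is "?Gs = {?H}")
proof -
  have U_orth: "U \<subseteq> orth U" by (rule ts_subset_orth[OF maximal_ts[OF U]])
  then have y_S: "y \<notin> S" using SU(1) y(1) by blast
  have "?H \<in> ts_subspaces" using y by (intro ts_span_insert[OF S]) auto
  moreover have "vec.dim ?H = vec.dim U"
    using dim_span_insert[OF ts_subspace[OF S] y_S] SU(2) by linarith
  moreover have y_H: "y \<in> ?H" and "S \<subseteq> ?H" using vec.span_superset[of "insert y S"] by auto
  moreover have "?H \<noteq> U" using y_H y(1) U_orth by blast
  ultimately have "?H \<in> ?Gs" by simp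
  moreover have "G = ?H" if "G \<in> ?Gs" for G
    using that SU(2) by (intro hyperplane_eq_span_insert[OF S _ _ _ _ y_S]) simp_all
  ultimately show ?thesis by blast
qed

lemma card_generators:
  assumes S: "S \<in> ts_subspaces" and U: "maximal U" and SU: "S \<subseteq> U" "vec.dim S + 1 = vec.dim U"
  shows "card {G \<in> ts_subspaces. vec.dim G = vec.dim U \<and> S \<subseteq> G}
      = \<nu> * CARD('a) ^ (CARD('m) - 2 * vec.dim U) + 1"
proof -
  let ?s = "vec.dim S" and ?q = "CARD('a)"
    and ?G = "{G \<in> ts_subspaces. vec.dim G = vec.dim U \<and> S \<subseteq> G} - {U}"
  note U_ts = maximal_ts[OF U]
  have dims: "vec.dim (orth S) = vec.dim (orth U) + 1"
    "vec.dim (orth U) = (CARD('m) - 2 * vec.dim U) + Suc ?s"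
    using dim_orth[OF S] dim_orth[OF U_ts] SU(2) dim_maximal_le[OF U] by linarith+
  have "card {y \<in> orth S - orth U. sing y} * 1 = card ?G * (?q ^ ?s * (?q - 1))"
  proof (rule card_biregular)
    show "card {G \<in> ?G. y \<in> G} = 1" if "y \<in> {y \<in> orth S - orth U. sing y}" for y
      using generators_through_outside[OF S U SU, of y] that by simp
    show "card {y \<in> {y \<in> orth S - orth U. sing y}. y \<in> G} = ?q ^ ?s * (?q - 1)" if G: "G \<in> ?G" for G
    proof -
      have "{y \<in> {y \<in> orth S - orth U. sing y}. y \<in> G} = G - S"
        using sing_outside_eq[OF S U SU] G by auto
      then show ?thesis
        using card_subspace_diff[OF ts_subspace[OF S] ts_subspace] G SU(2) by simp
    qed
  qed simp_all
  then have "?q * (card ?G * (?q ^ ?s * (?q - 1))) = \<nu> * card (orth S - orth U)"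
    using card_sing_orth_diff[OF ts_subspace[OF S] U_ts SU] by simp
  also have "\<dots> = \<nu> * (?q ^ (CARD('m) - 2 * vec.dim U) * (?q * ?q ^ ?s) * (?q - 1))"
    using card_subspace_diff[OF subspace_orth subspace_orth orth_antimono[OF SU(1)] dims(1)] dims(2)
    by (simp add: power_add)
  finally have "(?q * ?q ^ ?s * (?q - 1)) * card ?G
      = (?q * ?q ^ ?s * (?q - 1)) * (\<nu> * ?q ^ (CARD('m) - 2 * vec.dim U))"
    by (simp only: ac_simps)
  moreover have "?q * ?q ^ ?s * (?q - 1) > 0" using CARD_field_gt_1[where ?'a = 'a] by simp
  ultimately have card_G: "card ?G = \<nu> * ?q ^ (CARD('m) - 2 * vec.dim U)"
    by (simp only: nat_mult_eq_cancel1)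
  have "U \<in> {G \<in> ts_subspaces. vec.dim G = vec.dim U \<and> S \<subseteq> G}" using U_ts SU(1) by simp
  from card_Suc_Diff1[OF finite this] show ?thesis unfolding card_G by linarith
qed

lemma polar_spaceI:
  assumes M: "maximal M" "vec.dim M = n"
  shows "polar_space perp sing n (\<nu> * CARD('a) ^ (CARD('m) - 2 * n))"
proof unfold_locales
  fix U assume U: "U \<in> ts_subspaces"
  obtain G where G: "maximal G" "U \<subseteq> G" using obtain_maximal[OF U] .
  then show "\<exists>G\<in>ts_subspaces. U \<subseteq> G \<and> vec.dim G = n"
    using maximal_dim_eq[OF G(1) M(1)] M(2) maximal_ts by blast
  show "vec.dim U \<le> n" using dim_le_maximal[OF M(1) U] M(2) by simp
next
  fix S assume S: "S \<in> ts_subspaces" "vec.dim S + 1 = n"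
  obtain G where G: "maximal G" "S \<subseteq> G" using obtain_maximal[OF S(1)] .
  have "vec.dim G = n" using maximal_dim_eq[OF G(1) M(1)] M(2) by simp
  then show "card {G \<in> ts_subspaces. vec.dim G = n \<and> S \<subseteq> G} = \<nu> * CARD('a) ^ (CARD('m) - 2 * n) + 1"
    using card_generators[OF S(1) G] S(2) by simp
qed

end

lemma card_fibre_eq:
  assumes "finite A" "finite K" "f ` A \<subseteq> K" and fibre_le: "\<And>y. y \<in> K \<Longrightarrow> card {x \<in> A. f x = y} \<le> b"
    and K: "card K \<le> k" and A: "card A = k * b" and y: "y \<in> K"
  shows "card {x \<in> A. f x = y} = b"
proof (rule ccontr)
  assume "card {x \<in> A. f x = y} \<noteq> b"
  then have "card {x \<in> A. f x = y} < b" using fibre_le[OF y] by simp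
  then have "(\<Sum>y\<in>K. card {x \<in> A. f x = y}) < (\<Sum>y\<in>K. b)"
    using fibre_le y assms(2) by (intro sum_strict_mono_ex1) auto
  also have "\<dots> \<le> k * b" using K by simp
  also have "k * b = (\<Sum>y\<in>K. card {x \<in> A. f x = y})"
  proof -
    have "{y \<in> K. f x = y} = {f x}" if "x \<in> A" for x using that assms(3) by auto
    then show ?thesis using sum_multicount[of K A "\<lambda>y x. f x = y" 1] assms(1,2) A by simp
  qed
  finally show False by simp
qed

lemma card_power_eq_poly_le:
  fixes p :: "'a::idom poly"
  assumes "degree p < n"
  shows "card {x. x ^ n = poly p x} \<le> n"
proof -
  let ?r = "monom 1 n - p"
  have "coeff ?r n = 1" using assms by (simp add: coeff_eq_0)
  then have "?r \<noteq> 0" by auto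
  from card_poly_roots_bound[OF this] have "card {x. x ^ n = poly p x} \<le> degree ?r"
    by (simp add: poly_monom)
  also have "\<dots> \<le> n" using assms by (intro degree_diff_le degree_monom_le) simp
  finally show ?thesis .
qed

lemma of_nat_CARD_eq_0: "of_nat CARD('a) = (0 :: 'a::{field,finite})"
proof -
  have "(\<Sum>x\<in>UNIV. x + 1) = (\<Sum>x\<in>UNIV. x :: 'a)"
    by (rule sum.reindex_bij_witness[of _ "\<lambda>x. x - 1" "\<lambda>x. x + 1"]) auto
  then show ?thesis by (simp add: sum.distrib)
qed

lemma power_CARD: "x ^ CARD('a) = (x :: 'a::{field,finite})"
proof (cases "x = 0")
  case False
  have "(\<Prod>y\<in>UNIV - {0}. x * y) = (\<Prod>y\<in>UNIV - {0}. y)"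
    by (rule prod.reindex_bij_witness[of _ "\<lambda>y. y / x" "\<lambda>y. x * y"]) (use False in auto)
  then have "x ^ (CARD('a) - 1) * \<Prod>(UNIV - {0}) = 1 * \<Prod>(UNIV - {0})"
    by (simp add: prod.distrib card_Diff_singleton)
  moreover have "\<Prod>(UNIV - {0}) \<noteq> (0 :: 'a)" by simp
  ultimately have "x ^ (CARD('a) - 1) = 1" by (metis mult_right_cancel)
  then have "x ^ Suc (CARD('a) - 1) = x" by (simp only: power_Suc mult_1_right)
  moreover have "Suc (CARD('a) - 1) = CARD('a)" using CARD_field_gt_1[where ?'a = 'a] by linarith
  ultimately show ?thesis by (simp only:)
qed simp

context
  fixes q :: nat
  assumes q: "primepow q" and card_field: "CARD('a::{field,finite}) = q\<^sup>2"
begin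

lemma q_gt_1: "q > 1" using primepow_gt_Suc_0[OF q] by simp

lemma frobenius_add: "(a + b) ^ q = a ^ q + (b :: 'a) ^ q"
proof -
  obtain p k where pk: "prime p" "q = p ^ k" using q by (auto simp: primepow_def)
  have prime_CHAR: "prime CHAR('a)" by (rule prime_CHAR_semidom[OF finite_imp_CHAR_pos]) simp
  moreover have "CHAR('a) dvd CARD('a)"
    using of_nat_CARD_eq_0[where ?'a = 'a] of_nat_eq_0_iff_char_dvd by blast
  ultimately have "CHAR('a) dvd p" using prime_dvd_power unfolding card_field pk(2) by blast
  then have "CHAR('a) = p" using prime_CHAR pk(1) primes_dvd_imp_eq by blast
  then show ?thesis using prime_CHAR pk(2) by (intro freshmans_dream') auto
qed

lemma frobenius_twice: "((a :: 'a) ^ q) ^ q = a"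
  using power_CARD[of a] unfolding card_field by (simp only: power_mult power2_eq_square)

lemma card_fixed: "card {b :: 'a. b ^ q = b} \<le> q"
  using card_power_eq_poly_le[of "[:0, 1 :: 'a:]" q] q_gt_1 by simp

lemma card_trace_fibre:
  assumes "b ^ q = b"
  shows "card {a :: 'a. a + a ^ q = b} = q"
proof -
  have "card {a \<in> UNIV. a + a ^ q = b} = q"
  proof (rule card_fibre_eq[OF finite finite _ _ card_fixed])
    show "range (\<lambda>a :: 'a. a + a ^ q) \<subseteq> {b. b ^ q = b}"
      by (auto simp: frobenius_add frobenius_twice add.commute)
    have "card {a. a ^ q = poly [:c, - 1 :: 'a:] a} \<le> q" for c
      by (rule card_power_eq_poly_le) (use q_gt_1 in simp)
    then show "card {a \<in> UNIV. a + a ^ q = c} \<le> q" for c :: 'a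
      by (simp add: eq_diff_eq add.commute)
  qed (use assms card_field in \<open>auto simp: power2_eq_square\<close>)
  then show ?thesis by simp
qed

lemma norm_surj:
  assumes b: "b ^ q = b" "b \<noteq> 0"
  shows "\<exists>s :: 'a. s ^ (q + 1) = b"
proof -
  let ?X = "UNIV - {0 :: 'a}" and ?K = "{b :: 'a. b ^ q = b} - {0}"
  have "card {s \<in> ?X. s ^ (q + 1) = b} = q + 1"
  proof (rule card_fibre_eq[where K = ?K and k = "q - 1"])
    show "(\<lambda>s. s ^ (q + 1)) ` ?X \<subseteq> ?K"
      by (auto simp: power_mult_distrib frobenius_twice mult.commute)
    show "card {s \<in> ?X. s ^ (q + 1) = c} \<le> q + 1" for c
    proof -
      have "card {s \<in> ?X. s ^ (q + 1) = c} \<le> card {s. s ^ (q + 1) = poly [:c:] s}"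
        by (intro card_mono) auto
      also have "\<dots> \<le> q + 1" by (rule card_power_eq_poly_le) simp
      finally show ?thesis .
    qed
    have "0 \<in> {b :: 'a. b ^ q = b}" using q_gt_1 by simp
    then show "card ?K \<le> q - 1"
      using card_Diff_singleton[of "0 :: 'a"] card_fixed by (metis diff_le_mono)
    have "card ?X = q\<^sup>2 - 1" using card_Diff_singleton[of "0 :: 'a" UNIV] by (simp add: card_field)
    then show "card ?X = (q - 1) * (q + 1)" by (simp add: power2_eq_square algebra_simps)
  qed (use b in auto)
  then have "{s \<in> ?X. s ^ (q + 1) = b} \<noteq> {}" by (metis Suc_eq_plus1 card.empty nat.distinct(1))
  then show ?thesis by blast
qed

end

lemma perp_spaceI:
  fixes f :: "'a::{field,finite} ^ 'm \<Rightarrow> 'a ^ 'm \<Rightarrow> 'a"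
  assumes add: "\<And>x y z. f x (y + z) = f x y + f x z" and scale: "\<And>x c y. f x (c *s y) = c * f x y"
    and zero_sym: "\<And>x y. f x y = 0 \<Longrightarrow> f y x = 0"
  shows "perp_space (\<lambda>x y. f x y = 0)"
proof
  have f_zero: "f x 0 = 0" for x using scale[of x 0 0] by simp
  show "vec.subspace {y. f x y = 0}" for x by (simp add: vec.subspace_def f_zero add scale)
  then have subspace_perp: "vec.subspace (C \<inter> {y. f x y = 0})" if "vec.subspace C" for C x
    using that vec.subspace_inter by blast
  show "vec.dim C \<le> vec.dim (C \<inter> {y. f x y = 0}) + 1" if C: "vec.subspace C" for C x
  proof (cases "\<forall>y\<in>C. f x y = 0")
    case True
    then have "C \<inter> {y. f x y = 0} = C" by blast
    then show ?thesis by simp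
  next
    case False
    then obtain v where v: "v \<in> C" "f x v \<noteq> 0" by blast
    have "C \<subseteq> vec.span (insert v (C \<inter> {y. f x y = 0}))"
    proof
      fix y assume y: "y \<in> C"
      let ?c = "f x y / f x v"
      have "y - ?c *s v \<in> C" using y v C vec.subspace_diff vec.subspace_scale by blast
      moreover have "f x y = f x (y - ?c *s v) + f x (?c *s v)" by (simp flip: add)
      then have "f x (y - ?c *s v) = 0" using v(2) by (simp add: scale)
      moreover have "y = ?c *s v + (y - ?c *s v)" by simp
      ultimately show "y \<in> vec.span (insert v (C \<inter> {y. f x y = 0}))"
        unfolding span_insert_eq[OF subspace_perp[OF C]] by blast
    qed
    then have "vec.dim C \<le> vec.dim (vec.span (insert v (C \<inter> {y. f x y = 0})))"
      by (rule vec.dim_subset)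
    also have "\<dots> = vec.dim (C \<inter> {y. f x y = 0}) + 1"
      by (rule dim_span_insert[OF subspace_perp[OF C]]) (use v in simp)
    finally show ?thesis .
  qed
qed (rule zero_sym)

lemma linearD:
  fixes f :: "'a::{field,finite} ^ 'm \<Rightarrow> 'a"
  assumes "Vector_Spaces.linear (*s) (*) f"
  shows "f (x + y) = f x + f y" "f (c *s x) = c * f x"
  using assms unfolding Vector_Spaces.linear_iff by auto

subsection \<open>Hermitian forms\<close>

context
  fixes q :: nat and B :: "'a::{field,finite} ^ 'm \<Rightarrow> 'a ^ 'm \<Rightarrow> 'a"
  assumes q: "primepow q" and card_field: "CARD('a) = q\<^sup>2"
    and herm: "hermitian_form q B" and nondeg: "nondegenerate B"
begin

lemma hermitian_add: "B (x + y) z = B x z + B y z" and hermitian_scale: "B (c *s x) z = c * B x z"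
proof -
  have "Vector_Spaces.linear (*s) (*) (\<lambda>u. B u z)" using herm unfolding hermitian_form_def by blast
  from linearD[OF this] show "B (x + y) z = B x z + B y z" "B (c *s x) z = c * B x z" .
qed

lemma hermitian_conj: "B v u = B u v ^ q"
  using herm unfolding hermitian_form_def by blast

lemma hermitian_add_right: "B z (x + y) = B z x + B z y"
  unfolding hermitian_conj[of z] hermitian_add by (rule frobenius_add[OF q card_field])

lemma hermitian_scale_right: "B z (c *s x) = c ^ q * B z x"
  unfolding hermitian_conj[of z] hermitian_scale by (simp add: power_mult_distrib)

lemma hermitian_zero_sym: "B x y = 0 \<Longrightarrow> B y x = 0"
  unfolding hermitian_conj[of y x] using q_gt_1[OF q card_field] by simp

lemma hermitian_neg_fixed: "(- B y y) ^ q = - B y y"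
proof -
  have "(- B y y) ^ q + B y y ^ q = (- B y y + B y y) ^ q"
    by (rule frobenius_add[OF q card_field, symmetric])
  also have "\<dots> = 0" using q_gt_1[OF q card_field] by simp
  finally show ?thesis
    unfolding hermitian_conj[of y y, symmetric] by (simp only: eq_neg_iff_add_eq_0)
qed

lemma hermitian_formed_space: "formed_space (\<lambda>x y. B y x = 0) (\<lambda>x. B x x = 0) q"
proof -
  interpret perp_space "\<lambda>x y. B y x = 0"
    by (rule perp_spaceI[of "\<lambda>x y. B y x", OF hermitian_add hermitian_scale hermitian_zero_sym])
  have B0: "B 0 x = 0" for x using hermitian_scale[of 0 0 x] by simp
  show ?thesis
  proof
    show "B 0 0 = 0" by (rule B0)
    show "B (c *s x) (c *s x) = 0" if "B x x = 0" for x c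
      using that by (simp add: hermitian_scale hermitian_scale_right)
    show "B (x + y) (x + y) = 0" if "B x x = 0" "B y y = 0" "B y x = 0" for x y
      using that hermitian_zero_sym[OF that(3)] by (simp add: hermitian_add hermitian_add_right)
    show "B x x = 0" if "B x x = 0" for x by (rule that)
    show "card {c. B (y + c *s x) (y + c *s x) = 0} = q" if x: "B x x = 0" "B y x \<noteq> 0" for x y
    proof -
      define g where "g = B x y"
      have g: "g \<noteq> 0" using x(2) hermitian_zero_sym g_def by metis
      have "B (y + c *s x) (y + c *s x) = B y y + (c * g + (c * g) ^ q)" for c
        by (simp add: hermitian_add hermitian_add_right hermitian_scale hermitian_scale_right x(1) g_def
            hermitian_conj[of y x] power_mult_distrib algebra_simps)
      then have "{c. B (y + c *s x) (y + c *s x) = 0} = {c. c * g + (c * g) ^ q = - B y y}"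
        by (simp add: add_eq_0_iff2 add.commute eq_neg_iff_add_eq_0)
      moreover have "bij_betw (\<lambda>c. c * g) {c. c * g + (c * g) ^ q = - B y y} {a. a + a ^ q = - B y y}"
        by (rule bij_betwI[where g = "\<lambda>a. a / g"]) (use g in auto)
      moreover have "card {a. a + a ^ q = - B y y} = q"
        by (rule card_trace_fibre[OF q card_field hermitian_neg_fixed])
      ultimately show ?thesis using bij_betw_same_card[of "\<lambda>c. c * g"] by simp
    qed
    show "x = 0" if "B x x = 0" "\<And>y. B y x = 0" for x
      using nondeg that(2) hermitian_zero_sym unfolding nondegenerate_def by blast
  qed
qed

lemma hermitian_ts_subspaces: "singular_space.ts_subspaces (\<lambda>x y. B y x = 0) (\<lambda>x. B x x = 0)
    = isotropic_subspaces B"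
proof -
  interpret formed_space "\<lambda>x y. B y x = 0" "\<lambda>x. B x x = 0" q by (rule hermitian_formed_space)
  show ?thesis unfolding ts_subspaces_def isotropic_subspaces_def orth_def by blast
qed

lemma hermitian_dim_maximal:
  assumes U: "formed_space.maximal (\<lambda>x y. B y x = 0) (\<lambda>x. B x x = 0) U"
  shows "CARD('m) \<le> 2 * vec.dim U + 1"
proof (rule ccontr)
  interpret formed_space "\<lambda>x y. B y x = 0" "\<lambda>x. B x x = 0" q by (rule hermitian_formed_space)
  assume "\<not> ?thesis"
  then have dim_orth_U: "vec.dim U + 2 \<le> vec.dim (orth U)"
    using dim_orth[OF maximal_ts[OF U]] by linarith
  obtain e1 where e1: "e1 \<in> orth U" "B e1 e1 \<noteq> 0"
    using ex_nonsingular_orth[OF U order_refl, of "{}"] dim_orth_U by auto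
  obtain e2 where e2: "e2 \<in> orth U" "B e2 e2 \<noteq> 0" "B e2 e1 = 0"
    using ex_nonsingular_orth[OF U order_refl, of "{e1}"] dim_orth_U by auto
  let ?b = "- (B e2 e2 / B e1 e1)"
  have "?b ^ q = ((- B e2 e2) / B e1 e1) ^ q" by simp
  also have "\<dots> = (- B e2 e2) / B e1 e1"
    unfolding power_divide hermitian_neg_fixed hermitian_conj[of e1 e1, symmetric] ..
  finally obtain s where s: "s ^ (q + 1) = ?b"
    using norm_surj[OF q card_field, of ?b] e1(2) e2(2) by auto
  let ?v = "s *s e1 + e2"
  have "B ?v ?v = s ^ (q + 1) * B e1 e1 + B e2 e2"
    using e2(3) hermitian_zero_sym[OF e2(3)]
    by (simp add: hermitian_add hermitian_add_right hermitian_scale hermitian_scale_right algebra_simps)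
  then have "B ?v ?v = 0" unfolding s using e1(2) by simp
  moreover have "?v \<in> orth U"
    by (intro vec.subspace_add[OF subspace_orth] vec.subspace_scale[OF subspace_orth] e1(1) e2(1))
  ultimately have "?v \<in> U" by (rule maximal_mem[OF U])
  then have "B e1 ?v = 0" using e1(1) by (simp add: orth_def)
  then have "B ?v e1 = 0" by (rule hermitian_zero_sym)
  then have "s = 0" using e2(3) e1(2) by (simp add: hermitian_add hermitian_scale)
  then show False using s e1(2) e2(2) q_gt_1[OF q card_field] by simp
qed

lemma hermitian_polar_space:
  assumes "CARD('m) = 2 * n \<or> CARD('m) = 2 * n + 1"
  shows "polar_space (\<lambda>x y. B y x = 0) (\<lambda>x. B x x = 0) n (q * CARD('a) ^ (CARD('m) - 2 * n))"
proof -
  interpret formed_space "\<lambda>x y. B y x = 0" "\<lambda>x. B x x = 0" q by (rule hermitian_formed_space)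
  obtain U where U: "maximal U" using obtain_maximal[OF ts_zero] .
  then have "vec.dim U = n" using hermitian_dim_maximal[OF U] dim_maximal_le[OF U] assms by linarith
  then show ?thesis by (rule polar_spaceI[OF U])
qed

end

subsection \<open>Alternating forms\<close>

context
  fixes B :: "'a::{field,finite} ^ 'm \<Rightarrow> 'a ^ 'm \<Rightarrow> 'a"
  assumes alt: "alternating_form B" and nondeg: "nondegenerate B"
begin

lemma alternating_add: "B x (y + z) = B x y + B x z" "B (x + y) z = B x z + B y z"
  and alternating_scale: "B x (c *s y) = c * B x y" and alternating_self: "B x x = 0"
proof -
  have left: "Vector_Spaces.linear (*s) (*) (\<lambda>u. B u z)"
    and right: "Vector_Spaces.linear (*s) (*) (\<lambda>v. B x v)"
    and self: "B x x = 0" using alt unfolding alternating_form_def bilinear_form_def by blast+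
  show "B x (y + z) = B x y + B x z" "B (x + y) z = B x z + B y z" "B x (c *s y) = c * B x y" "B x x = 0"
    by (rule linearD(1)[OF right] linearD(1)[OF left] linearD(2)[OF right] self)+
qed

lemma alternating_zero_sym: "B x y = 0 \<Longrightarrow> B y x = 0"
  using alternating_self[of "x + y"] alternating_self[of x] alternating_self[of y]
  by (simp add: alternating_add)

lemma alternating_formed_space: "formed_space (\<lambda>x y. B x y = 0) (\<lambda>x. True) CARD('a)"
proof -
  interpret perp_space "\<lambda>x y. B x y = 0"
    by (rule perp_spaceI[of B, OF alternating_add(1) alternating_scale alternating_zero_sym])
  show ?thesis
    by unfold_locales (use nondeg alternating_self in \<open>auto simp: nondegenerate_def\<close>)
qed

lemma alternating_ts_subspaces: "singular_space.ts_subspaces (\<lambda>x y. B x y = 0) (\<lambda>x. True)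
    = isotropic_subspaces B"
proof -
  interpret formed_space "\<lambda>x y. B x y = 0" "\<lambda>x. True" "CARD('a)" by (rule alternating_formed_space)
  show ?thesis unfolding ts_subspaces_def isotropic_subspaces_def orth_def by blast
qed

lemma alternating_polar_space:
  assumes "CARD('m) = 2 * n"
  shows "polar_space (\<lambda>x y. B x y = 0) (\<lambda>x. True) n CARD('a)"
proof -
  interpret formed_space "\<lambda>x y. B x y = 0" "\<lambda>x. True" "CARD('a)" by (rule alternating_formed_space)
  obtain U where U: "maximal U" using obtain_maximal[OF ts_zero] .
  have "orth U \<subseteq> U" using maximal_mem[OF U] by blast
  then have "vec.dim (orth U) \<le> vec.dim U" by (rule vec.dim_subset)
  then have "vec.dim U = n"
    using dim_orth[OF maximal_ts[OF U]] dim_maximal_le[OF U] assms by linarith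
  from polar_spaceI[OF U this] show ?thesis using assms by simp
qed

end

subsection \<open>Quadratic forms\<close>

lemma card_squares_gt: "CARD('a::{field,finite}) < 2 * card (range (\<lambda>s :: 'a. s\<^sup>2))"
proof -
  let ?S = "range (\<lambda>s :: 'a. s\<^sup>2)"
  have "CARD('a) = card (\<Union>r\<in>?S. {s. s\<^sup>2 = r})" by (rule arg_cong[where f = card]) auto
  also have "\<dots> \<le> (\<Sum>r\<in>?S. card {s. s\<^sup>2 = r})" by (rule card_UN_le) simp
  also have "\<dots> < (\<Sum>r\<in>?S. 2)"
  proof (rule sum_strict_mono_ex1)
    have "card {s :: 'a. s\<^sup>2 = r} \<le> 2" for r using card_power_eq_poly_le[of "[:r:]" 2] by simp
    then show "\<forall>r\<in>?S. card {s. s\<^sup>2 = r} \<le> 2" by blast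
    have "card {s :: 'a. s\<^sup>2 = 0} < 2" by simp
    moreover have "0 \<in> ?S" by (rule range_eqI[of _ _ 0]) simp
    ultimately show "\<exists>r\<in>?S. card {s. s\<^sup>2 = r} < 2" by blast
  qed simp
  finally show ?thesis by (simp add: mult.commute)
qed

text \<open>The sets \<open>{as\<^sup>2}\<close> and \<open>{-c - bt\<^sup>2}\<close> both contain more than half of the scalars and hence meet.\<close>

lemma conic_solvable:
  fixes a b c :: "'a::{field,finite}"
  assumes nonzero: "a \<noteq> 0" "b \<noteq> 0"
  shows "\<exists>s t. a * s\<^sup>2 + b * t\<^sup>2 + c = 0"
proof -
  let ?S = "range (\<lambda>s :: 'a. s\<^sup>2)"
  let ?A = "(\<lambda>r. a * r) ` ?S" and ?B = "(\<lambda>r. - c - b * r) ` ?S"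
  have card_A: "card ?A = card ?S" and card_B: "card ?B = card ?S"
    by (rule card_image; use nonzero in \<open>auto simp: inj_on_def\<close>)+
  have "?A \<inter> ?B \<noteq> {}"
  proof
    assume "?A \<inter> ?B = {}"
    then have "card (?A \<union> ?B) = 2 * card ?S" using card_A card_B by (subst card_Un_disjoint) auto
    moreover have "card (?A \<union> ?B) \<le> CARD('a)" by (intro card_mono) auto
    ultimately show False using card_squares_gt[where ?'a = 'a] by linarith
  qed
  then obtain s t where "a * s\<^sup>2 = - c - b * t\<^sup>2" by blast
  then have "a * s\<^sup>2 + b * t\<^sup>2 + c = 0" by simp
  then show ?thesis by blast
qed

lemma square_surj:
  fixes r :: "'a::{field,finite}"
  assumes "(2 :: 'a) = 0"
  shows "\<exists>s. s\<^sup>2 = r"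
proof -
  have "inj (\<lambda>s :: 'a. s\<^sup>2)"
  proof (rule injI)
    fix s t :: 'a assume "s\<^sup>2 = t\<^sup>2"
    then have "s = t \<or> s = - t" by (simp add: power2_eq_iff)
    moreover have "t + t = 0" using assms by (metis mult_2 mult_zero_left)
    then have "- t = t" by (simp add: neg_eq_iff_add_eq_0)
    ultimately show "s = t" by auto
  qed
  then have "surj (\<lambda>s :: 'a. s\<^sup>2)" by (simp add: finite_UNIV_inj_surj)
  then show ?thesis by (metis surjE)
qed

context
  fixes Q :: "'a::{field,finite} ^ 'm \<Rightarrow> 'a"
  assumes quad: "quadratic_form Q" and nondeg: "nondegenerate_quadratic Q"
begin

lemma polarization_add: "polarization Q x (y + z) = polarization Q x y + polarization Q x z"
  and polarization_scale: "polarization Q x (c *s y) = c * polarization Q x y"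
  and quadratic_scale: "Q (c *s x) = c\<^sup>2 * Q x"
proof -
  have linear: "Vector_Spaces.linear (*s) (*) (\<lambda>v. polarization Q x v)"
    and scale: "Q (c *s x) = c\<^sup>2 * Q x"
    using quad unfolding quadratic_form_def bilinear_form_def by blast+
  show "polarization Q x (y + z) = polarization Q x y + polarization Q x z"
    "polarization Q x (c *s y) = c * polarization Q x y" "Q (c *s x) = c\<^sup>2 * Q x"
    by (rule linearD[OF linear] scale)+
qed

lemma polarization_sym: "polarization Q x y = polarization Q y x"
  by (simp add: polarization_def add.commute)

lemma quadratic_add: "Q (x + y) = Q x + Q y + polarization Q x y"
  by (simp add: polarization_def)

lemma polarization_self: "polarization Q x x = 2 * Q x"
  using quadratic_scale[of 2 x] quadratic_add[of x x]
  by (simp add: vec.scale_left_distrib[of 1 1 x, simplified])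

lemma quadratic_formed_space: "formed_space (\<lambda>x y. polarization Q x y = 0) (\<lambda>x. Q x = 0) 1"
proof -
  interpret perp_space "\<lambda>x y. polarization Q x y = 0"
    by (rule perp_spaceI[of "polarization Q", OF polarization_add polarization_scale])
      (simp add: polarization_sym)
  show ?thesis
  proof unfold_locales
    show "Q 0 = 0" using quadratic_scale[of 0 0] by simp
    show "Q (c *s x) = 0" if "Q x = 0" for c x using that by (simp add: quadratic_scale)
    show "Q (x + y) = 0" if "Q x = 0" "Q y = 0" "polarization Q x y = 0" for x y
      using that by (simp add: quadratic_add)
    show "polarization Q x x = 0" if "Q x = 0" for x using that by (simp add: polarization_self)
    show "card {c. Q (y + c *s x) = 0} = 1" if "Q x = 0" "polarization Q x y \<noteq> 0" for x y
    proof -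
      have "polarization Q y x \<noteq> 0" using that(2) polarization_sym by metis
      then have "{c. Q (y + c *s x) = 0} = {- Q y / polarization Q y x}"
        using that(1)
        by (auto simp: quadratic_add quadratic_scale polarization_scale field_simps add_eq_0_iff)
      then show ?thesis by simp
    qed
    show "x = 0" if "Q x = 0" "\<And>y. polarization Q x y = 0" for x
      using nondeg that unfolding nondegenerate_quadratic_def by blast
  qed
qed

lemma quadratic_ts_subspaces: "singular_space.ts_subspaces (\<lambda>x y. polarization Q x y = 0) (\<lambda>x. Q x = 0)
    = singular_subspaces Q"
proof -
  interpret formed_space "\<lambda>x y. polarization Q x y = 0" "\<lambda>x. Q x = 0" 1
    by (rule quadratic_formed_space)
  have "U \<subseteq> orth U" if U: "vec.subspace U" "\<forall>u\<in>U. Q u = 0" for U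
  proof
    fix y assume y: "y \<in> U"
    show "y \<in> orth U"
    proof (rule orthI)
      fix x assume "x \<in> U"
      then show "polarization Q x y = 0"
        using U y vec.subspace_add[OF U(1)] by (simp add: polarization_def)
    qed
  qed
  then show ?thesis unfolding ts_subspaces_def singular_subspaces_def by blast
qed

lemma quadratic_polar_space:
  assumes "witt_index Q = n"
  shows "polar_space (\<lambda>x y. polarization Q x y = 0) (\<lambda>x. Q x = 0) n (CARD('a) ^ (CARD('m) - 2 * n))"
proof -
  interpret formed_space "\<lambda>x y. polarization Q x y = 0" "\<lambda>x. Q x = 0" 1
    by (rule quadratic_formed_space)
  have n: "n = Max (vec.dim ` ts_subspaces)"
    using assms by (simp add: witt_index_def quadratic_ts_subspaces)
  have dims: "finite (vec.dim ` ts_subspaces)" "vec.dim ` ts_subspaces \<noteq> {}" using ts_zero by auto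
  obtain U where U: "U \<in> ts_subspaces" "vec.dim U = n" using Max_in[OF dims] n by auto
  have dim_le: "vec.dim W \<le> n" if "W \<in> ts_subspaces" for W using Max_ge[OF dims(1)] that n by simp
  have "W = U" if "W \<in> ts_subspaces" "U \<subseteq> W" for W
    using vec.subspace_dim_equal[OF ts_subspace[OF U(1)] ts_subspace[OF that(1)] that(2)]
      dim_le[OF that(1)] U(2) by simp
  then have "maximal U" using U(1) by (simp add: maximal_def)
  from polar_spaceI[OF this U(2)] show ?thesis by simp
qed

lemma quadratic_dim_maximal_char_2:
  assumes U: "formed_space.maximal (\<lambda>x y. polarization Q x y = 0) (\<lambda>x. Q x = 0) U"
    and char_2: "(2 :: 'a) = 0"
  shows "CARD('m) \<le> 2 * vec.dim U + 2"
proof (rule ccontr)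
  interpret formed_space "\<lambda>x y. polarization Q x y = 0" "\<lambda>x. Q x = 0" 1
    by (rule quadratic_formed_space)
  note U_subspace = ts_subspace[OF maximal_ts[OF U]]
  assume "\<not> ?thesis"
  then have dim_orth_U: "vec.dim U + 3 \<le> vec.dim (orth U)"
    using dim_orth[OF maximal_ts[OF U]] by linarith
  obtain e1 where e1: "e1 \<in> orth U" "e1 \<notin> U" "Q e1 \<noteq> 0"
    using ex_nonsingular_orth[OF U order_refl, of "{}"] dim_orth_U by auto
  have "U \<subseteq> vec.span (insert e1 U)" using vec.span_superset by blast
  then obtain e2 where e2: "e2 \<in> orth U" "e2 \<notin> vec.span (insert e1 U)" "polarization Q e1 e2 = 0"
    using ex_nonsingular_orth[OF U, of "vec.span (insert e1 U)" "{e1}"] dim_orth_U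
      dim_span_insert[OF U_subspace e1(2)] by auto
  obtain s where s: "s\<^sup>2 = - Q e2 / Q e1" using square_surj[OF char_2] by blast
  let ?v = "e2 + s *s e1"
  have "polarization Q e2 e1 = 0" using e2(3) polarization_sym by metis
  then have "Q ?v = 0" using e1(3) by (simp add: quadratic_add quadratic_scale polarization_scale s)
  moreover have "?v \<in> orth U"
    by (intro vec.subspace_add[OF subspace_orth] vec.subspace_scale[OF subspace_orth] e1(1) e2(1))
  ultimately have "?v \<in> U" by (rule maximal_mem[OF U])
  then have "(- s) *s e1 + ?v \<in> vec.span (insert e1 U)"
    unfolding span_insert_eq[OF U_subspace] by blast
  then show False using e2(2) by (simp add: vec.scale_minus_left)
qed

lemma quadratic_dim_maximal_odd_char:
  assumes U: "formed_space.maximal (\<lambda>x y. polarization Q x y = 0) (\<lambda>x. Q x = 0) U"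
    and odd_char: "(2 :: 'a) \<noteq> 0"
  shows "CARD('m) \<le> 2 * vec.dim U + 2"
proof (rule ccontr)
  interpret formed_space "\<lambda>x y. polarization Q x y = 0" "\<lambda>x. Q x = 0" 1
    by (rule quadratic_formed_space)
  assume "\<not> ?thesis"
  then have dim_orth_U: "vec.dim U + 3 \<le> vec.dim (orth U)"
    using dim_orth[OF maximal_ts[OF U]] by linarith
  obtain e1 where e1: "e1 \<in> orth U" "Q e1 \<noteq> 0"
    using ex_nonsingular_orth[OF U order_refl, of "{}"] dim_orth_U by auto
  obtain e2 where e2: "e2 \<in> orth U" "Q e2 \<noteq> 0" "polarization Q e1 e2 = 0"
    using ex_nonsingular_orth[OF U order_refl, of "{e1}"] dim_orth_U by auto
  have "card {e1, e2} \<le> 2" by (cases "e1 = e2") simp_all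
  then have "vec.dim U + card {e1, e2} < vec.dim (orth U)" using dim_orth_U by linarith
  then obtain e3 where e3: "e3 \<in> orth U" "Q e3 \<noteq> 0" "polarization Q e1 e3 = 0" "polarization Q e2 e3 = 0"
    using ex_nonsingular_orth[OF U order_refl, of "{e1, e2}"] by (metis finite insertCI)
  obtain s t where conic: "Q e1 * s\<^sup>2 + Q e2 * t\<^sup>2 + Q e3 = 0"
    using conic_solvable[OF e1(2) e2(2)] by blast
  let ?v = "e3 + (s *s e1 + t *s e2)"
  have e3_perp: "polarization Q e3 e1 = 0" "polarization Q e3 e2 = 0"
    using e3(3,4) polarization_sym by metis+
  have "polarization Q (s *s e1) (t *s e2) = 0"
    using e2(3) polarization_sym[of "s *s e1" e2] polarization_sym[of e2 e1]
    by (simp add: polarization_scale)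
  then have "Q ?v = Q e1 * s\<^sup>2 + Q e2 * t\<^sup>2 + Q e3"
    using e3_perp
    by (simp add: quadratic_add quadratic_scale polarization_add polarization_scale algebra_simps)
  then have "Q ?v = 0" using conic by simp
  moreover have "?v \<in> orth U"
    by (intro vec.subspace_add[OF subspace_orth] vec.subspace_scale[OF subspace_orth] e1(1) e2(1) e3(1))
  ultimately have "?v \<in> U" by (rule maximal_mem[OF U])
  then have "polarization Q e3 ?v = 0" using orthD[OF e3(1)] polarization_sym by metis
  then have "2 * Q e3 = 0"
    using e3_perp by (simp add: polarization_add polarization_scale polarization_self)
  then show False using odd_char e3(2) by simp
qed

lemma parabolic_polar_space:
  assumes "CARD('m) = 2 * n + 1"
  shows "polar_space (\<lambda>x y. polarization Q x y = 0) (\<lambda>x. Q x = 0) n CARD('a)"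
proof -
  interpret formed_space "\<lambda>x y. polarization Q x y = 0" "\<lambda>x. Q x = 0" 1
    by (rule quadratic_formed_space)
  obtain U where U: "maximal U" using obtain_maximal[OF ts_zero] .
  have "CARD('m) \<le> 2 * vec.dim U + 2"
    using quadratic_dim_maximal_char_2[OF U] quadratic_dim_maximal_odd_char[OF U] by blast
  then have "vec.dim U = n" using dim_maximal_le[OF U] assms by linarith
  from polar_spaceI[OF U this] show ?thesis using assms by simp
qed

end

section \<open>Steiner systems in classical polar spaces\<close>

context polar_space
begin

lemma generators_ts_subspaces: "generators ts_subspaces = gens"
proof (intro subset_antisym subsetI)
  fix U assume U: "U \<in> generators ts_subspaces"
  then obtain G where G: "G \<in> gens" "U \<subseteq> G" using obtain_gens[of U] by (auto simp: generators_def)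
  then show "U \<in> gens" using U gens_ts[OF G(1)] by (auto simp: generators_def)
next
  fix U assume U: "U \<in> gens"
  have "W = U" if W: "W \<in> ts_subspaces" "U \<subseteq> W" for W
    using vec.subspace_dim_equal[OF gens_subspace[OF U] ts_subspace[OF W(1)] W(2)]
      ts_dim_le[OF W(1)] gens_dim[OF U]
    by simp
  then show "U \<in> generators ts_subspaces" using gens_ts[OF U] by (simp add: generators_def)
qed

lemma steiner_zero_iff:
  assumes "t \<le> n"
  shows "steiner {0} t Y \<longleftrightarrow> steiner_system t ts_subspaces Y"
proof -
  have zero_subset: "{0} \<subseteq> U" if "vec.subspace U" for U :: "('a ^ 'm) set"
    using vec.subspace_0[OF that] by simp
  then have "level {0} t = {S \<in> ts_subspaces. vec.dim S = t}"
    using ts_subspace by (auto simp: level_def)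
  then have blocks: "(\<forall>S\<in>level {0} t. \<exists>!W. W \<in> Y \<and> S \<subseteq> W) \<longleftrightarrow>
      (\<forall>S\<in>ts_subspaces. vec.dim S = t \<longrightarrow> (\<exists>!W. W \<in> Y \<and> S \<subseteq> W))"
    by (simp only: Ball_def mem_Collect_eq imp_conjL)
  have "\<forall>W\<in>Y. {0} \<subseteq> W" if "Y \<subseteq> gens" using that zero_subset gens_subspace by blast
  then show ?thesis
    unfolding steiner_def blocks steiner_system_def generators_ts_subspaces
    using assms ts_zero by (cases "Y \<subseteq> gens") simp_all
qed

lemma steiner_system_residue:
  assumes Y: "steiner_system t ts_subspaces Y" and t: "t \<le> n" "k \<le> t"
  obtains R Y' where "vec.dim R + k = t" "steiner R (vec.dim R + k) Y'"
proof -
  obtain G where G: "G \<in> gens" "{0} \<subseteq> G" using obtain_gens[OF ts_zero] .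
  have "vec.dim {0 :: 'a ^ 'm} + (t - k) \<le> vec.dim G" using gens_dim[OF G(1)] t by simp
  then obtain R where R: "vec.subspace R" "{0} \<subseteq> R" "R \<subseteq> G"
    "vec.dim R = vec.dim {0 :: 'a ^ 'm} + (t - k)"
    using subs_between_nonempty[OF vec.subspace_single_0 gens_subspace[OF G(1)] G(2), of "t - k"]
    by blast
  then have dim_R: "vec.dim R + k = t" using t(2) by simp
  have "R \<in> ts_subspaces" by (rule ts_subset[OF gens_ts[OF G(1)] R(1,3)])
  moreover have "steiner {0} t Y" using steiner_zero_iff[OF t(1)] Y by simp
  ultimately have "steiner R t {W \<in> Y. R \<subseteq> W}"
    using steiner_residue[of "{0}" t Y R] R(2) dim_R by simp
  then show ?thesis using that[OF dim_R] unfolding dim_R by blast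
qed

lemma steiner_system_hyperbolic:
  assumes Y: "steiner_system t ts_subspaces Y" and t: "1 < t" "t < n" and E: "E = 1"
  shows "t = n - 1"
proof (rule ccontr)
  assume "t \<noteq> n - 1"
  obtain R Y' where R: "vec.dim R + 2 = t" and steiner: "steiner R (vec.dim R + 2) Y'"
    by (rule steiner_system_residue[OF Y, of 2]) (use t in auto)
  show False by (rule no_steiner2_hyperbolic[OF steiner E]) (use R t \<open>t \<noteq> n - 1\<close> in linarith)
qed

lemma no_steiner_system_le_CARD:
  assumes Y: "steiner_system t ts_subspaces Y" and t: "1 < t" "t < n" and E: "1 < E" "E \<le> CARD('a)"
  shows False
proof -
  obtain R Y' where R: "vec.dim R + 2 = t" and steiner: "steiner R (vec.dim R + 2) Y'"
    by (rule steiner_system_residue[OF Y, of 2]) (use t in auto)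
  have "CARD('a) \<le> CARD('a)\<^sup>2" unfolding power2_eq_square by (rule le_square)
  then have E_bounds: "0 < E" "E \<le> CARD('a)\<^sup>2" using E by linarith+
  have "n = r + 3 \<or> even (n - r) \<and> n \<ge> r + 4 \<or> odd (n - r) \<and> n \<ge> r + 5" if "r + 2 = t" for r
    using that t by presburger
  then consider "n = vec.dim R + 3" | "even (n - vec.dim R)" "n \<ge> vec.dim R + 4" | "odd (n - vec.dim R)"
    "n \<ge> vec.dim R + 5"
    using R by blast
  then show False
  proof cases
    assume "n = vec.dim R + 3"
    then show False by (rule no_steiner_rank3[OF steiner _ E])
  next
    assume "even (n - vec.dim R)" "n \<ge> vec.dim R + 4"
    then show False by (rule no_steiner2_even[OF steiner E_bounds, rotated])
  next
    assume "odd (n - vec.dim R)" "n \<ge> vec.dim R + 5"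
    then show False by (rule no_steiner2_odd[OF steiner E_bounds(1) E(2), rotated])
  qed
qed

lemma steiner_system_le_CARD_squared:
  assumes Y: "steiner_system t ts_subspaces Y" and t: "1 < t" "t < n"
    and E: "0 < E" "E \<le> CARD('a)\<^sup>2"
  obtains "t = 2" "odd n" | "t = n - 1" "3 \<le> t"
proof -
  have odd: "odd (n - t)"
  proof (rule ccontr)
    assume even: "\<not> odd (n - t)"
    obtain R Y' where R: "vec.dim R + 2 = t" and steiner: "steiner R (vec.dim R + 2) Y'"
      by (rule steiner_system_residue[OF Y, of 2]) (use t in auto)
    have "even (n - r) \<and> n \<ge> r + 4" if "r + 2 = t" for r using that t even by presburger
    then have "even (n - vec.dim R)" "n \<ge> vec.dim R + 4" using R by blast+
    then show False by (rule no_steiner2_even[OF steiner E, rotated])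
  qed
  have t_max: "t = n - 1" if t_ne_2: "t \<noteq> 2"
  proof (rule ccontr)
    assume "t \<noteq> n - 1"
    obtain R Y' where R: "vec.dim R + 3 = t" and steiner: "steiner R (vec.dim R + 3) Y'"
      by (rule steiner_system_residue[OF Y, of 3]) (use t t_ne_2 in auto)
    have "even (n - r) \<and> n \<ge> r + 6" if "r + 3 = t" for r using that t odd \<open>t \<noteq> n - 1\<close> by presburger
    then have "even (n - vec.dim R)" "n \<ge> vec.dim R + 6" using R by blast+
    then show False by (rule no_steiner3_even[OF steiner E, rotated])
  qed
  show ?thesis
  proof (cases "t = 2")
    case True
    then show ?thesis using that(1) odd t by simp
  next
    case False
    then show ?thesis using that(2) t_max t by simp
  qed
qed

end

lemma no_steiner_system_Two_A_odd:
  assumes q: "primepow q" and P: "classical_polar_space Two_A_odd q n P" and t: "1 < t" "t < n"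
  shows "\<not> steiner_system t (P :: ('a::{field,finite} ^ 'm) set set) Y"
proof
  assume Y: "steiner_system t P Y"
  obtain B where B: "CARD('a) = q\<^sup>2" "hermitian_form q B" "nondegenerate B"
    and m: "CARD('m) = 2 * n"
    and P_eq: "P = isotropic_subspaces B" using P by auto
  interpret polar_space "\<lambda>x y. B y x = 0" "\<lambda>x. B x x = 0" n q
    using hermitian_polar_space[OF q B, of n] m by simp
  have "steiner_system t ts_subspaces Y" using Y hermitian_ts_subspaces[OF q B] P_eq by simp
  moreover have "1 < q" "q \<le> CARD('a)" unfolding B(1)
    using primepow_gt_Suc_0[OF q] by (simp_all add: power2_eq_square)
  ultimately show False using no_steiner_system_le_CARD t by blast
qed

lemma no_steiner_system_Type_C:
  assumes P: "classical_polar_space Type_C q n P" and t: "1 < t" "t < n"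
  shows "\<not> steiner_system t (P :: ('a::{field,finite} ^ 'm) set set) Y"
proof
  assume Y: "steiner_system t P Y"
  obtain B where B: "alternating_form B" "nondegenerate B" and m: "CARD('m) = 2 * n"
    and P_eq: "P = isotropic_subspaces B" using P by auto
  interpret polar_space "\<lambda>x y. B x y = 0" "\<lambda>x. True" n "CARD('a)"
    by (rule alternating_polar_space[OF B m])
  have "steiner_system t ts_subspaces Y" using Y alternating_ts_subspaces[OF B] P_eq by simp
  then show False using no_steiner_system_le_CARD[OF _ t CARD_field_gt_1 order_refl] by blast
qed

lemma no_steiner_system_Type_B:
  assumes P: "classical_polar_space Type_B q n P" and t: "1 < t" "t < n"
  shows "\<not> steiner_system t (P :: ('a::{field,finite} ^ 'm) set set) Y"
proof
  assume Y: "steiner_system t P Y"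
  obtain Q where Q: "quadratic_form Q" "nondegenerate_quadratic Q" and m: "CARD('m) = 2 * n + 1"
    and P_eq: "P = singular_subspaces Q" using P by auto
  interpret polar_space "\<lambda>x y. polarization Q x y = 0" "\<lambda>x. Q x = 0" n "CARD('a)"
    by (rule parabolic_polar_space[OF Q m])
  have "steiner_system t ts_subspaces Y" using Y quadratic_ts_subspaces[OF Q] P_eq by simp
  then show False using no_steiner_system_le_CARD[OF _ t CARD_field_gt_1 order_refl] by blast
qed

lemma steiner_system_Type_D:
  assumes P: "classical_polar_space Type_D q n P" and t: "1 < t" "t < n"
    and Y: "steiner_system t (P :: ('a::{field,finite} ^ 'm) set set) Y"
  shows "t = n - 1"
proof -
  obtain Q where Q: "quadratic_form Q" "nondegenerate_quadratic Q" and m: "CARD('m) = 2 * n"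
    and witt: "witt_index Q = n" and P_eq: "P = singular_subspaces Q" using P by auto
  interpret polar_space "\<lambda>x y. polarization Q x y = 0" "\<lambda>x. Q x = 0" n 1
    using quadratic_polar_space[OF Q witt] m by simp
  have "steiner_system t ts_subspaces Y" using Y quadratic_ts_subspaces[OF Q] P_eq by simp
  then show ?thesis by (rule steiner_system_hyperbolic[OF _ t refl])
qed

lemma steiner_system_Two_A_even:
  assumes q: "primepow q" and P: "classical_polar_space Two_A_even q n P" and t: "1 < t" "t < n"
    and Y: "steiner_system t (P :: ('a::{field,finite} ^ 'm) set set) Y"
  shows "t = 2 \<and> odd n \<or> t = n - 1 \<and> q \<ge> 3"
proof -
  obtain B where B: "CARD('a) = q\<^sup>2" "hermitian_form q B" "nondegenerate B"
    and m: "CARD('m) = 2 * n + 1"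
    and P_eq: "P = isotropic_subspaces B" using P by auto
  have q_gt_1: "1 < q" using primepow_gt_Suc_0[OF q] by simp
  have "q * CARD('a) ^ (CARD('m) - 2 * n) = q ^ 3"
    by (simp add: B(1) m power2_eq_square power3_eq_cube)
  then interpret polar_space "\<lambda>x y. B y x = 0" "\<lambda>x. B x x = 0" n "q ^ 3"
    using hermitian_polar_space[OF q B, of n] m by simp
  have Y_ts: "steiner_system t ts_subspaces Y" using Y hermitian_ts_subspaces[OF q B] P_eq by simp
  have "q ^ 3 \<le> q ^ 4" using q_gt_1 by (intro power_increasing) auto
  then have "0 < q ^ 3" "q ^ 3 \<le> CARD('a)\<^sup>2" unfolding B(1)
    using q_gt_1 by (simp_all flip: power_mult)
  from Y_ts t this show ?thesis
  proof (rule steiner_system_le_CARD_squared)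
    assume t_max: "t = n - 1" "3 \<le> t"
    have "q \<noteq> 2"
    proof
      assume "q = 2"
      obtain R Y' where R: "vec.dim R + 3 = t" "steiner R (vec.dim R + 3) Y'"
        by (rule steiner_system_residue[OF Y_ts, of 3]) (use t_max t in auto)
      have "n = vec.dim R + 4" using R(1) t_max t by linarith
      with R(2) show False by (rule no_steiner_rank4_hermitian) (use \<open>q = 2\<close> B(1) in auto)
    qed
    then show ?thesis using t_max(1) q_gt_1 by simp
  qed simp
qed

lemma no_steiner_system_elliptic_binary:
  fixes Q :: "'a::{field,finite} ^ 'm \<Rightarrow> 'a"
  assumes Q: "quadratic_form Q" "nondegenerate_quadratic Q" "witt_index Q = n"
    and m: "CARD('m) = 2 * n + 2"
    and q: "CARD('a) = 2" and t: "t = n - 1" "3 \<le> t"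
  shows "\<not> steiner_system t (singular_subspaces Q) Y"
proof
  assume Y: "steiner_system t (singular_subspaces Q) Y"
  interpret polar_space "\<lambda>x y. polarization Q x y = 0" "\<lambda>x. Q x = 0" n 4
    using quadratic_polar_space[OF Q] m q by simp
  have "steiner_system t ts_subspaces Y" using Y quadratic_ts_subspaces[OF Q(1,2)] by simp
  then obtain R Y' where R: "vec.dim R + 2 = t" "steiner R (vec.dim R + 2) Y'"
    by (rule steiner_system_residue[where k = 2]) (use t in auto)
  have add_eq_0: "a + b = 0 \<longleftrightarrow> (a = 0 \<longleftrightarrow> b = 0)" for a b :: 'a
    using binary_field_cases[OF q, of a] binary_field_cases[OF q, of b]
      binary_field_one_add_one[OF q] by auto
  have "binary_elliptic (\<lambda>x y. polarization Q x y = 0) (\<lambda>x. Q x = 0) n R Y'"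
  proof unfold_locales
    show "CARD('a) = 2" by (rule q)
    show "polarization Q x (y + z) = 0 \<longleftrightarrow> (polarization Q x y = 0 \<longleftrightarrow> polarization Q x z = 0)"
      for x y z
      unfolding polarization_add[OF Q(1,2)] add_eq_0 ..
    show "Q (x + y) = 0 \<longleftrightarrow> ((Q x = 0 \<longleftrightarrow> Q y = 0) \<longleftrightarrow> polarization Q x y = 0)" for x y
      unfolding quadratic_add[OF Q(1,2)] add_eq_0 ..
    show "n = vec.dim R + 3" using R t by linarith
    show "steiner R (vec.dim R + 2) Y'" by (rule R(2))
  qed
  then show False by (rule binary_elliptic.no_steiner_rank3_elliptic_binary)
qed

lemma steiner_system_Two_D:
  assumes P: "classical_polar_space Two_D q n P" and t: "1 < t" "t < n"
    and Y: "steiner_system t (P :: ('a::{field,finite} ^ 'm) set set) Y"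
  shows "t = 2 \<and> odd n \<or> t = n - 1 \<and> q \<ge> 3"
proof -
  obtain Q where Q: "quadratic_form Q" "nondegenerate_quadratic Q" "witt_index Q = n"
    and q: "CARD('a) = q" and m: "CARD('m) = 2 * n + 2" and P_eq: "P = singular_subspaces Q"
      using P by auto
  interpret polar_space "\<lambda>x y. polarization Q x y = 0" "\<lambda>x. Q x = 0" n "CARD('a)\<^sup>2"
    using quadratic_polar_space[OF Q] m by simp
  have "steiner_system t ts_subspaces Y" using Y quadratic_ts_subspaces[OF Q(1,2)] P_eq by simp
  moreover have "0 < CARD('a)\<^sup>2" by simp
  ultimately show ?thesis
  proof (rule steiner_system_le_CARD_squared[OF _ t _ order_refl])
    assume t_max: "t = n - 1" "3 \<le> t"
    then have "q \<noteq> 2" using no_steiner_system_elliptic_binary[OF Q m] Y P_eq q by blast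
    moreover have "1 < q" using CARD_field_gt_1[where ?'a = 'a] q by simp
    ultimately show ?thesis using t_max(1) by simp
  qed simp
qed

theorem theorem1p1:
  fixes P :: "('a::{field,finite} ^ 'm) set set"
    and T :: polar_type and q n t :: nat
  assumes "primepow q"
    and "classical_polar_space T q n P"
    and "1 < t" and "t < n"
    and "\<exists>Y. steiner_system t P Y"
  shows "(t = 2 \<and> (T = Two_A_even \<or> T = Two_D) \<and> odd n) \<or>
         (t = n - 1 \<and> (((T = Two_A_even \<or> T = Two_D) \<and> q \<ge> 3) \<or> T = Type_D))"
proof -
  obtain Y where Y: "steiner_system t P Y" using assms(5) by blast
  note q = assms(1) and t = assms(3,4)
  show ?thesis
  proof (cases T)
    case Two_A_odd
    then show ?thesis using no_steiner_system_Two_A_odd[OF q _ t] assms(2) Y by blast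
  next
    case Two_A_even
    then show ?thesis using steiner_system_Two_A_even[OF q _ t Y] assms(2) by simp
  next
    case Type_C
    then show ?thesis using no_steiner_system_Type_C[OF _ t] assms(2) Y by blast
  next
    case Type_D
    then show ?thesis using steiner_system_Type_D[OF _ t Y] assms(2) by simp
  next
    case Type_B
    then show ?thesis using no_steiner_system_Type_B[OF _ t] assms(2) Y by blast
  next
    case Two_D
    then show ?thesis using steiner_system_Two_D[OF _ t Y] assms(2) by simp
  qed
qed

end
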